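(* For every $c\ge1$, let $\mathcal{M}_c$ be a polytope whose normal fan is $\mathsf{DKK}_{\mathrm{red}}(H_{c,2})$, and let $\Pi_{c+1}$ be the $c$-dimensional permutohedron. Then $f_i(\mathcal{M}_c)=f_i(\Pi_{c+1})$ for all $0\le i\le c$. However, for $c\ge3$, $\mathcal{M}_c$ and $\Pi_{c+1}$ are not combinatorially isomorphic.
   Context: $H_{c,2}$ is the directed graph with vertex set $\{0,\dots,c+1\}\times\{1,2\}$, edges $(a,b)\to(a+1,b)$ for $0\le a\le c$ and $(a,1)\to(a,2)$, $(a,2)\to(a,1)$ for $1\le a\le c$, with the two edges of each $2$-cycle coloured red and all other edges blue. Routes are the $2$-cycles and directed walks from a source $(0,b)$ to a sink $(c+1,b')$; a walk is good if it does not traverse both edges of some $2$-cycle consecutively. Two routes $\rho,\rho'$ are incompatible if both are source-to-sink walks and there is a common subwalk $S$ (possibly a vertex) with $\rho=PSQ$, $\rho'=P'SQ'$, the last edge of $P$ and first edge of $Q'$ blue, and the first edge of $Q$ and last edge of $P'$ red; exceptional routes are those compatible with every route. $\mathsf{DKK}(H_{c,2})$ is the complete simplicial fan in $\mathbb{R}^E$ whose cones are spanned by indicator vectors of sets of pairwise compatible routes among the $2$-cycles and good routes (a unimodular triangulation of the cone of nonnegative flows balanced at internal vertices); $\mathsf{DKK}_{\mathrm{red}}(H_{c,2})$ is its projection to the quotient of the balanced flow space by the span of indicator vectors of exceptional routes. Such a polytope $\mathcal{M}_c$ exists (the mutoperhedron). $f_i$ denotes the number of $i$-dimensional faces. *)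

theory Defs
  imports "HOL-Analysis.Analysis"
begin

section \<open>The graph \<open>H\<^sub>c\<^sub>,\<^sub>2\<close> and its routes\<close>

type_synonym vertex = "nat \<times> nat"
type_synonym edge = "vertex \<times> vertex"

definition blue_edges :: "nat \<Rightarrow> edge set" where
  "blue_edges c = {((a, b), (a + 1, b)) | a b. a \<le> c \<and> b \<in> {1, 2}}"

definition red_edges :: "nat \<Rightarrow> edge set" where
  "red_edges c = (\<Union>a\<in>{1..c}. {((a, 1), (a, 2)), ((a, 2), (a, 1))})"

definition edges :: "nat \<Rightarrow> edge set" where
  "edges c = blue_edges c \<union> red_edges c"

definition two_cycles :: "nat \<Rightarrow> edge set set" where
  "two_cycles c = (\<lambda>a. {((a, 1), (a, 2)), ((a, 2), (a, 1))}) ` {1..c}"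

definition internal_vertices :: "nat \<Rightarrow> vertex set" where
  "internal_vertices c = {1..c} \<times> {1, 2}"

text \<open>The graph has no parallel edges, so a walk is given by its list of vertices.  A 2-cycle,
  which has no distinguished starting point, is given by its set of edges.\<close>

datatype route = TwoCycle "edge set" | Walk "vertex list"

definition walk_edges :: "vertex list \<Rightarrow> edge list" where
  "walk_edges w = zip w (tl w)"

definition source_sink_walk :: "nat \<Rightarrow> vertex list \<Rightarrow> bool" where
  "source_sink_walk c w \<longleftrightarrow>
     w \<noteq> [] \<and> set (walk_edges w) \<subseteq> edges c \<and> hd w \<in> {0} \<times> {1, 2} \<and> last w \<in> {c + 1} \<times> {1, 2}"

definition routes :: "nat \<Rightarrow> route set" where
  "routes c = TwoCycle ` two_cycles c \<union> Walk ` {w. source_sink_walk c w}"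

definition good_walk :: "nat \<Rightarrow> vertex list \<Rightarrow> bool" where
  "good_walk c w \<longleftrightarrow> \<not> (\<exists>es e e' es'. walk_edges w = es @ [e, e'] @ es' \<and> {e, e'} \<in> two_cycles c)"

definition good_routes :: "nat \<Rightarrow> route set" where
  "good_routes c = Walk ` {w. source_sink_walk c w \<and> good_walk c w}"

text \<open>In terms of vertex lists, the common subwalk \<open>S\<close> is the nonempty list of its vertices
  (a singleton if \<open>S\<close> is a vertex), and \<open>P\<close>, \<open>Q\<close> are listed without the endpoint they share with
  \<open>S\<close>.  So the last edge of \<open>P\<close> is \<open>(last P, hd S)\<close> and the first edge of \<open>Q\<close> is
  \<open>(last S, hd Q)\<close>.\<close>

definition conflict :: "nat \<Rightarrow> route \<Rightarrow> route \<Rightarrow> bool" where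
  "conflict c \<rho> \<rho>' \<longleftrightarrow>
     (\<exists>P S Q P' Q'. \<rho> = Walk (P @ S @ Q) \<and> \<rho>' = Walk (P' @ S @ Q') \<and>
        S \<noteq> [] \<and> P \<noteq> [] \<and> Q \<noteq> [] \<and> P' \<noteq> [] \<and> Q' \<noteq> [] \<and>
        (last P, hd S) \<in> blue_edges c \<and> (last S, hd Q) \<in> red_edges c \<and>
        (last P', hd S) \<in> red_edges c \<and> (last S, hd Q') \<in> blue_edges c)"

definition compatible :: "nat \<Rightarrow> route \<Rightarrow> route \<Rightarrow> bool" where
  "compatible c \<rho> \<rho>' \<longleftrightarrow> \<not> conflict c \<rho> \<rho>' \<and> \<not> conflict c \<rho>' \<rho>"

definition exceptional_routes :: "nat \<Rightarrow> route set" where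
  "exceptional_routes c = {\<rho> \<in> routes c. \<forall>\<rho>'\<in>routes c. compatible c \<rho> \<rho>'}"

section \<open>The fans\<close>

text \<open>The space \<open>\<real>\<^sup>E\<close> is modelled by \<^typ>\<open>real ^ 'e\<close>, for a finite type \<^typ>\<open>'e\<close> that a bijection
  \<open>lab\<close> onto \<^term>\<open>edges c\<close> identifies with the edge set.\<close>

primrec route_edges :: "route \<Rightarrow> edge set" where
  "route_edges (TwoCycle C) = C"
| "route_edges (Walk w) = set (walk_edges w)"

definition indicator_vector :: "('e::finite \<Rightarrow> edge) \<Rightarrow> route \<Rightarrow> real ^ 'e" where
  "indicator_vector lab \<rho> = (\<chi> e. indicator (route_edges \<rho>) (lab e))"

definition balanced_flows :: "nat \<Rightarrow> ('e::finite \<Rightarrow> edge) \<Rightarrow> (real ^ 'e) set" where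
  "balanced_flows c lab =
     {x. \<forall>v\<in>internal_vertices c. (\<Sum>e | snd (lab e) = v. x $ e) = (\<Sum>e | fst (lab e) = v. x $ e)}"

definition DKK :: "nat \<Rightarrow> ('e::finite \<Rightarrow> edge) \<Rightarrow> (real ^ 'e) set set" where
  "DKK c lab =
     {convex_cone hull (indicator_vector lab ` K) | K.
        K \<subseteq> TwoCycle ` two_cycles c \<union> good_routes c \<and> pairwise (compatible c) K}"

definition exceptional_span :: "nat \<Rightarrow> ('e::finite \<Rightarrow> edge) \<Rightarrow> (real ^ 'e) set" where
  "exceptional_span c lab = span (indicator_vector lab ` exceptional_routes c)"

text \<open>There is no quotient of vector spaces in the library: we say instead that \<open>q\<close>, restricted to
  the subspace \<open>F\<close>, is a realisation of the projection \<open>F \<rightarrow> F / L\<close>, i.e. a linear surjection with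
  kernel \<open>L\<close>.  The values of \<open>q\<close> outside \<open>F\<close> are irrelevant.\<close>

definition quotient_projection ::
    "'a::real_vector set \<Rightarrow> 'a set \<Rightarrow> ('a \<Rightarrow> 'b::real_vector) \<Rightarrow> bool" where
  "quotient_projection F L q \<longleftrightarrow> linear q \<and> q ` F = UNIV \<and> {x \<in> F. q x = 0} = L"

definition DKK_red ::
    "nat \<Rightarrow> ('e::finite \<Rightarrow> edge) \<Rightarrow> (real ^ 'e \<Rightarrow> 'q::euclidean_space) \<Rightarrow> 'q set set" where
  "DKK_red c lab q = (\<lambda>C. q ` C) ` DKK c lab"

section \<open>Polytopes\<close>

text \<open>Outer normal cones, with the dual space identified with the space itself through the inner
  product.  (Inner normal cones amount to replacing the polytope by its negative.)\<close>

definition normal_cone :: "'a::euclidean_space set \<Rightarrow> 'a set \<Rightarrow> 'a set" where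
  "normal_cone P F = {y. \<forall>x\<in>F. \<forall>z\<in>P. y \<bullet> z \<le> y \<bullet> x}"

definition normal_fan :: "'a::euclidean_space set \<Rightarrow> 'a set set" where
  "normal_fan P = {normal_cone P F | F. F face_of P \<and> F \<noteq> {}}"

definition num_faces :: "nat \<Rightarrow> 'a::euclidean_space set \<Rightarrow> nat" where
  "num_faces i P = card {F. F face_of P \<and> aff_dim F = int i}"

definition combinatorially_isomorphic ::
    "'a::euclidean_space set \<Rightarrow> 'b::euclidean_space set \<Rightarrow> bool" where
  "combinatorially_isomorphic P Q \<longleftrightarrow>
     (\<exists>\<phi>. bij_betw \<phi> {F. F face_of P} {G. G face_of Q} \<and>
          (\<forall>F F'. F face_of P \<longrightarrow> F' face_of P \<longrightarrow> (F \<subseteq> F' \<longleftrightarrow> \<phi> F \<subseteq> \<phi> F')))"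

definition permutohedron :: "(real ^ 'n::finite) set" where
  "permutohedron = convex hull {(\<chi> i. real (\<sigma> i)) | \<sigma>. bij_betw \<sigma> (UNIV :: 'n set) {1..CARD('n)}}"

end

theory Submission
  imports Defs
begin

text \<open>Modulo the exceptional routes, a good route is the 0/1 vector of the rows of its blue edges, taken
  modulo the all-ones vector: exactly the rays of the braid fan, which is the normal fan of the
  permutohedron.  Only the sets of compatible rays differ.  In both fans, a set of compatible 0/1
  vectors of length \<open>n + 1\<close> is the same as one of length \<open>n\<close> together with a monotone choice of the
  additional bits along a linear order (inclusion for the permutohedron, an order of Gray code type
  for the routes), where at most one vector receives both bits.  The number of choices depends only on the
  number of vectors, so the two complexes have the same face numbers.  They are not isomorphic:
  complementation within a gap of a chain shows that every chain of proper subsets has an even number of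
  one-element extensions, whereas a set of compatible routes with exactly five extensions exists
  as soon as \<open>c \<ge> 3\<close>.\<close>

section \<open>Complexes of 0/1 vectors built one coordinate at a time\<close>

text \<open>Why routes obey such a recursion: in a conflict the shared walk starts where one route
  has just taken a red edge and the other a blue one, and what happens at its end depends on the
  later bits alone. So a new head bit creates a conflict or not according to the two head bits and
  one comparison of the tails, which is what \<open>R_Cons\<close> says. For routes the comparison
  \<open>lt\<close> is a total order; for chains it is strict inclusion. The constant lists are
  extremal for \<open>lt\<close>, hence compatible with everything. They are the rays that vanish in
  the quotient, so the counts have to be corrected for them. Counting cliques says something about
  faces only if the cones are simplicial. For the routes, linear independence is again a consequence
  of the head recursion. The dimension of the polytope is then the size of a largest simplex, and a
  face loses one dimension for each element of its simplex. One-element extensions of a simplex are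
  the facets of its face. Faces of a permutohedron have an even number of them; for
  \<open>c = 3\<close> the other polytope has a pentagon, and coning carries a face with five facets
  to every larger \<open>c\<close>.\<close>

locale head_extension_complex =
  fixes R lt :: "bool list \<Rightarrow> bool list \<Rightarrow> bool"
  assumes R_Nil: "R [] []"
    and R_Cons: "length g = length h \<Longrightarrow>
      R (x # g) (y # h) \<longleftrightarrow> R g h \<and> (lt g h \<longrightarrow> x \<le> y) \<and> (lt h g \<longrightarrow> y \<le> x)"
    and lt_irrefl: "\<not> lt h h"
    and lt_trans: "lt f g \<Longrightarrow> lt g h \<Longrightarrow> length f = length g \<Longrightarrow> length g = length h \<Longrightarrow> lt f h"
    and lt_total: "R g h \<Longrightarrow> length g = length h \<Longrightarrow> g \<noteq> h \<Longrightarrow> lt g h \<or> lt h g"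
    and lt_least: "h \<noteq> replicate (length h) False \<Longrightarrow> lt (replicate (length h) False) h"
    and lt_greatest: "h \<noteq> replicate (length h) True \<Longrightarrow> lt h (replicate (length h) True)"
begin

lemma lt_asym: "lt g h \<Longrightarrow> length g = length h \<Longrightarrow> \<not> lt h g"
  using lt_trans lt_irrefl by metis

lemma R_refl: "R h h"
  by (induction h) (auto simp: R_Nil R_Cons)

lemma R_sym: "length g = length h \<Longrightarrow> R g h \<Longrightarrow> R h g"
  by (induction g h rule: list_induct2) (auto simp: R_Cons)

text \<open>A constant tail is extremal for \<open>lt\<close>, so only one of the two monotonicity
  conditions can apply, and the constant head bit \<open>b\<close> satisfies it.\<close>

lemma R_constant: "R h (replicate (length h) b)"
proof (induction h)
  case Nil
  then show ?case by (simp add: R_Nil)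
next
  case (Cons x h)
  have "\<not> lt h (replicate (length h) False)" "\<not> lt (replicate (length h) True) h"
    using lt_least[of h] lt_greatest[of h] lt_asym lt_irrefl by (metis length_replicate)+
  with Cons show ?case by (cases b) (auto simp: R_Cons)
qed

definition cliques :: "nat \<Rightarrow> bool list set set" where
  "cliques n = {K. K \<subseteq> {h. length h = n} \<and> (\<forall>g\<in>K. \<forall>h\<in>K. R g h)}"

lemma finite_lists: "finite {h :: bool list. length h = n}"
  using finite_lists_length_eq[of "UNIV :: bool set" n] by simp

lemma finite_clique: "K \<in> cliques n \<Longrightarrow> finite K"
  unfolding cliques_def using finite_lists finite_subset by blast

lemma finite_cliques: "finite (cliques n)"
proof -
  have "cliques n \<subseteq> Pow {h. length h = n}" by (auto simp: cliques_def)
  then show ?thesis using finite_lists by (meson finite_Pow_iff finite_subset)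
qed

lemma cliques_0: "cliques 0 = {{}, {[]}}"
  by (auto simp: cliques_def R_Nil)

lemma tl_clique: "K \<in> cliques (Suc n) \<Longrightarrow> tl ` K \<in> cliques n"
  unfolding cliques_def
  by (auto simp: length_Suc_conv subset_iff) (metis R_Cons length_Cons list.sel(3) nat.inject)

text \<open>Extending a clique by one head bit amounts to a monotone choice of bits along a linear
  order; up to the size of the clique, this does not depend on \<open>R\<close>.\<close>

definition rank :: "bool list set \<Rightarrow> bool list \<Rightarrow> nat" where
  "rank L h = card {g \<in> L. lt g h}"

text \<open>On all lists \<open>lt\<close> may be a partial order, but \<open>R\<close> makes it
  total on a clique. Hence counting smaller members yields positions.\<close>

lemma rank_less_iff:
  assumes "L \<in> cliques n" "g \<in> L" "h \<in> L"
  shows "rank L g < rank L h \<longleftrightarrow> lt g h"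
proof -
  have len: "length f = n" if "f \<in> L" for f using that assms(1) by (auto simp: cliques_def)
  have mono: "rank L a < rank L b" if "lt a b" "a \<in> L" "b \<in> L" for a b
  proof -
    have "{g \<in> L. lt g a} \<subset> {g \<in> L. lt g b}"
      using that len lt_trans lt_irrefl by (metis (no_types, lifting) mem_Collect_eq psubsetI subsetI)
    then show ?thesis unfolding rank_def
      using finite_clique[OF assms(1)] by (simp add: psubset_card_mono)
  qed
  show ?thesis
  proof
    assume "rank L g < rank L h"
    then have "g \<noteq> h" "\<not> lt h g" using mono[of h g] assms by auto
    moreover have "R g h" using assms by (auto simp: cliques_def)
    ultimately show "lt g h" using lt_total len assms by metis
  qed (use mono assms in auto)
qed

lemma bij_betw_rank:
  assumes L: "L \<in> cliques n"
  shows "bij_betw (rank L) L {..<card L}"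
proof -
  have len: "length f = n" if "f \<in> L" for f using that assms(1) by (auto simp: cliques_def)
  have fin: "finite L" using finite_clique[OF L] .
  have inj: "inj_on (rank L) L"
  proof (rule inj_onI, rule ccontr)
    fix g h assume *: "g \<in> L" "h \<in> L" "rank L g = rank L h" "g \<noteq> h"
    then have "R g h" using L by (auto simp: cliques_def)
    then have "lt g h \<or> lt h g" using lt_total * len by metis
    then show False using * rank_less_iff[OF L, of g h] rank_less_iff[OF L, of h g] by auto
  qed
  have "rank L ` L \<subseteq> {..<card L}"
  proof
    fix k assume "k \<in> rank L ` L"
    then obtain h where h: "h \<in> L" "k = rank L h" by auto
    have "{g \<in> L. lt g h} \<subset> L" using h lt_irrefl by auto
    then show "k \<in> {..<card L}" using fin h by (simp add: rank_def psubset_card_mono)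
  qed
  moreover have "card (rank L ` L) = card L" using inj by (simp add: card_image)
  ultimately have "rank L ` L = {..<card L}" by (simp add: card_subset_eq)
  with inj show ?thesis by (simp add: bij_betw_def)
qed

end

text \<open>An index with both bits stands for a list that is extended in both ways. Monotonicity
  leaves room for at most one such index, the place where the bits pass from \<open>False\<close> to
  \<open>True\<close>, so \<open>m\<close> can only be \<open>k\<close> or
  \<open>k + 1\<close>.\<close>

definition monotone_extensions :: "nat \<Rightarrow> nat \<Rightarrow> (nat \<times> bool) set set" where
  "monotone_extensions k m =
     {E. fst ` E = {..<k} \<and> (\<forall>(i, x)\<in>E. \<forall>(j, y)\<in>E. i < j \<longrightarrow> x \<le> y) \<and> card E = m}"

context head_extension_complex
begin

text \<open>Record a list by the position of its tail in \<open>L\<close> and by its head bit. Under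
  this bijection \<open>R_Cons\<close> becomes monotonicity along \<open>{..<card L}\<close>, and
  every trace of \<open>R\<close> and \<open>lt\<close> disappears.\<close>

lemma card_clique_extensions:
  assumes L: "L \<in> cliques n"
  shows "card {K \<in> cliques (Suc n). tl ` K = L \<and> card K = m} = card (monotone_extensions (card L) m)"
proof -
  define f where "f h = (rank L (tl h), hd h)" for h :: "bool list"
  define X where "X = {h :: bool list. length h = Suc n \<and> tl h \<in> L}"
  have len: "length f = n" if "f \<in> L" for f using that L by (auto simp: cliques_def)
  have rk: "bij_betw (rank L) L {..<card L}" using bij_betw_rank[OF L] .
  have f: "bij_betw f X ({..<card L} \<times> UNIV)"
  proof (rule bij_betw_imageI)
    show "inj_on f X"
    proof (rule inj_onI)
      fix g h assume *: "g \<in> X" "h \<in> X" "f g = f h"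
      then have "tl g = tl h" using rk unfolding f_def X_def bij_betw_def inj_on_def by auto
      moreover have "hd g = hd h" using * by (simp add: f_def)
      moreover have "g \<noteq> []" "h \<noteq> []" using * by (auto simp: X_def)
      ultimately show "g = h" by (simp add: list.expand)
    qed
    show "f ` X = {..<card L} \<times> UNIV"
    proof
      show "f ` X \<subseteq> {..<card L} \<times> UNIV" using rk by (auto simp: f_def X_def bij_betw_def)
      show "{..<card L} \<times> UNIV \<subseteq> f ` X"
      proof
        fix p :: "nat \<times> bool" assume "p \<in> {..<card L} \<times> UNIV"
        then have "fst p \<in> rank L ` L" using rk by (auto simp: bij_betw_def)
        then obtain h where "h \<in> L" "fst p = rank L h" by auto
        then show "p \<in> f ` X" using len[OF \<open>h \<in> L\<close>]
          by (intro image_eqI[of _ _ "snd p # h"]) (simp_all add: f_def X_def prod_eq_iff)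
      qed
    qed
  qed
  have compat: "R g h \<longleftrightarrow> (rank L (tl g) < rank L (tl h) \<longrightarrow> hd g \<le> hd h) \<and>
      (rank L (tl h) < rank L (tl g) \<longrightarrow> hd h \<le> hd g)" if gh: "g \<in> X" "h \<in> X" for g h
  proof -
    obtain x g' y h' where [simp]: "g = x # g'" "h = y # h'"
      using gh by (cases g; cases h) (auto simp: X_def)
    have "R g' h'" "length g' = length h'" using gh L by (auto simp: X_def cliques_def)
    then show ?thesis using gh by (auto simp: R_Cons X_def rank_less_iff[OF L])
  qed
  \<comment> \<open>The tails lie in the clique \<open>L\<close>, so only the head bit conditions of
    \<open>R_Cons\<close> remain; as \<open>g\<close> and \<open>h\<close> range over all ordered
    pairs, the two conditions merge into one.\<close>
  have XK: "K \<in> cliques (Suc n) \<and> tl ` K = L \<longleftrightarrow>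
      K \<subseteq> X \<and> fst ` f ` K = {..<card L} \<and> (\<forall>(i, x)\<in>f ` K. \<forall>(j, y)\<in>f ` K. i < j \<longrightarrow> x \<le> y)" for K
  proof (cases "K \<subseteq> X")
    case True
    have inj: "inj_on (rank L) L" "rank L ` L = {..<card L}" using rk by (auto simp: bij_betw_def)
    have sub: "tl ` K \<subseteq> L" using True by (auto simp: X_def)
    have "fst ` f ` K = rank L ` tl ` K" by (simp add: image_image f_def)
    then have 1: "fst ` f ` K = {..<card L} \<longleftrightarrow> tl ` K = L"
      using inj_on_image_eq_iff[OF inj(1) sub order_refl] inj(2) by auto
    have "K \<in> cliques (Suc n) \<longleftrightarrow> (\<forall>g\<in>K. \<forall>h\<in>K. R g h)"
      using True by (auto simp: cliques_def X_def)
    also have "\<dots> \<longleftrightarrow> (\<forall>g\<in>K. \<forall>h\<in>K. rank L (tl g) < rank L (tl h) \<longrightarrow> hd g \<le> hd h)"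
      using True compat by (meson subset_iff)
    finally show ?thesis using 1 True by (auto simp: f_def)
  next
    case False
    then show ?thesis by (auto simp: cliques_def X_def)
  qed
  have "bij_betw ((`) f) {K \<in> cliques (Suc n). tl ` K = L \<and> card K = m} (monotone_extensions (card L) m)"
  proof (rule bij_betw_imageI)
    show "inj_on ((`) f) {K \<in> cliques (Suc n). tl ` K = L \<and> card K = m}"
    proof (rule inj_onI)
      fix K K' assume "K \<in> {K \<in> cliques (Suc n). tl ` K = L \<and> card K = m}"
        "K' \<in> {K \<in> cliques (Suc n). tl ` K = L \<and> card K = m}" and eq: "f ` K = f ` K'"
      then have "K \<subseteq> X" "K' \<subseteq> X" using XK[of K] XK[of K'] by simp_all
      then show "K = K'" using eq f inj_on_image_eq_iff unfolding bij_betw_def by blast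
    qed
    have card: "card (f ` K) = card K" if "K \<subseteq> X" for K
      using that f by (meson bij_betw_def card_image inj_on_subset)
    show "(`) f ` {K \<in> cliques (Suc n). tl ` K = L \<and> card K = m} = monotone_extensions (card L) m"
    proof
      show "(`) f ` {K \<in> cliques (Suc n). tl ` K = L \<and> card K = m} \<subseteq> monotone_extensions (card L) m"
      proof
        fix E assume "E \<in> (`) f ` {K \<in> cliques (Suc n). tl ` K = L \<and> card K = m}"
        then obtain K where "K \<in> cliques (Suc n) \<and> tl ` K = L" "card K = m" "E = f ` K" by blast
        then show "E \<in> monotone_extensions (card L) m"
          using card[of K] unfolding XK monotone_extensions_def by simp
      qed
      show "monotone_extensions (card L) m \<subseteq> (`) f ` {K \<in> cliques (Suc n). tl ` K = L \<and> card K = m}"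
      proof
        fix E assume E: "E \<in> monotone_extensions (card L) m"
        then have "fst ` E \<subseteq> {..<card L}" by (simp add: monotone_extensions_def)
        then have "E \<subseteq> {..<card L} \<times> UNIV" by (auto simp: subset_iff)
        then obtain K where K: "K \<subseteq> X" "E = f ` K"
          using f by (metis bij_betw_def subset_imageE)
        then have "card K = m" "K \<in> cliques (Suc n) \<and> tl ` K = L"
          using E card unfolding XK by (auto simp: monotone_extensions_def)
        then show "E \<in> (`) f ` {K \<in> cliques (Suc n). tl ` K = L \<and> card K = m}"
          using K by blast
      qed
    qed
  qed
  then show ?thesis by (rule bij_betw_same_card)
qed

text \<open>Sort the cliques by their set of tails, then these sets by size; \<open>2 ^ n\<close> is
  the number of lists of length \<open>n\<close> and thus bounds the size.\<close>

lemma card_cliques_Suc: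
  "card {K \<in> cliques (Suc n). card K = m} =
     (\<Sum>k\<le>2 ^ n. card {L \<in> cliques n. card L = k} * card (monotone_extensions k m))"
proof -
  have bd: "card L \<le> 2 ^ n" if "L \<in> cliques n" for L
  proof -
    have "card L \<le> card {h :: bool list. length h = n}"
      using that finite_lists by (intro card_mono) (auto simp: cliques_def)
    then show ?thesis using card_lists_length_eq[of "UNIV :: bool set" n] by simp
  qed
  have "{K \<in> cliques (Suc n). card K = m} =
      (\<Union>L\<in>cliques n. {K \<in> cliques (Suc n). tl ` K = L \<and> card K = m})"
    using tl_clique by auto
  also have "card \<dots> = (\<Sum>L\<in>cliques n. card {K \<in> cliques (Suc n). tl ` K = L \<and> card K = m})"
    using finite_cliques by (intro card_UN_disjoint) auto
  also have "\<dots> = (\<Sum>L\<in>cliques n. card (monotone_extensions (card L) m))"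
    by (intro sum.cong refl card_clique_extensions)
  also have "\<dots> = (\<Sum>k\<le>2 ^ n. \<Sum>L\<in>{L \<in> cliques n. card L = k}. card (monotone_extensions (card L) m))"
    using finite_cliques bd by (intro sum.group[symmetric]) auto
  also have "\<dots> = (\<Sum>k\<le>2 ^ n. card {L \<in> cliques n. card L = k} * card (monotone_extensions k m))"
    by (intro sum.cong) auto
  finally show ?thesis .
qed

section \<open>Removing the two constant lists\<close>

definition constants :: "nat \<Rightarrow> bool list set" where
  "constants n = {replicate n False, replicate n True}"

definition reduced_cliques :: "nat \<Rightarrow> bool list set set" where
  "reduced_cliques n = {K \<in> cliques n. K \<inter> constants n = {}}"

lemma clique_Un_constants:
  assumes "K \<in> cliques n" "A \<subseteq> constants n"
  shows "K \<union> A \<in> cliques n"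
proof -
  have len: "length h = n" if "h \<in> K \<union> A" for h
    using that assms by (auto simp: cliques_def constants_def)
  have "R g h" if "g \<in> K \<union> A" "h \<in> K \<union> A" for g h
  proof -
    have "\<exists>b. f = replicate n b" if "f \<in> A" for f using that assms(2) by (auto simp: constants_def)
    moreover have "R f f'" if "f \<in> A" "f' \<in> K \<union> A" for f f'
      using that calculation[of f] len R_constant[of f'] R_sym[of f' f] by auto
    ultimately show ?thesis using that assms(1) R_sym[of g h] R_sym[of h g] len[OF that(1)] len[OF that(2)]
      by (auto simp: cliques_def)
  qed
  with len show ?thesis by (auto simp: cliques_def)
qed

text \<open>The constants are cone points: any set of them can be added to a clique. The weights 1,
  2, 1 count the subsets of the two constants by size; these are distinct lists because
  \<open>n\<close> is positive.\<close>

lemma card_cliques_eq_reduced: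
  assumes "n \<noteq> 0"
  shows "card {K \<in> cliques n. card K = k} =
    card {K \<in> reduced_cliques n. card K = k} + 2 * card {K \<in> reduced_cliques n. Suc (card K) = k} +
    card {K \<in> reduced_cliques n. Suc (Suc (card K)) = k}"
proof -
  let ?F = "replicate n False" and ?T = "replicate n True"
  have ne: "?F \<noteq> ?T" using assms by (cases n) auto
  have fib: "card {K \<in> cliques n. card K = k \<and> K \<inter> constants n = A} =
      card {K \<in> reduced_cliques n. card K + card A = k}" if A: "A \<subseteq> constants n" for A
  proof (rule bij_betw_same_card)
    have finA: "finite A" using A by (auto simp: constants_def intro: finite_subset)
    have *: "card (K - A) + card A = card K" if "K \<in> cliques n" "K \<inter> constants n = A" for K
      using that finite_clique[of K n] finA by (metis Int_lower1 add.commute card_Diff_subset card_mono le_add_diff_inverse)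
    have **: "card (K \<union> A) = card K + card A" if "K \<in> reduced_cliques n" for K
      using that finite_clique[of K n] finA A by (intro card_Un_disjoint) (auto simp: reduced_cliques_def)
    show "bij_betw (\<lambda>K. K - A) {K \<in> cliques n. card K = k \<and> K \<inter> constants n = A}
        {K \<in> reduced_cliques n. card K + card A = k}"
    proof (rule bij_betwI[where g = "\<lambda>K. K \<union> A"])
      show "(\<lambda>K. K - A) \<in> {K \<in> cliques n. card K = k \<and> K \<inter> constants n = A} \<rightarrow>
          {K \<in> reduced_cliques n. card K + card A = k}"
        using * by (auto simp: reduced_cliques_def) (auto simp: cliques_def)
      show "(\<lambda>K. K \<union> A) \<in> {K \<in> reduced_cliques n. card K + card A = k} \<rightarrow>
          {K \<in> cliques n. card K = k \<and> K \<inter> constants n = A}"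
        using ** A clique_Un_constants by (auto simp: reduced_cliques_def)
      show "K - A \<union> A = K" if "K \<in> {K \<in> cliques n. card K = k \<and> K \<inter> constants n = A}" for K
        using that by auto
      show "K \<union> A - A = K" if "K \<in> {K \<in> reduced_cliques n. card K + card A = k}" for K
        using that A by (auto simp: reduced_cliques_def)
    qed
  qed
  have "{K \<in> cliques n. card K = k} =
      (\<Union>A\<in>Pow (constants n). {K \<in> cliques n. card K = k \<and> K \<inter> constants n = A})"
    by (rule set_eqI) simp
  also have "card \<dots> = (\<Sum>A\<in>Pow (constants n). card {K \<in> cliques n. card K = k \<and> K \<inter> constants n = A})"
    using finite_cliques by (intro card_UN_disjoint) (auto simp: constants_def)
  also have "\<dots> = (\<Sum>A\<in>Pow (constants n). card {K \<in> reduced_cliques n. card K + card A = k})"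
    by (intro sum.cong refl fib) auto
  also have "Pow (constants n) = {{}, {?F}, {?T}, {?F, ?T}}"
    by (auto simp: constants_def Pow_insert)
  also have "(\<Sum>A\<in>\<dots>. card {K \<in> reduced_cliques n. card K + card A = k}) =
      card {K \<in> reduced_cliques n. card K = k} + 2 * card {K \<in> reduced_cliques n. Suc (card K) = k} +
      card {K \<in> reduced_cliques n. Suc (Suc (card K)) = k}"
    using ne by (simp add: doubleton_eq_iff)
  finally show ?thesis .
qed

text \<open>Add up the coefficients over each fibre of \<open>tl\<close>. By induction these sums
  vanish for every tail except possibly the all-\<open>False\<close> one, so a tail that occurs with
  one head bit only has coefficient 0. What remains is a single doubled tail or the list
  \<open>True # replicate n False\<close>, never both, and the equation of the head coordinate
  settles it.\<close>

lemma clique_linearly_independent: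
  fixes u :: "bool list \<Rightarrow> real"
  assumes "K \<in> cliques n" "replicate n False \<notin> K"
    and "\<And>i. i < n \<Longrightarrow> (\<Sum>h\<in>K. u h * of_bool (h ! i)) = 0"
  shows "\<forall>h\<in>K. u h = 0"
  using assms
proof (induction n arbitrary: K u)
  case 0
  then show ?case by (auto simp: cliques_0)
next
  case (Suc n)
  let ?F = "replicate n False"
  have fin: "finite K" using finite_clique Suc.prems(1) by auto
  have tl: "tl ` K \<in> cliques n" using tl_clique Suc.prems(1) by auto
  have len: "length h = Suc n" if "h \<in> K" for h using that Suc.prems(1) by (auto simp: cliques_def)
  have RK: "R g h" if "g \<in> K" "h \<in> K" for g h using that Suc.prems(1) by (auto simp: cliques_def)
  define U where "U h = (\<Sum>g | g \<in> K \<and> tl g = h. u g)" for h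
  have tl': "tl ` K - {?F} \<in> cliques n" using tl by (auto simp: cliques_def)
  have U0: "\<forall>h\<in>tl ` K - {?F}. U h = 0"
  proof (rule Suc.IH[OF tl'])
    fix i assume i: "i < n"
    have "(\<Sum>h\<in>tl ` K - {?F}. U h * of_bool (h ! i)) = (\<Sum>h\<in>tl ` K. U h * of_bool (h ! i))"
      using fin i by (intro sum.mono_neutral_left) auto
    also have "\<dots> = (\<Sum>h\<in>tl ` K. \<Sum>g | g \<in> K \<and> tl g = h. u g * of_bool (g ! Suc i))"
    proof (intro sum.cong refl)
      fix h assume "h \<in> tl ` K"
      have "U h * of_bool (h ! i) = (\<Sum>g | g \<in> K \<and> tl g = h. u g * of_bool (h ! i))"
        by (simp add: U_def sum_distrib_right)
      also have "\<dots> = (\<Sum>g | g \<in> K \<and> tl g = h. u g * of_bool (g ! Suc i))"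
        using len by (intro sum.cong refl) (auto simp: nth_tl i)
      finally show "U h * of_bool (h ! i) = (\<Sum>g | g \<in> K \<and> tl g = h. u g * of_bool (g ! Suc i))" .
    qed
    also have "\<dots> = (\<Sum>g\<in>K. u g * of_bool (g ! Suc i))"
      using fin by (intro sum.group) auto
    also have "\<dots> = 0" using Suc.prems(3)[of "Suc i"] i by simp
    finally show "(\<Sum>h\<in>tl ` K - {?F}. U h * of_bool (h ! i)) = 0" .
  qed auto
  have fibre: "{g \<in> K. tl g = h} \<subseteq> {True # h, False # h}" for h
  proof
    fix g assume "g \<in> {g \<in> K. tl g = h}"
    then have "length g = Suc n" "tl g = h" using len by auto
    then obtain x where "g = x # h" by (cases g) auto
    then show "g \<in> {True # h, False # h}" by (cases x) auto
  qed
  have single: "u (x # h) = 0" if "x # h \<in> K" "(\<not> x) # h \<notin> K" "h \<noteq> ?F" for x h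
  proof -
    have "{g \<in> K. tl g = h} = {x # h}" using fibre[of h] that by (cases x) auto
    then have "U h = u (x # h)" by (simp add: U_def)
    moreover have "h \<in> tl ` K" using that by force
    ultimately show ?thesis using U0 that by auto
  qed
  have hd0: "(\<Sum>h\<in>K. u h * of_bool (hd h)) = 0"
  proof -
    have "(\<Sum>h\<in>K. u h * of_bool (hd h)) = (\<Sum>h\<in>K. u h * of_bool (h ! 0))"
      using len by (intro sum.cong refl) (metis hd_conv_nth length_0_conv nat.distinct(1))
    then show ?thesis using Suc.prems(3)[of 0] by simp
  qed
  have F: "False # ?F \<notin> K" using Suc.prems(2) by simp
  have double_uniq: "h = h'" if "True # h \<in> K" "False # h \<in> K" "True # h' \<in> K" "False # h' \<in> K" for h h'
  proof (rule ccontr)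
    assume "h \<noteq> h'"
    have l: "length h = length h'" using len[OF that(1)] len[OF that(3)] by simp
    have "R h h'" using RK[of "True # h" "True # h'"] that l by (simp add: R_Cons)
    then consider "lt h h'" | "lt h' h" using lt_total l \<open>h \<noteq> h'\<close> by blast
    then show False
      using RK[of "True # h" "False # h'"] RK[of "True # h'" "False # h"] that l
      by cases (auto simp: R_Cons)
  qed
  \<comment> \<open>The all-\<open>False\<close> tail is least, so a head bit \<open>True\<close> on
    it forces \<open>True\<close> on every other list.\<close>
  have no_double: "False # h \<notin> K" if "True # ?F \<in> K" for h
  proof
    assume *: "False # h \<in> K"
    from len[OF this] have l: "length h = n" by simp
    have "h \<noteq> ?F" using * F by auto
    then have "lt ?F h" using lt_least[of h] l by simp
    then show False using RK[OF that *] l by (simp add: R_Cons)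
  qed
  have True0: "u (True # h) = 0" if "True # h \<in> K" for h
  proof -
    \<comment> \<open>In either case no other list with head \<open>True\<close> keeps a nonzero
      coefficient, so the head coordinate reduces to \<open>u (True # h) = 0\<close>.\<close>
    have others: "u g * of_bool (hd g) = 0" if g: "g \<in> K" "g \<noteq> True # h" and h: "h = ?F \<or> False # h \<in> K" for g
    proof (cases g)
      case Nil
      then show ?thesis using len g by force
    next
      case (Cons x g')
      show ?thesis
      proof (cases x)
        case True
        have "g' \<noteq> ?F"
        proof
          assume "g' = ?F"
          with Cons True g no_double h show False by auto
        qed
        moreover have "False # g' \<notin> K"
          using double_uniq[of h g'] no_double[of g'] Cons True g h \<open>True # h \<in> K\<close> by auto
        ultimately have "u g = 0" using single[of True g'] Cons True g by auto
        then show ?thesis by simp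
      qed (use Cons in auto)
    qed
    show ?thesis
    proof (cases "h = ?F \<or> False # h \<in> K")
      case True
      have "(\<Sum>g\<in>K. u g * of_bool (hd g)) = u (True # h) * of_bool (hd (True # h))"
        using fin that others True by (subst sum.remove[of K "True # h"]) (auto intro!: sum.neutral)
      then show ?thesis using hd0 by simp
    next
      case False
      then show ?thesis using single[of True h] that by auto
    qed
  qed
  have False0: "u (False # h) = 0" if "False # h \<in> K" for h
  proof (cases "True # h \<in> K")
    case True
    have "{g \<in> K. tl g = h} = {True # h, False # h}" using fibre[of h] that True by auto
    then have "U h = u (True # h) + u (False # h)" by (simp add: U_def)
    moreover have "h \<in> tl ` K" "h \<noteq> ?F" using that F by force+
    ultimately show ?thesis using U0 True0[OF True] by auto
  next
    case False
    then show ?thesis using single[of False h] that F by auto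
  qed
  show ?case
  proof
    fix h assume "h \<in> K"
    then obtain x g where "h = x # g" using len by (cases h) fastforce+
    then show "u h = 0" using \<open>h \<in> K\<close> True0 False0 by (cases x) auto
  qed
qed

text \<open>This is independence modulo the all-ones vector: that vector joins the clique as a
  further member, with coefficient \<open>- r\<close>.\<close>

lemma reduced_clique_independent:
  fixes u :: "bool list \<Rightarrow> real"
  assumes K: "K \<in> reduced_cliques n"
    and r: "\<And>i. i < n \<Longrightarrow> (\<Sum>h\<in>K. u h * of_bool (h ! i)) = r"
  shows "\<forall>h\<in>K. u h = 0"
proof (cases "n = 0")
  case True
  then show ?thesis using K by (auto simp: reduced_cliques_def cliques_0 constants_def)
next
  case False
  let ?T = "replicate n True"
  let ?u = "u(?T := - r)"
  have T: "?T \<notin> K" using K by (auto simp: reduced_cliques_def constants_def)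
  have "\<forall>h\<in>insert ?T K. ?u h = 0"
  proof (rule clique_linearly_independent)
    show "insert ?T K \<in> cliques n"
      using clique_Un_constants[of K n "{?T}"] K by (simp add: reduced_cliques_def constants_def)
    have "replicate n False \<noteq> ?T" using False by (cases n) auto
    then show "replicate n False \<notin> insert ?T K"
      using K by (auto simp: reduced_cliques_def constants_def)
    fix i assume i: "i < n"
    have "(\<Sum>h\<in>K. ?u h * of_bool (h ! i)) = (\<Sum>h\<in>K. u h * of_bool (h ! i))"
      using T by (intro sum.cong) auto
    moreover have "finite K" using K finite_clique by (auto simp: reduced_cliques_def)
    ultimately show "(\<Sum>h\<in>insert ?T K. ?u h * of_bool (h ! i)) = 0"
      using T r[OF i] i by simp
  qed
  then show ?thesis using T by (auto split: if_splits)
qed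

end

lemma card_cliques_universal:
  assumes "head_extension_complex R lt" "head_extension_complex R' lt'"
  shows "card {K \<in> head_extension_complex.cliques R n. card K = m} =
    card {K \<in> head_extension_complex.cliques R' n. card K = m}"
proof (induction n arbitrary: m)
  case 0
  then show ?case
    by (simp add: head_extension_complex.cliques_0[OF assms(1)] head_extension_complex.cliques_0[OF assms(2)])
next
  case (Suc n)
  then show ?case
    by (simp add: head_extension_complex.card_cliques_Suc[OF assms(1)] head_extension_complex.card_cliques_Suc[OF assms(2)])
qed

text \<open>The formula for all cliques is triangular in the reduced counts, with diagonal entries
  1, and can therefore be inverted by strong induction on \<open>m\<close>.\<close>

lemma card_reduced_cliques_universal:
  assumes "head_extension_complex R lt" "head_extension_complex R' lt'" "n \<noteq> 0"
  shows "card {K \<in> head_extension_complex.reduced_cliques R n. card K = m} =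
    card {K \<in> head_extension_complex.reduced_cliques R' n. card K = m}"
proof (induction m rule: less_induct)
  case (less m)
  have *: "card {K \<in> head_extension_complex.reduced_cliques R n. Suc (card K) = m} =
      card {K \<in> head_extension_complex.reduced_cliques R' n. Suc (card K) = m}"
    using less[of "m - 1"] by (cases m) auto
  have **: "card {K \<in> head_extension_complex.reduced_cliques R n. Suc (Suc (card K)) = m} =
      card {K \<in> head_extension_complex.reduced_cliques R' n. Suc (Suc (card K)) = m}"
    using less[of "m - 2"] by (cases m rule: nat.exhaust; cases "m - 1" rule: nat.exhaust) auto
  show ?case
    using card_cliques_universal[OF assms(1,2), of n m] * **
    unfolding head_extension_complex.card_cliques_eq_reduced[OF assms(1,3)]
      head_extension_complex.card_cliques_eq_reduced[OF assms(2,3)]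
    by simp
qed

section \<open>Polytopes with simplicial normal fan\<close>

text \<open>The normal cone spans the orthogonal complement of the directions of \<open>F\<close>.
  To reach a vector \<open>w\<close> of this complement, perturb an exposing normal \<open>a\<close>
  by a small multiple of \<open>w\<close>: it stays constant on \<open>F\<close>, and the finitely
  many generators outside \<open>F\<close> have a positive gap.\<close>

lemma dim_normal_cone:
  fixes P :: "'a::euclidean_space set"
  assumes P: "polytope P" and F: "F face_of P" "F \<noteq> {}"
  shows "aff_dim F = int DIM('a) - int (dim (normal_cone P F))"
proof -
  have "F exposed_face_of P"
    using P F exposed_face_of_polyhedron polytope_imp_polyhedron by blast
  then obtain a b where ab: "P \<subseteq> {x. a \<bullet> x \<le> b}" "F = P \<inter> {x. a \<bullet> x = b}"
    unfolding exposed_face_of_def by blast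
  obtain V where V: "finite V" "P = convex hull V" using P polytope_def by blast
  have VP: "V \<subseteq> P" by (simp add: V(2) hull_subset)
  obtain x0 where x0: "x0 \<in> F" using F by blast
  define D where "D = span ((\<lambda>x. x - x0) ` F)"
  have "aff_dim F = int (dim ((\<lambda>x. x - x0) ` F))"
    using x0 by (intro aff_dim_eq_dim_subtract) (simp add: hull_inc)
  then have dimD: "aff_dim F = int (dim D)" by (simp add: D_def dim_span)
  let ?O = "{y \<in> UNIV. \<forall>x\<in>D. orthogonal x y}"
  have N_sub: "normal_cone P F \<subseteq> ?O"
  proof
    fix y assume y: "y \<in> normal_cone P F"
    have "orthogonal y x" if "x \<in> D" for x
      using that unfolding D_def
    proof (rule orthogonal_to_span)
      fix z assume "z \<in> (\<lambda>x. x - x0) ` F"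
      then obtain x where x: "x \<in> F" "z = x - x0" by auto
      then have "y \<bullet> x = y \<bullet> x0"
        using y x0 ab(2) by (force simp: normal_cone_def intro: antisym)
      then show "orthogonal y z" using x by (simp add: orthogonal_def inner_diff_right)
    qed
    then show "y \<in> ?O" by (simp add: orthogonal_commute)
  qed
  have "?O \<subseteq> span (normal_cone P F)"
  proof
    fix w assume w: "w \<in> ?O"
    have wF: "w \<bullet> x = w \<bullet> x0" if "x \<in> F" for x
    proof -
      have "x - x0 \<in> D" using that by (auto simp: D_def intro: span_base)
      then have "(x - x0) \<bullet> w = 0" using w by (auto simp: orthogonal_def)
      then show ?thesis by (simp add: inner_diff_right inner_commute)
    qed
    have "\<exists>e>0. \<forall>v\<in>V - F. e * (w \<bullet> v - w \<bullet> x0) \<le> b - a \<bullet> v"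
    proof -
      have gap: "a \<bullet> v < b" if "v \<in> V - F" for v
        using that ab VP by force
      \<comment> \<open>The inserted 1 covers the case of no generator outside \<open>F\<close> and
        ensures \<open>B \<ge> 1\<close>, so that \<open>m / B\<close> is positive.\<close>
      define m where "m = Min (insert 1 ((\<lambda>v. b - a \<bullet> v) ` (V - F)))"
      define B where "B = Max (insert 1 ((\<lambda>v. \<bar>w \<bullet> v - w \<bullet> x0\<bar>) ` (V - F)))"
      have m: "m > 0" "\<And>v. v \<in> V - F \<Longrightarrow> m \<le> b - a \<bullet> v"
        using V(1) gap unfolding m_def by (auto simp: Min_gr_iff)
      have B: "B \<ge> 1" "\<And>v. v \<in> V - F \<Longrightarrow> \<bar>w \<bullet> v - w \<bullet> x0\<bar> \<le> B"
        using V(1) unfolding B_def by auto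
      have "m / B * (w \<bullet> v - w \<bullet> x0) \<le> b - a \<bullet> v" if v: "v \<in> V - F" for v
      proof -
        have "m / B * (w \<bullet> v - w \<bullet> x0) \<le> m / B * B"
          using m B(1) B(2)[OF v] by (intro mult_left_mono) auto
        also have "\<dots> = m" using B by simp
        finally show ?thesis using m(2)[OF v] by simp
      qed
      then show ?thesis using m B by (intro exI[of _ "m / B"]) auto
    qed
    then obtain e where e: "e > 0" "\<And>v. v \<in> V - F \<Longrightarrow> e * (w \<bullet> v - w \<bullet> x0) \<le> b - a \<bullet> v" by auto
    have "a + e *\<^sub>R w \<in> normal_cone P F"
    proof -
      have "V \<subseteq> {z. (a + e *\<^sub>R w) \<bullet> z \<le> (a + e *\<^sub>R w) \<bullet> x0}"
      proof
        fix v assume v: "v \<in> V"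
        show "v \<in> {z. (a + e *\<^sub>R w) \<bullet> z \<le> (a + e *\<^sub>R w) \<bullet> x0}"
        proof (cases "v \<in> F")
          case True
          then show ?thesis using wF[OF True] x0 ab by (simp add: inner_add_left)
        next
          case False
          then show ?thesis using e(2)[of v] v x0 ab by (simp add: inner_add_left algebra_simps)
        qed
      qed
      then have "P \<subseteq> {z. (a + e *\<^sub>R w) \<bullet> z \<le> (a + e *\<^sub>R w) \<bullet> x0}"
        unfolding V(2) by (intro hull_minimal) (auto simp: convex_halfspace_le)
      moreover have "(a + e *\<^sub>R w) \<bullet> x = (a + e *\<^sub>R w) \<bullet> x0" if "x \<in> F" for x
        using wF[OF that] that x0 ab by (simp add: inner_add_left)
      ultimately show ?thesis by (auto simp: normal_cone_def)
    qed
    moreover have "a \<in> normal_cone P F" using ab by (auto simp: normal_cone_def)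
    ultimately have "(1 / e) *\<^sub>R ((a + e *\<^sub>R w) - a) \<in> span (normal_cone P F)"
      by (intro span_scale span_diff span_base)
    then show "w \<in> span (normal_cone P F)" using e by simp
  qed
  then have "dim (normal_cone P F) = dim ?O"
    using N_sub by (metis (no_types, lifting) antisym dim_span dim_subset)
  moreover have "dim ?O + dim D = DIM('a)"
    using dim_subspace_orthogonal_to_vectors[of D UNIV] by (simp add: D_def)
  ultimately show ?thesis using dimD by simp
qed

text \<open>A normal that exposes \<open>F\<close> lies in the normal cone of \<open>F\<close>. If
  it is also normal to \<open>F'\<close>, then the points of \<open>F'\<close> attain the same
  maximum, which happens only on \<open>F\<close>.\<close>

lemma normal_cone_subset_iff:
  assumes "polytope P" "F face_of P" "F \<noteq> {}" "F' face_of P"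
  shows "normal_cone P F \<subseteq> normal_cone P F' \<longleftrightarrow> F' \<subseteq> F"
proof
  assume N: "normal_cone P F \<subseteq> normal_cone P F'"
  have "F exposed_face_of P"
    using assms exposed_face_of_polyhedron polytope_imp_polyhedron by blast
  then obtain a b where ab: "P \<subseteq> {x. a \<bullet> x \<le> b}" "F = P \<inter> {x. a \<bullet> x = b}"
    unfolding exposed_face_of_def by blast
  then have "a \<in> normal_cone P F" by (auto simp: normal_cone_def)
  then have a: "a \<in> normal_cone P F'" using N by blast
  obtain x0 where "x0 \<in> F" using assms by blast
  have "F' \<subseteq> P" using assms(4) face_of_imp_subset by blast
  show "F' \<subseteq> F"
  proof
    fix x assume x: "x \<in> F'"
    then have "a \<bullet> x0 \<le> a \<bullet> x" using a \<open>x0 \<in> F\<close> ab by (auto simp: normal_cone_def)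
    moreover have "a \<bullet> x \<le> b" using x ab \<open>F' \<subseteq> P\<close> by auto
    ultimately show "x \<in> F" using x ab \<open>x0 \<in> F\<close> \<open>F' \<subseteq> P\<close> by auto
  qed
qed (auto simp: normal_cone_def)

text \<open>The permutohedron lies in a hyperplane, so its normal cones contain the line
  \<open>diagonal\<close>; \<open>L\<close> carries such a lineality space. The fan of the routes
  has \<open>L = {0}\<close>.\<close>

definition cone_mod :: "('k \<Rightarrow> 'a::real_vector) \<Rightarrow> 'a set \<Rightarrow> 'k set \<Rightarrow> 'a set" where
  "cone_mod v L K = {(\<Sum>k\<in>K. t k *\<^sub>R v k) + z | t z. (\<forall>k\<in>K. 0 \<le> t k) \<and> z \<in> L}"

lemma convex_cone_hull_eq_cone_mod:
  assumes J: "finite J" and X: "v ` J \<subseteq> X" "X \<subseteq> v ` J \<union> {0}"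
  shows "convex_cone hull X = cone_mod v {0} J"
proof
  have cone: "cone_mod v {0} J = {\<Sum>k\<in>J. t k *\<^sub>R v k | t. \<forall>k\<in>J. 0 \<le> t k}"
    by (simp add: cone_mod_def)
  show "convex_cone hull X \<subseteq> cone_mod v {0} J"
  proof (rule hull_minimal)
    have "v k \<in> cone_mod v {0} J" if "k \<in> J" for k
    proof -
      have "v k = (\<Sum>i\<in>J. (if i = k then 1 else 0) *\<^sub>R v i)"
        using J that by (simp add: if_distrib[of "\<lambda>x. x *\<^sub>R _"] sum.delta cong: if_cong)
      then show ?thesis unfolding cone by fastforce
    qed
    moreover have zero: "0 \<in> cone_mod v {0} J" unfolding cone by (intro CollectI exI[of _ "\<lambda>_. 0"]) simp
    ultimately show "X \<subseteq> cone_mod v {0} J" using X by blast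
    have "x + y \<in> cone_mod v {0} J" if xy: "x \<in> cone_mod v {0} J" "y \<in> cone_mod v {0} J" for x y
    proof -
      obtain s t where "x = (\<Sum>k\<in>J. s k *\<^sub>R v k)" "\<forall>k\<in>J. 0 \<le> s k" "y = (\<Sum>k\<in>J. t k *\<^sub>R v k)" "\<forall>k\<in>J. 0 \<le> t k"
        using xy unfolding cone by blast
      then show ?thesis unfolding cone
        by (intro CollectI exI[of _ "\<lambda>k. s k + t k"]) (simp add: scaleR_add_left sum.distrib)
    qed
    moreover have "a *\<^sub>R x \<in> cone_mod v {0} J" if ax: "x \<in> cone_mod v {0} J" "0 \<le> a" for a x
    proof -
      obtain s where "x = (\<Sum>k\<in>J. s k *\<^sub>R v k)" "\<forall>k\<in>J. 0 \<le> s k"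
        using ax unfolding cone by blast
      then show ?thesis unfolding cone using ax
        by (intro CollectI exI[of _ "\<lambda>k. a * s k"]) (simp add: scaleR_sum_right)
    qed
    ultimately show "convex_cone (cone_mod v {0} J)" using zero unfolding convex_cone_iff by auto
  qed
  show "cone_mod v {0} J \<subseteq> convex_cone hull X"
  proof
    fix x assume "x \<in> cone_mod v {0} J"
    then obtain t where t: "x = (\<Sum>k\<in>J. t k *\<^sub>R v k)" "\<forall>k\<in>J. 0 \<le> t k" unfolding cone by blast
    have "(\<Sum>k\<in>I. t k *\<^sub>R v k) \<in> convex_cone hull X" if "finite I" "I \<subseteq> J" for I
      using that
    proof (induction I rule: finite_induct)
      case empty
      then show ?case by (simp add: convex_cone_hull_contains_0)
    next
      case (insert k I)
      have "t k *\<^sub>R v k \<in> convex_cone hull X"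
        using insert.prems t X by (intro convex_cone_hull_mul hull_inc) auto
      then show ?case using insert by (simp add: convex_cone_hull_add)
    qed
    then show "x \<in> convex_cone hull X" using J t by simp
  qed
qed

text \<open>The set \<open>L\<close> is the lineality space.  That the cones meet along common faces is automatic for a
  normal fan.\<close>

locale simplicial_normal_fan =
  fixes P :: "'a::euclidean_space set" and v :: "'k \<Rightarrow> 'a" and L :: "'a set" and \<K> :: "'k set set"
  assumes polytope: "polytope P"
    and lineality: "subspace L"
    and fan: "normal_fan P = cone_mod v L ` \<K>"
    and finite_simplex: "K \<in> \<K> \<Longrightarrow> finite K"
    and empty_simplex: "{} \<in> \<K>"
    and down_closed: "K \<in> \<K> \<Longrightarrow> J \<subseteq> K \<Longrightarrow> J \<in> \<K>"
    and independent_mod: "K \<in> \<K> \<Longrightarrow> (\<Sum>k\<in>K. u k *\<^sub>R v k) \<in> L \<Longrightarrow> k \<in> K \<Longrightarrow> u k = 0"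
    and rays_distinct: "{k} \<in> \<K> \<Longrightarrow> {k'} \<in> \<K> \<Longrightarrow> s > 0 \<Longrightarrow> v k - s *\<^sub>R v k' \<in> L \<Longrightarrow> k = k'"
begin

text \<open>The cone spans the sum of the span of its rays and \<open>L\<close>. Both the
  independence of the rays and the trivial intersection of the two summands come from
  \<open>independent_mod\<close>.\<close>

lemma dim_cone_mod:
  assumes K: "K \<in> \<K>"
  shows "dim (cone_mod v L K) = card K + dim L"
proof -
  note fin = finite_simplex[OF K]
  have span: "span (cone_mod v L K) = {x + y |x y. x \<in> span (v ` K) \<and> y \<in> span L}"
  proof
    have "cone_mod v L K \<subseteq> {x + y |x y. x \<in> span (v ` K) \<and> y \<in> span L}"
      unfolding cone_mod_def
      by clarsimp (metis (no_types, lifting) image_eqI span_base span_scale span_sum)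
    then show "span (cone_mod v L K) \<subseteq> {x + y |x y. x \<in> span (v ` K) \<and> y \<in> span L}"
      by (intro span_minimal subspace_sums) auto
    have "v k \<in> cone_mod v L K" if "k \<in> K" for k
    proof -
      have "v k = (\<Sum>i\<in>K. (if i = k then 1 else 0) *\<^sub>R v i) + 0"
        using fin that by (simp add: if_distrib[of "\<lambda>x. x *\<^sub>R _"] sum.delta cong: if_cong)
      then show ?thesis unfolding cone_mod_def using subspace_0[OF lineality] by fastforce
    qed
    then have 1: "span (v ` K) \<subseteq> span (cone_mod v L K)" by (intro span_mono) auto
    have "z \<in> cone_mod v L K" if "z \<in> L" for z
    proof -
      have "z = (\<Sum>i\<in>K. 0 *\<^sub>R v i) + z" by simp
      then show ?thesis unfolding cone_mod_def using that by fastforce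
    qed
    then have "span L \<subseteq> span (cone_mod v L K)" by (intro span_mono) auto
    with 1 show "{x + y |x y. x \<in> span (v ` K) \<and> y \<in> span L} \<subseteq> span (cone_mod v L K)"
      by (auto intro: span_add)
  qed
  have inj: "inj_on v K"
  proof (rule inj_onI, rule ccontr)
    fix i j assume *: "i \<in> K" "j \<in> K" "v i = v j" "i \<noteq> j"
    have "(\<Sum>k\<in>K. (if k = i then 1 else if k = j then -1 else 0) *\<^sub>R v k) =
        (\<Sum>k\<in>{i, j}. (if k = i then 1 else if k = j then -1 else 0) *\<^sub>R v k)"
      using * fin by (intro sum.mono_neutral_right) auto
    also have "\<dots> = 0" using * by auto
    finally have "(\<Sum>k\<in>K. (if k = i then 1 else if k = j then -1 else 0) *\<^sub>R v k) \<in> L"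
      using subspace_0[OF lineality] by simp
    from independent_mod[OF K this *(1)] show False by simp
  qed
  have ind: "independent (v ` K)"
    unfolding independent_explicit_finite_subsets
  proof (intro allI impI ballI)
    fix A u x assume A: "A \<subseteq> v ` K" "finite A" "(\<Sum>a\<in>A. u a *\<^sub>R a) = 0" and x: "x \<in> A"
    then obtain J where J: "J \<subseteq> K" "A = v ` J" by (meson subset_imageE)
    have "(\<Sum>j\<in>J. u (v j) *\<^sub>R v j) = 0"
      using A(3) J inj by (simp add: sum.reindex inj_on_subset)
    then have "(\<Sum>j\<in>J. u (v j) *\<^sub>R v j) \<in> L" using subspace_0[OF lineality] by simp
    then have "\<forall>j\<in>J. u (v j) = 0" using independent_mod[OF down_closed[OF K J(1)], of "\<lambda>j. u (v j)"] by blast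
    then show "u x = 0" using x J by auto
  qed
  have "span (v ` K) \<inter> span L = {0}"
  proof -
    have "x = 0" if x_in: "x \<in> span (v ` K)" "x \<in> L" for x
    proof -
      obtain u where "x = (\<Sum>a\<in>v ` K. u a *\<^sub>R a)"
        using x_in(1) fin by (auto simp: span_finite)
      then have x: "x = (\<Sum>k\<in>K. u (v k) *\<^sub>R v k)" using inj by (simp add: sum.reindex)
      then have "\<forall>k\<in>K. u (v k) = 0" using x_in(2) independent_mod[OF K, of "\<lambda>k. u (v k)"] by blast
      then show ?thesis using x by simp
    qed
    then show ?thesis using lineality by (auto simp: span_eq_iff[THEN iffD2] span_zero subspace_0)
  qed
  then have "dim (span (v ` K) \<inter> span L) = 0" by simp
  moreover have "dim (span (cone_mod v L K)) + dim (span (v ` K) \<inter> span L) =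
      dim (span (v ` K)) + dim (span L)"
    unfolding span by (intro dim_sums_Int) auto
  ultimately have "dim (span (cone_mod v L K)) = dim (span (v ` K)) + dim (span L)"
    by linarith
  then show ?thesis
    using ind inj by (simp add: dim_span dim_eq_card_independent card_image)
qed

text \<open>The choice is in fact unique, since by \<open>cone_mod_subset_iff\<close> different
  simplices have different cones.\<close>

definition face_simplex :: "'a set \<Rightarrow> 'k set" where
  "face_simplex F = (SOME K. K \<in> \<K> \<and> normal_cone P F = cone_mod v L K)"

lemma face_simplex:
  assumes "F face_of P" "F \<noteq> {}"
  shows "face_simplex F \<in> \<K>" "normal_cone P F = cone_mod v L (face_simplex F)"
proof -
  have "normal_cone P F \<in> normal_fan P" using assms by (auto simp: normal_fan_def)
  then have "\<exists>K. K \<in> \<K> \<and> normal_cone P F = cone_mod v L K" unfolding fan by auto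
  from someI_ex[OF this] show "face_simplex F \<in> \<K>" "normal_cone P F = cone_mod v L (face_simplex F)"
    by (auto simp: face_simplex_def)
qed

lemma cone_mod_normal_cone:
  assumes "K \<in> \<K>"
  obtains F where "F face_of P" "F \<noteq> {}" "normal_cone P F = cone_mod v L K"
proof -
  have "cone_mod v L K \<in> normal_fan P" using assms fan by simp
  then obtain F where "cone_mod v L K = normal_cone P F" "F face_of P" "F \<noteq> {}"
    unfolding normal_fan_def by blast
  then show ?thesis using that by simp
qed

lemma aff_dim_face:
  assumes "F face_of P" "F \<noteq> {}"
  shows "aff_dim F = int DIM('a) - int (dim L) - int (card (face_simplex F))"
  using dim_normal_cone[OF polytope assms] face_simplex[OF assms] dim_cone_mod by simp

lemma cone_mod_mono:
  assumes "J \<subseteq> K" "K \<in> \<K>"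
  shows "cone_mod v L J \<subseteq> cone_mod v L K"
proof
  fix x assume "x \<in> cone_mod v L J"
  then obtain t z where tz: "x = (\<Sum>k\<in>J. t k *\<^sub>R v k) + z" "\<forall>k\<in>J. 0 \<le> t k" "z \<in> L"
    by (auto simp: cone_mod_def)
  have "(\<Sum>k\<in>J. t k *\<^sub>R v k) = (\<Sum>k\<in>K. (if k \<in> J then t k else 0) *\<^sub>R v k)"
    using assms finite_simplex[OF assms(2)] by (intro sum.mono_neutral_cong_left) auto
  then show "x \<in> cone_mod v L K"
    unfolding cone_mod_def using tz by (intro CollectI exI[of _ "\<lambda>k. if k \<in> J then t k else 0"] exI[of _ z]) auto
qed

text \<open>If \<open>v k = \<Sum>k'\<in>K. t k' v k'\<close> lies in the cone of \<open>K\<close>, then every \<open>v k'\<close> with \<open>t k' > 0\<close> lies in the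
  cone spanned by \<open>v k\<close>, because both are normal cones.\<close>

lemma cone_mod_subset_iff:
  assumes J: "J \<in> \<K>" and K: "K \<in> \<K>"
  shows "cone_mod v L J \<subseteq> cone_mod v L K \<longleftrightarrow> J \<subseteq> K"
proof
  assume sub: "cone_mod v L J \<subseteq> cone_mod v L K"
  show "J \<subseteq> K"
  proof
    fix k assume k: "k \<in> J"
    have kK: "{k} \<in> \<K>" using down_closed[OF J] k by auto
    have single: "x \<in> cone_mod v L {k} \<longleftrightarrow> (\<exists>t z. x = t *\<^sub>R v k + z \<and> 0 \<le> t \<and> z \<in> L)" for x
    proof
      assume "\<exists>t z. x = t *\<^sub>R v k + z \<and> 0 \<le> t \<and> z \<in> L"
      then obtain t z where "x = t *\<^sub>R v k + z" "0 \<le> t" "z \<in> L" by blast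
      then show "x \<in> cone_mod v L {k}"
        unfolding cone_mod_def by (intro CollectI exI[of _ "\<lambda>_. t"] exI[of _ z]) auto
    qed (auto simp: cone_mod_def)
    have "v k \<in> cone_mod v L {k}" unfolding single
      using subspace_0[OF lineality] by (intro exI[of _ 1] exI[of _ 0]) auto
    then have "v k \<in> cone_mod v L K" using sub cone_mod_mono[of "{k}" J] k J by auto
    then obtain t z where tz: "v k = (\<Sum>i\<in>K. t i *\<^sub>R v i) + z" "\<forall>i\<in>K. 0 \<le> t i" "z \<in> L"
      by (auto simp: cone_mod_def)
    have nz: "v k \<notin> L" using independent_mod[OF kK, of "\<lambda>_. 1" k] by auto
    have "\<exists>j\<in>K. t j \<noteq> 0"
    proof (rule ccontr)
      assume "\<not> (\<exists>j\<in>K. t j \<noteq> 0)"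
      then have "(\<Sum>i\<in>K. t i *\<^sub>R v i) = 0" by (intro sum.neutral) auto
      then show False using tz nz by simp
    qed
    then obtain j where j: "j \<in> K" "t j \<noteq> 0" by blast
    obtain F where F: "F face_of P" "F \<noteq> {}" "normal_cone P F = cone_mod v L {k}"
      using cone_mod_normal_cone[OF kK] .
    obtain F' where F': "F' face_of P" "F' \<noteq> {}" "normal_cone P F' = cone_mod v L K"
      using cone_mod_normal_cone[OF K] .
    have "F' \<subseteq> F"
    proof -
      have "cone_mod v L {k} \<subseteq> cone_mod v L K" using sub cone_mod_mono[of "{k}" J] k J by auto
      then show ?thesis using normal_cone_subset_iff[OF polytope F(1,2) F'(1)] F F' by simp
    qed
    \<comment> \<open>A normal cone contains the subspace \<open>L\<close> and hence both signs of
      each of its vectors, which are therefore constant on \<open>P\<close>.\<close>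
    have L_const: "y \<bullet> x = y \<bullet> x'" if "y \<in> L" "x \<in> P" "x' \<in> F" for y x x'
    proof -
      have "w \<in> cone_mod v L {k}" if "w \<in> L" for w
        unfolding single using that by (intro exI[of _ "0 :: real"] exI[of _ w]) auto
      then have "y \<in> cone_mod v L {k}" "- y \<in> cone_mod v L {k}"
        using that subspace_neg[OF lineality] by auto
      then have "y \<bullet> x \<le> y \<bullet> x'" "- y \<bullet> x \<le> - y \<bullet> x'"
        using that unfolding F(3)[symmetric] normal_cone_def by blast+
      then show ?thesis by simp
    qed
    have FP: "F \<subseteq> P" using F face_of_imp_subset by auto
    obtain x' where x': "x' \<in> F'" using F' by auto
    have vi: "v i \<bullet> y \<le> v i \<bullet> x'" if "i \<in> K" "y \<in> P" for i y
    proof -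
      have "v i \<in> cone_mod v L {i}" unfolding cone_mod_def
        using subspace_0[OF lineality] by (intro CollectI exI[of _ "\<lambda>_. 1"] exI[of _ 0]) auto
      then have "v i \<in> normal_cone P F'" using cone_mod_mono[of "{i}" K] that K F' by auto
      then show ?thesis using that x' by (auto simp: normal_cone_def)
    qed
    \<comment> \<open>Otherwise the summand of \<open>j\<close> makes the combination strictly
      smaller at \<open>x\<close> than at \<open>x'\<close>, whereas \<open>v k\<close> and
      \<open>z\<close> take equal values at these two points of \<open>F\<close>.\<close>
    have "v j \<bullet> x = v j \<bullet> x'" if x: "x \<in> F" for x
    proof (rule ccontr)
      assume "v j \<bullet> x \<noteq> v j \<bullet> x'"
      then have lt: "v j \<bullet> x < v j \<bullet> x'" using vi j x FP by (metis less_eq_real_def subsetD)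
      have "v k \<bullet> x = v k \<bullet> x'"
      proof (rule antisym)
        have "v k \<in> normal_cone P F" using F(3) \<open>v k \<in> cone_mod v L {k}\<close> by simp
        then show "v k \<bullet> x \<le> v k \<bullet> x'" "v k \<bullet> x' \<le> v k \<bullet> x"
          using x x' \<open>F' \<subseteq> F\<close> FP unfolding normal_cone_def by blast+
      qed
      moreover have "z \<bullet> x = z \<bullet> x'" using L_const tz x FP x' \<open>F' \<subseteq> F\<close> by blast
      ultimately have "(\<Sum>i\<in>K. t i *\<^sub>R v i) \<bullet> x = (\<Sum>i\<in>K. t i *\<^sub>R v i) \<bullet> x'"
        unfolding tz(1) by (simp add: inner_add_left)
      then have "(\<Sum>i\<in>K. t i * (v i \<bullet> x)) = (\<Sum>i\<in>K. t i * (v i \<bullet> x'))"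
        by (simp add: inner_sum_left)
      moreover have "(\<Sum>i\<in>K. t i * (v i \<bullet> x)) < (\<Sum>i\<in>K. t i * (v i \<bullet> x'))"
      proof (rule sum_strict_mono_ex1[OF finite_simplex[OF K]])
        show "\<forall>i\<in>K. t i * (v i \<bullet> x) \<le> t i * (v i \<bullet> x')"
          using vi x FP tz by (auto intro!: mult_left_mono)
        have "t j > 0" using tz(2) j by (metis less_eq_real_def)
        then show "\<exists>i\<in>K. t i * (v i \<bullet> x) < t i * (v i \<bullet> x')"
          using j lt by (intro bexI[of _ j]) auto
      qed
      ultimately show False by simp
    qed
    then have "v j \<in> normal_cone P F"
      using vi j by (auto simp: normal_cone_def)
    then obtain s w where sw: "v j = s *\<^sub>R v k + w" "0 \<le> s" "w \<in> L" unfolding F single by auto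
    have jK: "{j} \<in> \<K>" using down_closed[OF K] j by auto
    then have "v j \<notin> L" using independent_mod[OF jK, of "\<lambda>_. 1" j] by auto
    then have "s > 0" using sw by (cases "s = 0") auto
    then have "j = k" using rays_distinct[OF jK kK, of s] sw by simp
    then show "k \<in> K" using j by simp
  qed
qed (use cone_mod_mono K in auto)

lemma face_simplex_subset_iff:
  assumes "F face_of P" "F \<noteq> {}" "F' face_of P" "F' \<noteq> {}"
  shows "face_simplex F \<subseteq> face_simplex F' \<longleftrightarrow> F' \<subseteq> F"
  using assms face_simplex[OF assms(1,2)] face_simplex[OF assms(3,4)] normal_cone_subset_iff[OF polytope assms(1-3)]
    cone_mod_subset_iff by metis

lemma bij_betw_face_simplex: "bij_betw face_simplex {F. F face_of P \<and> F \<noteq> {}} \<K>"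
proof (rule bij_betw_imageI)
  show "inj_on face_simplex {F. F face_of P \<and> F \<noteq> {}}"
  proof (rule inj_onI)
    fix F G assume "F \<in> {F. F face_of P \<and> F \<noteq> {}}" "G \<in> {F. F face_of P \<and> F \<noteq> {}}"
      and "face_simplex F = face_simplex G"
    then show "F = G"
      using face_simplex_subset_iff[of F G] face_simplex_subset_iff[of G F] by auto
  qed
  show "face_simplex ` {F. F face_of P \<and> F \<noteq> {}} = \<K>"
  proof
    show "face_simplex ` {F. F face_of P \<and> F \<noteq> {}} \<subseteq> \<K>" using face_simplex by auto
    show "\<K> \<subseteq> face_simplex ` {F. F face_of P \<and> F \<noteq> {}}"
    proof
      fix K assume K: "K \<in> \<K>"
      then have "cone_mod v L K \<in> normal_fan P" using fan by simp
      then obtain F where F: "F face_of P" "F \<noteq> {}" "cone_mod v L K = normal_cone P F"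
        by (auto simp: normal_fan_def)
      then have "cone_mod v L K = cone_mod v L (face_simplex F)" "face_simplex F \<in> \<K>"
        using face_simplex by auto
      then have "K = face_simplex F"
        using cone_mod_subset_iff[of K "face_simplex F"] cone_mod_subset_iff[of "face_simplex F" K] K by auto
      then show "K \<in> face_simplex ` {F. F face_of P \<and> F \<noteq> {}}" using F by blast
    qed
  qed
qed

lemma face_of_simplex:
  assumes "K \<in> \<K>"
  obtains F where "F face_of P" "F \<noteq> {}" "face_simplex F = K"
proof -
  have "K \<in> face_simplex ` {F. F face_of P \<and> F \<noteq> {}}"
    using bij_betw_face_simplex assms by (simp add: bij_betw_def)
  then show ?thesis using that by auto
qed

lemma finite_complex: "finite \<K>"
proof -
  have "finite {F. F face_of P \<and> F \<noteq> {}}"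
    using finite_polytope_faces[OF polytope] by (rule rev_finite_subset) auto
  then show ?thesis using bij_betw_face_simplex bij_betw_finite by blast
qed

text \<open>The simplex of a vertex has exactly this many elements, and no face has a larger simplex
  because dimensions of nonempty faces are nonnegative. The ambient dimension is thereby replaced by
  a number that depends on the complex alone, so polytopes in different spaces become
  comparable.\<close>

lemma codim_lineality: "int DIM('a) - int (dim L) = int (Max (card ` \<K>))"
proof -
  have "P \<noteq> {}" using empty_simplex face_of_simplex by (metis empty_subsetI face_of_imp_subset subset_antisym)
  then obtain x where "x extreme_point_of P"
    using extreme_point_exists_convex polytope polytope_imp_compact polytope_imp_convex by metis
  then have x: "{x} face_of P" by (simp add: face_of_singleton)
  let ?K = "face_simplex {x}"
  have "int DIM('a) - int (dim L) = int (card ?K)" using aff_dim_face[OF x] by simp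
  moreover have "Max (card ` \<K>) = card ?K"
  proof (rule Max_eqI)
    show "finite (card ` \<K>)" using finite_complex by simp
    show "card ?K \<in> card ` \<K>" using face_simplex x by simp
    fix k assume "k \<in> card ` \<K>"
    then obtain F where F: "F face_of P" "F \<noteq> {}" "k = card (face_simplex F)"
      using face_of_simplex by (metis imageE)
    have "aff_dim F \<ge> 0" using F aff_dim_negative_iff[of F] by linarith
    then have "int k \<le> int DIM('a) - int (dim L)" using aff_dim_face[OF F(1,2)] F(3) by simp
    then show "k \<le> card ?K" using \<open>int DIM('a) - int (dim L) = int (card ?K)\<close> by simp
  qed
  ultimately show ?thesis by simp
qed

text \<open>Writing the codimension as a sum avoids truncated subtraction: for \<open>i\<close>
  above the dimension of \<open>P\<close> the set on the right is empty, as it should be.\<close>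

lemma num_faces_eq: "num_faces i P = card {K \<in> \<K>. card K + i = Max (card ` \<K>)}"
proof -
  have "bij_betw face_simplex {F. F face_of P \<and> aff_dim F = int i} {K \<in> \<K>. card K + i = Max (card ` \<K>)}"
  proof (rule bij_betw_subset[OF bij_betw_face_simplex])
    show "{F. F face_of P \<and> aff_dim F = int i} \<subseteq> {F. F face_of P \<and> F \<noteq> {}}" by auto
    have *: "aff_dim F = int i \<longleftrightarrow> card (face_simplex F) + i = Max (card ` \<K>)"
      if "F face_of P" "F \<noteq> {}" for F
      using aff_dim_face[OF that] codim_lineality by auto
    show "face_simplex ` {F. F face_of P \<and> aff_dim F = int i} = {K \<in> \<K>. card K + i = Max (card ` \<K>)}"
    proof
      show "face_simplex ` {F. F face_of P \<and> aff_dim F = int i} \<subseteq> {K \<in> \<K>. card K + i = Max (card ` \<K>)}"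
        using * face_simplex by fastforce
      show "{K \<in> \<K>. card K + i = Max (card ` \<K>)} \<subseteq> face_simplex ` {F. F face_of P \<and> aff_dim F = int i}"
      proof
        fix K assume K: "K \<in> {K \<in> \<K>. card K + i = Max (card ` \<K>)}"
        then obtain F where "F face_of P" "F \<noteq> {}" "K = face_simplex F"
          using face_of_simplex by (metis (mono_tags) mem_Collect_eq)
        then show "K \<in> face_simplex ` {F. F face_of P \<and> aff_dim F = int i}" using * K by auto
      qed
    qed
  qed
  then show ?thesis unfolding num_faces_def by (rule bij_betw_same_card)
qed

end

text \<open>In a normal fan these are the facets of the face belonging to \<open>K\<close>, so their
  number is a combinatorial invariant of that face.\<close>

definition simplex_covers :: "'k set set \<Rightarrow> 'k set \<Rightarrow> 'k set set" where
  "simplex_covers \<K> K = {J \<in> \<K>. K \<subseteq> J \<and> card J = Suc (card K)}"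

lemma card_simplex_covers:
  assumes "\<And>K. K \<in> \<K> \<Longrightarrow> finite K" "K \<in> \<K>"
  shows "card (simplex_covers \<K> K) = card {x. x \<notin> K \<and> insert x K \<in> \<K>}"
proof -
  have "bij_betw (\<lambda>x. insert x K) {x. x \<notin> K \<and> insert x K \<in> \<K>} (simplex_covers \<K> K)"
  proof (rule bij_betw_imageI)
    show "inj_on (\<lambda>x. insert x K) {x. x \<notin> K \<and> insert x K \<in> \<K>}"
      by (rule inj_onI) auto
    show "(\<lambda>x. insert x K) ` {x. x \<notin> K \<and> insert x K \<in> \<K>} = simplex_covers \<K> K"
    proof
      show "(\<lambda>x. insert x K) ` {x. x \<notin> K \<and> insert x K \<in> \<K>} \<subseteq> simplex_covers \<K> K"
        using assms by (auto simp: simplex_covers_def)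
      show "simplex_covers \<K> K \<subseteq> (\<lambda>x. insert x K) ` {x. x \<notin> K \<and> insert x K \<in> \<K>}"
      proof
        fix J assume J: "J \<in> simplex_covers \<K> K"
        then have "card (J - K) = 1"
          using assms by (simp add: simplex_covers_def card_Diff_subset)
        then obtain x where "J - K = {x}" by (auto simp: card_1_singleton_iff)
        then have "J = insert x K" "x \<notin> K" using J by (auto simp: simplex_covers_def)
        then show "J \<in> (\<lambda>x. insert x K) ` {x. x \<notin> K \<and> insert x K \<in> \<K>}"
          using J by (auto simp: simplex_covers_def)
      qed
    qed
  qed
  then show ?thesis by (rule bij_betw_same_card[symmetric])
qed

text \<open>The order determines the size of a simplex: the simplices below \<open>J\<close> are all
  of its subsets, and they correspond to the subsets of \<open>\<theta> J\<close>.\<close>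

lemma card_simplex_covers_transfer:
  assumes bij: "bij_betw \<theta> \<K> \<L>"
    and mono: "\<And>J K. J \<in> \<K> \<Longrightarrow> K \<in> \<K> \<Longrightarrow> \<theta> J \<subseteq> \<theta> K \<longleftrightarrow> J \<subseteq> K"
    and K: "\<And>K. K \<in> \<K> \<Longrightarrow> finite K" "\<And>J K. K \<in> \<K> \<Longrightarrow> J \<subseteq> K \<Longrightarrow> J \<in> \<K>"
    and L: "\<And>K. K \<in> \<L> \<Longrightarrow> finite K" "\<And>J K. K \<in> \<L> \<Longrightarrow> J \<subseteq> K \<Longrightarrow> J \<in> \<L>"
    and A: "A \<in> \<K>"
  shows "card (simplex_covers \<L> (\<theta> A)) = card (simplex_covers \<K> A)"
proof -
  have in_L: "\<theta> J \<in> \<L>" if "J \<in> \<K>" for J using that bij by (auto simp: bij_betw_def)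
  have card: "card (\<theta> J) = card J" if J: "J \<in> \<K>" for J
  proof -
    have "bij_betw \<theta> (Pow J) (Pow (\<theta> J))"
    proof (rule bij_betw_subset[OF bij])
      show "Pow J \<subseteq> \<K>" using K(2)[OF J] by auto
      show "\<theta> ` Pow J = Pow (\<theta> J)"
      proof
        show "\<theta> ` Pow J \<subseteq> Pow (\<theta> J)" using mono J K(2)[OF J] by auto
        show "Pow (\<theta> J) \<subseteq> \<theta> ` Pow J"
        proof
          fix B assume B: "B \<in> Pow (\<theta> J)"
          then have "B \<in> \<L>" using L(2)[OF in_L[OF J]] by auto
          then obtain C where "C \<in> \<K>" "B = \<theta> C" using bij by (auto simp: bij_betw_def)
          then show "B \<in> \<theta> ` Pow J" using B mono J by auto
        qed
      qed
    qed
    then have "card (Pow J) = card (Pow (\<theta> J))" by (rule bij_betw_same_card)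
    then show ?thesis using K(1)[OF J] L(1)[OF in_L[OF J]] by (simp add: card_Pow)
  qed
  have "bij_betw \<theta> (simplex_covers \<K> A) (simplex_covers \<L> (\<theta> A))"
  proof (rule bij_betw_subset[OF bij])
    show "simplex_covers \<K> A \<subseteq> \<K>" by (auto simp: simplex_covers_def)
    show "\<theta> ` simplex_covers \<K> A = simplex_covers \<L> (\<theta> A)"
    proof
      show "\<theta> ` simplex_covers \<K> A \<subseteq> simplex_covers \<L> (\<theta> A)"
      proof
        fix B assume "B \<in> \<theta> ` simplex_covers \<K> A"
        then obtain J where "J \<in> \<K>" "A \<subseteq> J" "card J = Suc (card A)" "B = \<theta> J"
          by (auto simp: simplex_covers_def)
        then show "B \<in> simplex_covers \<L> (\<theta> A)"
          using mono[OF A] card A in_L by (simp add: simplex_covers_def)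
      qed
      show "simplex_covers \<L> (\<theta> A) \<subseteq> \<theta> ` simplex_covers \<K> A"
      proof
        fix B assume B: "B \<in> simplex_covers \<L> (\<theta> A)"
        then obtain C where "C \<in> \<K>" "B = \<theta> C" using bij by (auto simp: bij_betw_def simplex_covers_def)
        then show "B \<in> \<theta> ` simplex_covers \<K> A" using B A card mono by (auto simp: simplex_covers_def)
      qed
    qed
  qed
  then show ?thesis by (rule bij_betw_same_card[symmetric])
qed

text \<open>Both \<open>face_simplex\<close> maps reverse inclusion, so composing them with a face
  isomorphism preserves it. The empty face has no simplex and must be split off; it is fixed as the
  least face.\<close>

lemma combinatorially_isomorphic_simplex_covers:
  assumes P: "simplicial_normal_fan P v L \<K>" and Q: "simplicial_normal_fan Q w M \<L>"
    and iso: "combinatorially_isomorphic P Q" and A: "A \<in> \<K>"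
  shows "\<exists>B\<in>\<L>. card (simplex_covers \<L> B) = card (simplex_covers \<K> A)"
proof -
  interpret P: simplicial_normal_fan P v L \<K> by fact
  interpret Q: simplicial_normal_fan Q w M \<L> by fact
  obtain \<phi> where \<phi>: "bij_betw \<phi> {F. F face_of P} {G. G face_of Q}"
      "\<And>F F'. F face_of P \<Longrightarrow> F' face_of P \<Longrightarrow> F \<subseteq> F' \<longleftrightarrow> \<phi> F \<subseteq> \<phi> F'"
    using iso unfolding combinatorially_isomorphic_def by auto
  have \<phi>face: "\<phi> F face_of Q" if "F face_of P" for F using that \<phi>(1) by (auto simp: bij_betw_def)
  have empty: "\<phi> {} = {}"
  proof -
    have "{} \<in> \<phi> ` {F. F face_of P}" using \<phi>(1) by (auto simp: bij_betw_def)
    then obtain F where "F face_of P" "\<phi> F = {}" by auto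
    then show ?thesis using \<phi>(2)[of "{}" F] by auto
  qed
  have \<phi>': "bij_betw \<phi> {F. F face_of P \<and> F \<noteq> {}} {G. G face_of Q \<and> G \<noteq> {}}"
  proof -
    have "bij_betw \<phi> ({F. F face_of P} - {{}}) ({G. G face_of Q} - {{}})"
      by (rule bij_betw_DiffI[OF \<phi>(1)]) (simp_all add: empty bij_betw_def)
    then show ?thesis by (simp add: set_diff_eq)
  qed
  let ?\<psi> = "inv_into {F. F face_of P \<and> F \<noteq> {}} P.face_simplex"
  define \<theta> where "\<theta> = Q.face_simplex \<circ> (\<phi> \<circ> ?\<psi>)"
  have \<psi>: "bij_betw ?\<psi> \<K> {F. F face_of P \<and> F \<noteq> {}}"
    using bij_betw_inv_into[OF P.bij_betw_face_simplex] .
  have \<theta>: "bij_betw \<theta> \<K> \<L>"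
    unfolding \<theta>_def by (rule bij_betw_trans[OF bij_betw_trans[OF \<psi> \<phi>'] Q.bij_betw_face_simplex])
  have mono: "\<theta> J \<subseteq> \<theta> K \<longleftrightarrow> J \<subseteq> K" if "J \<in> \<K>" "K \<in> \<K>" for J K
  proof -
    have \<psi>_props: "?\<psi> J face_of P" "?\<psi> J \<noteq> {}" "P.face_simplex (?\<psi> J) = J" if "J \<in> \<K>" for J
      using bij_betwE[OF \<psi>] that bij_betw_inv_into_right[OF P.bij_betw_face_simplex that] by simp_all
    note J = \<psi>_props[OF that(1)] and K = \<psi>_props[OF that(2)]
    have "\<phi> (?\<psi> J) \<noteq> {}" "\<phi> (?\<psi> K) \<noteq> {}" using J K bij_betwE[OF \<phi>'] by simp_all
    then have "\<theta> J \<subseteq> \<theta> K \<longleftrightarrow> \<phi> (?\<psi> K) \<subseteq> \<phi> (?\<psi> J)"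
      unfolding \<theta>_def using Q.face_simplex_subset_iff \<phi>face J K by simp
    also have "\<dots> \<longleftrightarrow> ?\<psi> K \<subseteq> ?\<psi> J" using \<phi>(2) J K by simp
    also have "\<dots> \<longleftrightarrow> J \<subseteq> K" using P.face_simplex_subset_iff[OF J(1,2) K(1,2)] J K by simp
    finally show ?thesis .
  qed
  have "card (simplex_covers \<L> (\<theta> A)) = card (simplex_covers \<K> A)"
    by (rule card_simplex_covers_transfer[OF \<theta> mono])
      (use P.finite_simplex P.down_closed Q.finite_simplex Q.down_closed A in blast)+
  moreover have "\<theta> A \<in> \<L>" using \<theta> A by (auto simp: bij_betw_def)
  ultimately show ?thesis by blast
qed

section \<open>The normal fan of the permutohedron\<close>

lemma even_card_involution:
  assumes "finite X" "\<And>x. x \<in> X \<Longrightarrow> f x \<in> X" "\<And>x. x \<in> X \<Longrightarrow> f (f x) = x" "\<And>x. x \<in> X \<Longrightarrow> f x \<noteq> x"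
  shows "even (card X)"
  using assms
proof (induction X rule: finite_psubset_induct)
  case (psubset X)
  show ?case
  proof (cases "X = {}")
    case False
    then obtain x where x: "x \<in> X" by blast
    let ?Y = "X - {x, f x}"
    have Y: "f y \<in> ?Y" if "y \<in> ?Y" for y
      using that psubset.prems x by (metis Diff_iff insert_iff singletonD)
    have "even (card ?Y)"
      by (rule psubset.IH) (use x psubset.prems Y in auto)
    moreover have "card X = Suc (Suc (card ?Y))"
    proof -
      have "card {x, f x} = 2" using psubset.prems(3)[OF x] by auto
      moreover have "card ?Y = card X - card {x, f x}"
        using x psubset.prems(1) by (intro card_Diff_subset) auto
      moreover have "card {x, f x} \<le> card X"
        using x psubset.prems(1) psubset.hyps by (intro card_mono) auto
      ultimately show ?thesis by linarith
    qed
    ultimately show ?thesis by simp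
  qed simp
qed

lemma Union_Inter_mem_chain:
  assumes "finite A" "A \<noteq> {}" "\<forall>S\<in>A. \<forall>T\<in>A. S \<subseteq> T \<or> T \<subseteq> S"
  shows "\<Union>A \<in> A" "\<Inter>A \<in> A"
proof -
  have "\<Union>A \<in> A \<and> \<Inter>A \<in> A"
    using assms
  proof (induction A rule: finite_ne_induct)
    case (insert S A)
    then have IH: "\<Union>A \<in> A" "\<Inter>A \<in> A" by simp_all
    have "S \<subseteq> \<Union>A \<or> \<Union>A \<subseteq> S" "S \<subseteq> \<Inter>A \<or> \<Inter>A \<subseteq> S" using insert.prems IH by blast+
    then have "\<Union>(insert S A) = S \<or> \<Union>(insert S A) = \<Union>A" "\<Inter>(insert S A) = S \<or> \<Inter>(insert S A) = \<Inter>A"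
      by blast+
    then show ?case using IH by auto
  qed auto
  then show "\<Union>A \<in> A" "\<Inter>A \<in> A" by simp_all
qed

definition proper_chains :: "'n set set set" where
  "proper_chains = {K. (\<forall>S\<in>K. S \<noteq> {} \<and> S \<noteq> UNIV) \<and> (\<forall>S\<in>K. \<forall>T\<in>K. S \<subseteq> T \<or> T \<subseteq> S)}"

lemma proper_chains_subset: "K \<in> proper_chains \<Longrightarrow> J \<subseteq> K \<Longrightarrow> J \<in> proper_chains"
  unfolding proper_chains_def mem_Collect_eq by (simp add: subset_iff)

text \<open>The involution that makes the number of extensions of a chain even.\<close>

definition gap_complement :: "'n set set \<Rightarrow> 'n set \<Rightarrow> 'n set" where
  "gap_complement K S = \<Union>{T \<in> K. T \<subseteq> S} \<union> (\<Inter>{T \<in> K. S \<subseteq> T} - S)"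

text \<open>The new set lies between the same neighbours \<open>lo\<close> and \<open>hi\<close> of
  the chain as \<open>S\<close> and is incomparable with \<open>S\<close>. The same members are
  below and above it, so complementing again uses the same gap and returns \<open>S\<close>.\<close>

lemma gap_complement:
  fixes S :: "'n::finite set"
  assumes K: "insert S K \<in> proper_chains" and S: "S \<notin> K"
  shows "\<not> gap_complement K S \<subseteq> S" "\<not> S \<subseteq> gap_complement K S"
    "insert (gap_complement K S) K \<in> proper_chains"
    "gap_complement K (gap_complement K S) = S"
proof -
  define lo where "lo = \<Union>{T \<in> K. T \<subseteq> S}"
  define hi where "hi = \<Inter>{T \<in> K. S \<subseteq> T}"
  have S': "gap_complement K S = lo \<union> (hi - S)" by (simp add: gap_complement_def lo_def hi_def)
  have comp: "T \<subseteq> S \<or> S \<subseteq> T" if "T \<in> K" for T using K that by (auto simp: proper_chains_def)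
  have chain: "\<forall>S\<in>{T \<in> K. Q T}. \<forall>T\<in>{T \<in> K. Q T}. S \<subseteq> T \<or> T \<subseteq> S" for Q
    using K by (auto simp: proper_chains_def)
  have lo: "lo \<subset> S"
  proof (cases "{T \<in> K. T \<subseteq> S} = {}")
    case True
    \<comment> \<open>If no member lies below \<open>S\<close>, the gap starts at the empty union;
      if none lies above, it ends at the empty intersection \<open>UNIV\<close>. Since
      \<open>S\<close> is proper, it is strictly inside the gap in these cases too.\<close>
    then have "lo = {}" unfolding lo_def by (metis Sup_empty)
    then show ?thesis using K by (auto simp: proper_chains_def)
  next
    case False
    then have "lo \<in> {T \<in> K. T \<subseteq> S}" unfolding lo_def using Union_Inter_mem_chain(1)[OF _ False chain] by simp
    then show ?thesis using S by blast
  qed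
  have hi: "S \<subset> hi"
  proof (cases "{T \<in> K. S \<subseteq> T} = {}")
    case True
    then have "hi = UNIV" unfolding hi_def by (metis Inf_empty)
    then show ?thesis using K by (auto simp: proper_chains_def)
  next
    case False
    then have "hi \<in> {T \<in> K. S \<subseteq> T}" unfolding hi_def using Union_Inter_mem_chain(2)[OF _ False chain] by simp
    then show ?thesis using S by blast
  qed
  show 1: "\<not> gap_complement K S \<subseteq> S" "\<not> S \<subseteq> gap_complement K S"
    unfolding S' using lo hi by blast+
  have below: "T \<subseteq> gap_complement K S \<longleftrightarrow> T \<subseteq> S" if "T \<in> K" for T
  proof
    assume "T \<subseteq> S"
    then show "T \<subseteq> gap_complement K S" using that unfolding S' lo_def by blast
  qed (use 1 comp that in blast)
  have above: "gap_complement K S \<subseteq> T \<longleftrightarrow> S \<subseteq> T" if "T \<in> K" for T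
  proof
    assume "S \<subseteq> T"
    then have "hi \<subseteq> T" using that unfolding hi_def by blast
    then show "gap_complement K S \<subseteq> T" using lo \<open>S \<subseteq> T\<close> unfolding S' by blast
  qed (use 1 comp that in blast)
  show "insert (gap_complement K S) K \<in> proper_chains"
    using K 1 comp below above unfolding proper_chains_def by (auto; blast)
  have "gap_complement K (gap_complement K S) = lo \<union> (hi - gap_complement K S)"
    unfolding gap_complement_def[of K "gap_complement K S"] lo_def hi_def using below above by (metis (no_types, lifting) Collect_cong)
  then show "gap_complement K (gap_complement K S) = S"
    unfolding S' using lo hi by blast
qed

lemma even_card_chain_covers:
  fixes K :: "'n::finite set set"
  assumes K: "K \<in> proper_chains"
  shows "even (card (simplex_covers proper_chains K))"
proof -
  have "even (card {S. S \<notin> K \<and> insert S K \<in> proper_chains})"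
  proof (rule even_card_involution[where f = "gap_complement K"])
    fix S assume "S \<in> {S. S \<notin> K \<and> insert S K \<in> proper_chains}"
    then have S: "insert S K \<in> proper_chains" "S \<notin> K" by auto
    note gc = gap_complement[OF S]
    have "gap_complement K S \<notin> K"
      using S gc(1,2) unfolding proper_chains_def by blast
    then show "gap_complement K S \<in> {S. S \<notin> K \<and> insert S K \<in> proper_chains}" using gc by simp
    show "gap_complement K (gap_complement K S) = S" using gc by simp
    show "gap_complement K S \<noteq> S" using gc by blast
  qed simp
  then show ?thesis using card_simplex_covers[OF _ K] by simp
qed

section \<open>Rankings that put the members of a chain on top\<close>

definition rankings :: "('n::finite \<Rightarrow> nat) set" where
  "rankings = {\<sigma>. bij_betw \<sigma> UNIV {1..CARD('n)}}"

text \<open>By \<open>set_vector_inner_ranking\<close>, this describes the generators of the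
  permutohedron at which the sum of the coordinates in \<open>S\<close> is maximal.\<close>

definition ranks_highest :: "('n \<Rightarrow> nat) \<Rightarrow> 'n set \<Rightarrow> bool" where
  "ranks_highest \<sigma> S \<longleftrightarrow> (\<forall>i\<in>S. \<forall>j. j \<notin> S \<longrightarrow> \<sigma> j < \<sigma> i)"

lemma ranks_highest_comparable:
  assumes "ranks_highest \<sigma> S" "ranks_highest \<sigma> T"
  shows "S \<subseteq> T \<or> T \<subseteq> S"
proof (rule ccontr)
  assume "\<not> (S \<subseteq> T \<or> T \<subseteq> S)"
  then obtain i j where "i \<in> S" "i \<notin> T" "j \<in> T" "j \<notin> S" by blast
  then have "\<sigma> j < \<sigma> i" "\<sigma> i < \<sigma> j" using assms by (simp_all add: ranks_highest_def)
  then show False by simp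
qed

lemma exists_linear_extension_on:
  fixes g :: "'a \<Rightarrow> nat"
  assumes "finite A"
  shows "\<exists>\<sigma>. bij_betw \<sigma> A {1..card A} \<and> (\<forall>i\<in>A. \<forall>j\<in>A. g i < g j \<longrightarrow> \<sigma> i < \<sigma> j)"
  using assms
proof (induction "card A" arbitrary: A)
  case 0
  then show ?case by (auto simp: bij_betw_def)
next
  case (Suc n)
  then have "A \<noteq> {}" by auto
  then have "Max (g ` A) \<in> g ` A" using Suc.prems by (intro Max_in) auto
  then obtain a where a: "a \<in> A" "g a = Max (g ` A)" by auto
  have max: "g i \<le> g a" if "i \<in> A" for i using that a Suc.prems by simp
  have cA: "card (A - {a}) = n" using Suc a by simp
  then obtain \<sigma> where \<sigma>: "bij_betw \<sigma> (A - {a}) {1..n}"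
      "\<forall>i\<in>A - {a}. \<forall>j\<in>A - {a}. g i < g j \<longrightarrow> \<sigma> i < \<sigma> j"
    using Suc.hyps(1)[of "A - {a}"] Suc.prems by auto
  let ?\<tau> = "\<sigma>(a := Suc n)"
  have "bij_betw ?\<tau> (A - {a}) {1..n}" 
    using bij_betw_cong[of "A - {a}" ?\<tau> \<sigma>] \<sigma>(1) by auto
  then have "bij_betw ?\<tau> ((A - {a}) \<union> {a}) ({1..n} \<union> {Suc n})"
    by (intro bij_betw_combine) auto
  moreover have "(A - {a}) \<union> {a} = A" "{1..n} \<union> {Suc n} = {1..card A}"
    using a Suc.hyps(2) by auto
  ultimately have "bij_betw ?\<tau> A {1..card A}" by simp
  moreover have "?\<tau> i < ?\<tau> j" if "i \<in> A" "j \<in> A" "g i < g j" for i j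
  proof (cases "i = a")
    case True
    then show ?thesis using max[of j] that by simp
  next
    case False
    then have "\<sigma> i \<in> {1..n}" using \<sigma>(1) that by (auto simp: bij_betw_def)
    then show ?thesis using False \<sigma>(2) that by auto
  qed
  ultimately show ?case by blast
qed

text \<open>A point of \<open>S\<close> lies in more members of the chain than a point outside
  \<open>S\<close>: each member containing the latter contains all of \<open>S\<close>, and
  \<open>S\<close> itself contains only the former. So it suffices to rank by this number.\<close>

lemma exists_ranking:
  fixes K :: "'n::finite set set"
  assumes K: "K \<in> proper_chains"
  shows "\<exists>\<sigma>\<in>rankings. \<forall>S\<in>K. ranks_highest \<sigma> S"
proof -
  obtain \<sigma> where \<sigma>: "bij_betw \<sigma> (UNIV :: 'n set) {1..CARD('n)}"
      "\<forall>i j. card {T \<in> K. i \<in> T} < card {T \<in> K. j \<in> T} \<longrightarrow> \<sigma> i < \<sigma> j"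
    using exists_linear_extension_on[of "UNIV :: 'n set" "\<lambda>i. card {T \<in> K. i \<in> T}"] by auto
  have "ranks_highest \<sigma> S" if S: "S \<in> K" for S
    unfolding ranks_highest_def
  proof (intro ballI allI impI)
    fix i j assume "i \<in> S" "j \<notin> S"
    then have "{T \<in> K. j \<in> T} \<subset> {T \<in> K. i \<in> T}"
      using K S unfolding proper_chains_def by blast
    then show "\<sigma> j < \<sigma> i" using \<sigma>(2) by (simp add: psubset_card_mono)
  qed
  then show ?thesis using \<sigma>(1) by (auto simp: rankings_def)
qed

text \<open>This recovers a chain from the generators on its face. A missing \<open>S\<close> would
  be comparable with all members, so its gap complement could be added to the chain; a ranking for
  the longer chain cannot also put \<open>S\<close> on top, because sets on top of one ranking are
  nested.\<close>

lemma mem_chain_if_always_ranked_highest: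
  fixes K :: "'n::finite set set"
  assumes K: "K \<in> proper_chains" and S: "S \<noteq> {}" "S \<noteq> UNIV"
    and forced: "\<And>\<sigma>. \<sigma> \<in> rankings \<Longrightarrow> \<forall>T\<in>K. ranks_highest \<sigma> T \<Longrightarrow> ranks_highest \<sigma> S"
  shows "S \<in> K"
proof (rule ccontr)
  assume "S \<notin> K"
  obtain \<sigma> where \<sigma>: "\<sigma> \<in> rankings" "\<forall>T\<in>K. ranks_highest \<sigma> T" using exists_ranking[OF K] by auto
  then have "\<forall>T\<in>K. S \<subseteq> T \<or> T \<subseteq> S" using forced ranks_highest_comparable by blast
  then have "insert S K \<in> proper_chains" using K S unfolding proper_chains_def by blast
  note gc = gap_complement[OF this \<open>S \<notin> K\<close>]
  obtain \<tau> where \<tau>: "\<tau> \<in> rankings" "\<forall>T\<in>insert (gap_complement K S) K. ranks_highest \<tau> T"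
    using exists_ranking[OF gc(3)] by auto
  then have "ranks_highest \<tau> S" using forced by blast
  then show False using \<tau>(2) gc(1,2) ranks_highest_comparable by blast
qed

section \<open>Faces and normal cones of the permutohedron\<close>

definition set_vector :: "'n::finite set \<Rightarrow> real ^ 'n" where
  "set_vector S = (\<chi> i. of_bool (i \<in> S))"

definition ranking_vector :: "('n::finite \<Rightarrow> nat) \<Rightarrow> real ^ 'n" where
  "ranking_vector \<sigma> = (\<chi> i. real (\<sigma> i))"

text \<open>The sum of the \<open>card S\<close> largest ranks: the support function of the
  permutohedron at \<open>set_vector S\<close>.\<close>

definition top_sum :: "'n::finite set \<Rightarrow> real" where
  "top_sum (S :: 'n set) = real (\<Sum>{CARD('n) - card S + 1..CARD('n)})"

lemma permutohedron_eq:
  "(permutohedron :: (real ^ 'n::finite) set) = convex hull (ranking_vector ` rankings)"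
proof -
  have "{(\<chi> i. real (\<sigma> i)) | \<sigma>. bij_betw \<sigma> (UNIV :: 'n set) {1..CARD('n)}} = ranking_vector ` rankings"
    unfolding ranking_vector_def rankings_def by blast
  then show ?thesis unfolding permutohedron_def by (rule arg_cong)
qed

text \<open>Exchange argument: the ranks of \<open>S\<close> outside the top block \<open>?B\<close>
  are at most \<open>?n - ?s\<close>, and the equally many missing top ranks are at least
  \<open>?n - ?s + 1\<close>. The resulting slack \<open>card (?A - ?B)\<close> yields the bound
  together with its equality case.\<close>

lemma set_vector_inner_ranking:
  fixes \<sigma> :: "'n::finite \<Rightarrow> nat"
  assumes \<sigma>: "\<sigma> \<in> rankings"
  shows "set_vector S \<bullet> ranking_vector \<sigma> \<le> top_sum S"
    "set_vector S \<bullet> ranking_vector \<sigma> = top_sum S \<longleftrightarrow> ranks_highest \<sigma> S"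
proof -
  let ?n = "CARD('n)" and ?s = "card S"
  let ?A = "\<sigma> ` S" and ?B = "{?n - ?s + 1..?n}"
  have bij: "inj \<sigma>" "range \<sigma> = {1..?n}" using \<sigma> by (auto simp: rankings_def bij_betw_def)
  have sn: "?s \<le> ?n" by (simp add: card_mono)
  have A: "?A \<subseteq> {1..?n}" "card ?A = ?s" "finite ?A"
    using bij by (auto simp: card_image inj_on_subset)
  have cB: "card ?B = ?s" using sn by simp
  have "set_vector S \<bullet> ranking_vector \<sigma> = (\<Sum>i\<in>UNIV. of_bool (i \<in> S) * real (\<sigma> i))"
    by (simp add: inner_vec_def set_vector_def ranking_vector_def)
  also have "\<dots> = (\<Sum>i\<in>S. real (\<sigma> i))"
    by (intro sum.mono_neutral_cong_right) auto
  also have "\<dots> = real (\<Sum>?A)" using bij by (simp add: sum.reindex inj_on_subset)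
  finally have inner: "set_vector S \<bullet> ranking_vector \<sigma> = real (\<Sum>?A)" .
  have diff: "card (?A - ?B) = card (?B - ?A)"
    using A cB card_le_sym_Diff[of ?A ?B] card_le_sym_Diff[of ?B ?A] by simp
  have "\<Sum>?A = \<Sum>(?A - ?B) + \<Sum>(?A \<inter> ?B)"
    using sum.Int_Diff[OF A(3), of "\<lambda>x. x" ?B] by simp
  moreover have "\<Sum>?B = \<Sum>(?B - ?A) + \<Sum>(?A \<inter> ?B)"
    using sum.Int_Diff[of ?B "\<lambda>x. x" ?A] by (simp add: Int_commute)
  moreover have "\<Sum>(?A - ?B) \<le> card (?A - ?B) * (?n - ?s)"
  proof -
    have "\<Sum>(?A - ?B) \<le> of_nat (card (?A - ?B)) * (?n - ?s)"
      by (rule sum_bounded_above) (use A(1) in fastforce)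
    then show ?thesis by simp
  qed
  moreover have "card (?B - ?A) * (?n - ?s + 1) \<le> \<Sum>(?B - ?A)"
  proof -
    have "of_nat (card (?B - ?A)) * (?n - ?s + 1) \<le> \<Sum>(?B - ?A)"
      by (rule sum_bounded_below) auto
    then show ?thesis by simp
  qed
  moreover have "card (?B - ?A) * (?n - ?s + 1) = card (?A - ?B) * (?n - ?s) + card (?A - ?B)"
    using diff by simp
  ultimately have *: "\<Sum>?A + card (?A - ?B) \<le> \<Sum>?B"
    by linarith
  then show "set_vector S \<bullet> ranking_vector \<sigma> \<le> top_sum S"
    unfolding inner top_sum_def by linarith
  have "set_vector S \<bullet> ranking_vector \<sigma> = top_sum S \<longleftrightarrow> ?A = ?B"
  proof
    assume "set_vector S \<bullet> ranking_vector \<sigma> = top_sum S"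
    then have "card (?A - ?B) = 0" using * unfolding inner top_sum_def by linarith
    then have "?A \<subseteq> ?B" using A(3) by simp
    then show "?A = ?B" using A cB by (simp add: card_subset_eq)
  qed (simp add: inner top_sum_def)
  also have "\<dots> \<longleftrightarrow> ranks_highest \<sigma> S"
  proof
    assume eq: "?A = ?B"
    show "ranks_highest \<sigma> S" unfolding ranks_highest_def
    proof (intro ballI allI impI)
      fix i j assume "i \<in> S" "j \<notin> S"
      then have "\<sigma> i \<in> ?A" "\<sigma> j \<notin> ?A" using bij(1) by (auto simp: inj_image_mem_iff)
      then have "\<sigma> i \<in> ?B" "\<sigma> j \<notin> ?B" unfolding eq by simp_all
      moreover have "\<sigma> j \<in> {1..?n}" using bij(2) by blast
      ultimately show "\<sigma> j < \<sigma> i" by auto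
    qed
  next
    assume high: "ranks_highest \<sigma> S"
    have "?A \<subseteq> ?B"
    proof (rule ccontr)
      assume "\<not> ?A \<subseteq> ?B"
      then obtain a where a: "a \<in> ?A" "a \<notin> ?B" by blast
      then have "?A - ?B \<noteq> {}" by blast
      then have "?B - ?A \<noteq> {}" using diff A(3) by (metis card_0_eq finite_Diff finite_atLeastAtMost)
      then obtain b where b: "b \<in> ?B" "b \<notin> ?A" by blast
      then have "b \<in> range \<sigma>" using bij by auto
      then obtain j where "b = \<sigma> j" "j \<notin> S" using b by auto
      moreover obtain i where "a = \<sigma> i" "i \<in> S" using a by auto
      ultimately have "b < a" using high by (auto simp: ranks_highest_def)
      moreover have "a \<le> ?n" using a A by auto
      ultimately show False using a b by auto
    qed
    then show "?A = ?B" using A cB by (simp add: card_subset_eq)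
  qed
  finally show "set_vector S \<bullet> ranking_vector \<sigma> = top_sum S \<longleftrightarrow> ranks_highest \<sigma> S" .
qed

lemma set_vector_inner_le_top_sum:
  assumes "x \<in> permutohedron"
  shows "set_vector S \<bullet> x \<le> top_sum S"
proof -
  have "convex hull (ranking_vector ` rankings) \<subseteq> {x. set_vector S \<bullet> x \<le> top_sum S}"
    by (rule hull_minimal) (auto simp: set_vector_inner_ranking convex_halfspace_le)
  then show ?thesis using assms by (auto simp: permutohedron_eq)
qed

lemma set_vector_UNIV_inner:
  fixes x :: "real ^ 'n::finite"
  assumes "x \<in> permutohedron"
  shows "set_vector UNIV \<bullet> x = top_sum (UNIV :: 'n set)"
proof -
  have "convex hull (ranking_vector ` rankings) \<subseteq> {x :: real ^ 'n. set_vector UNIV \<bullet> x = top_sum (UNIV :: 'n set)}"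
    by (rule hull_minimal) (auto simp: set_vector_inner_ranking(2)[THEN iffD2] convex_hyperplane ranks_highest_def)
  then show ?thesis using assms by (auto simp: permutohedron_eq)
qed

text \<open>The members of \<open>K\<close> are the proper upper level sets of \<open>z\<close>,
  weighted by the steps between consecutive values. Each induction step lowers the largest value to
  the second largest. The clause comparing coordinates inside and outside a member strengthens the
  induction: it forces the later sets to contain the current top set.\<close>

lemma exists_chain_decomposition:
  fixes z :: "real ^ 'n::finite"
  shows "\<exists>K\<in>proper_chains. \<exists>t r. (\<forall>S\<in>K. 0 < t S) \<and> (\<forall>S\<in>K. \<forall>i\<in>S. \<forall>j. j \<notin> S \<longrightarrow> z $ j < z $ i) \<and>
    z = (\<Sum>S\<in>K. t S *\<^sub>R set_vector S) + r *\<^sub>R set_vector UNIV"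
proof (induction "card (range (($) z))" arbitrary: z rule: less_induct)
  case less
  define m where "m = Max (range (($) z))"
  define S where "S = {i. z $ i = m}"
  have max: "z $ i \<le> m" for i by (simp add: m_def)
  have "m \<in> range (($) z)" unfolding m_def by (intro Max_in) auto
  then have "S \<noteq> {}" by (auto simp: S_def)
  show ?case
  proof (cases "S = UNIV")
    case True
    then have "z = m *\<^sub>R set_vector UNIV" by (auto simp: S_def set_vector_def vec_eq_iff)
    then show ?thesis
      by (intro bexI[of _ "{}"] exI[of _ m]) (auto simp: proper_chains_def)
  next
    case False
    define m' where "m' = Max (range (($) z) - {m})"
    have "range (($) z) - {m} \<noteq> {}" using False by (auto simp: S_def)
    then have "m' \<in> range (($) z) - {m}" unfolding m'_def by (intro Max_in) auto
    then obtain l where l: "m' = z $ l" "m' \<noteq> m" by auto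
    have m': "m' < m" using max[of l] l by simp
    have max': "z $ i \<le> m'" if "i \<notin> S" for i
      unfolding m'_def using that by (intro Max_ge) (auto simp: S_def)
    define y where "y = z - (m - m') *\<^sub>R set_vector S"
    have y: "y $ i = (if i \<in> S then m' else z $ i)" for i
      by (auto simp: y_def set_vector_def S_def)
    have "range (($) y) \<subseteq> range (($) z) - {m}"
      using l by (auto simp: y S_def)
    moreover have "m \<in> range (($) z)" by fact
    ultimately have "card (range (($) y)) < card (range (($) z))"
      by (intro psubset_card_mono) auto
    from less[OF this] obtain K t r where K: "K \<in> proper_chains" "\<forall>T\<in>K. 0 < t T"
        "\<forall>T\<in>K. \<forall>i\<in>T. \<forall>j. j \<notin> T \<longrightarrow> y $ j < y $ i"
        "y = (\<Sum>T\<in>K. t T *\<^sub>R set_vector T) + r *\<^sub>R set_vector UNIV"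
      by auto
    have y_le: "y $ i \<le> m'" for i using max' y by auto
    \<comment> \<open>Every point at which \<open>y\<close> attains its maximum \<open>m'\<close>
      lies in each member of \<open>K\<close>. Besides \<open>S\<close> this includes
      \<open>l\<close>, which is not in \<open>S\<close>, so the inclusion of \<open>S\<close> is
      strict.\<close>
    have ST: "S \<subseteq> T \<and> l \<in> T" if T: "T \<in> K" for T
    proof -
      have "T \<noteq> {}" using K(1) T unfolding proper_chains_def by blast
      then obtain i where i: "i \<in> T" by blast
      have "j \<in> T" if "y $ j = m'" for j
      proof (rule ccontr)
        assume "j \<notin> T"
        then have "y $ j < y $ i" by (rule K(3)[rule_format, OF T i])
        then show False using that y_le[of i] by linarith
      qed
      then have *: "j \<in> T" if "y $ j = m'" for j using that by blast
      have "l \<in> T" by (rule *) (simp add: y l(1))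
      moreover have "S \<subseteq> T" by (intro subsetI *) (simp add: y)
      ultimately show ?thesis by simp
    qed
    have "l \<notin> S" using l by (simp add: S_def)
    then have "S \<notin> K" using ST by blast
    have "insert S K \<in> proper_chains"
      using K(1) ST \<open>S \<noteq> {}\<close> False unfolding proper_chains_def by blast
    moreover have "\<forall>T\<in>insert S K. 0 < (t(S := m - m')) T"
      using K(2) m' \<open>S \<notin> K\<close> by auto
    moreover have "z $ j < z $ i" if "T \<in> insert S K" "i \<in> T" "j \<notin> T" for T i j
    proof (cases "T = S")
      case True
      then show ?thesis using that max[of j] by (auto simp: S_def less_le)
    next
      case False
      then have "T \<in> K" using that by simp
      then have "y $ j < y $ i" "j \<notin> S" using K(3) that ST by blast+
      moreover have "y $ i \<le> z $ i" using y[of i] m' by (auto simp: S_def)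
      ultimately show ?thesis using y[of j] by simp
    qed
    moreover have "z = (\<Sum>T\<in>insert S K. (t(S := m - m')) T *\<^sub>R set_vector T) + r *\<^sub>R set_vector UNIV"
    proof -
      have "(\<Sum>T\<in>K. (t(S := m - m')) T *\<^sub>R set_vector T) = (\<Sum>T\<in>K. t T *\<^sub>R set_vector T)"
        using \<open>S \<notin> K\<close> by (intro sum.cong) auto
      then have *: "(\<Sum>T\<in>insert S K. (t(S := m - m')) T *\<^sub>R set_vector T) =
          (m - m') *\<^sub>R set_vector S + (\<Sum>T\<in>K. t T *\<^sub>R set_vector T)"
        using \<open>S \<notin> K\<close> by simp
      have "z = (m - m') *\<^sub>R set_vector S + y" by (simp add: y_def)
      then show ?thesis unfolding * K(4) by (simp only: add.assoc)
    qed
    ultimately show ?thesis by blast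
  qed
qed

definition chain_face :: "'n::finite set set \<Rightarrow> (real ^ 'n) set" where
  "chain_face K = {x \<in> permutohedron. \<forall>S\<in>K. set_vector S \<bullet> x = top_sum S}"

lemma ranking_vector_in_chain_face:
  assumes "\<sigma> \<in> rankings"
  shows "ranking_vector \<sigma> \<in> chain_face K \<longleftrightarrow> (\<forall>S\<in>K. ranks_highest \<sigma> S)"
proof -
  have "ranking_vector \<sigma> \<in> permutohedron" unfolding permutohedron_eq using assms by (intro hull_inc imageI)
  then show ?thesis using set_vector_inner_ranking(2)[OF assms] by (simp add: chain_face_def)
qed

lemma chain_face_nonempty:
  assumes "K \<in> proper_chains"
  shows "chain_face K \<noteq> {}"
proof -
  obtain \<sigma> where "\<sigma> \<in> rankings" "\<forall>S\<in>K. ranks_highest \<sigma> S" using exists_ranking[OF assms] by blast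
  then have "ranking_vector \<sigma> \<in> chain_face K" by (simp add: ranking_vector_in_chain_face)
  then show ?thesis by blast
qed

text \<open>Weighted supporting inequalities are added up, the all-ones direction being constant on
  the permutohedron. With positive weights the total is attained only where each inequality is
  tight.\<close>

lemma chain_sum_inner_le:
  fixes K :: "'n::finite set set"
  assumes x: "x \<in> permutohedron" and t: "\<forall>S\<in>K. 0 \<le> t S"
    and z: "z = (\<Sum>S\<in>K. t S *\<^sub>R set_vector S) + r *\<^sub>R set_vector UNIV"
  shows "z \<bullet> x \<le> (\<Sum>S\<in>K. t S * top_sum S) + r * top_sum (UNIV :: 'n set)"
    and "x \<in> chain_face K \<Longrightarrow> z \<bullet> x = (\<Sum>S\<in>K. t S * top_sum S) + r * top_sum (UNIV :: 'n set)"
    and "\<forall>S\<in>K. 0 < t S \<Longrightarrow> z \<bullet> x = (\<Sum>S\<in>K. t S * top_sum S) + r * top_sum (UNIV :: 'n set) \<Longrightarrow> x \<in> chain_face K"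
proof -
  have zx: "z \<bullet> x = (\<Sum>S\<in>K. t S * (set_vector S \<bullet> x)) + r * top_sum (UNIV :: 'n set)"
    unfolding z by (simp add: inner_add_left inner_sum_left set_vector_UNIV_inner[OF x])
  have le: "t S * (set_vector S \<bullet> x) \<le> t S * top_sum S" if "S \<in> K" for S
    using that t set_vector_inner_le_top_sum[OF x] by (simp add: mult_left_mono)
  show "z \<bullet> x \<le> (\<Sum>S\<in>K. t S * top_sum S) + r * top_sum (UNIV :: 'n set)"
    unfolding zx using le by (simp add: sum_mono)
  show "x \<in> chain_face K \<Longrightarrow> z \<bullet> x = (\<Sum>S\<in>K. t S * top_sum S) + r * top_sum (UNIV :: 'n set)"
    unfolding zx by (simp add: chain_face_def)
  show "x \<in> chain_face K" if pos: "\<forall>S\<in>K. 0 < t S"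
      and eq: "z \<bullet> x = (\<Sum>S\<in>K. t S * top_sum S) + r * top_sum (UNIV :: 'n set)"
  proof -
    have "(\<Sum>S\<in>K. t S * top_sum S - t S * (set_vector S \<bullet> x)) = 0"
      using eq unfolding zx by (simp add: sum_subtractf)
    then have "\<forall>S\<in>K. t S * top_sum S - t S * (set_vector S \<bullet> x) = 0"
      using le by (subst (asm) sum_nonneg_eq_0_iff) auto
    then have "\<forall>S\<in>K. set_vector S \<bullet> x = top_sum S" using pos by (auto simp: less_le)
    then show ?thesis using x by (simp add: chain_face_def)
  qed
qed

lemma exposed_by_chain:
  fixes z :: "real ^ 'n::finite"
  obtains K t r where "K \<in> proper_chains" "\<forall>S\<in>K. 0 < t S"
    "z = (\<Sum>S\<in>K. t S *\<^sub>R set_vector S) + r *\<^sub>R set_vector UNIV"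
    "\<And>x. x \<in> permutohedron \<Longrightarrow> z \<bullet> x \<le> (\<Sum>S\<in>K. t S * top_sum S) + r * top_sum (UNIV :: 'n set)"
    "\<And>x. x \<in> permutohedron \<Longrightarrow> z \<bullet> x = (\<Sum>S\<in>K. t S * top_sum S) + r * top_sum (UNIV :: 'n set) \<longleftrightarrow> x \<in> chain_face K"
proof -
  obtain K t r where K: "K \<in> proper_chains" "\<forall>S\<in>K. 0 < t S"
      "z = (\<Sum>S\<in>K. t S *\<^sub>R set_vector S) + r *\<^sub>R set_vector UNIV"
    using exists_chain_decomposition[of z] by auto
  have t: "\<forall>S\<in>K. 0 \<le> t S" using K(2) by (simp add: less_imp_le)
  show ?thesis
    by (rule that[OF K]) (use chain_sum_inner_le[OF _ t K(3)] K(2) in blast)+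
qed

lemma chain_face_face_of:
  fixes K :: "'n::finite set set"
  assumes K: "K \<in> proper_chains"
  shows "chain_face K face_of permutohedron"
proof -
  let ?z = "(\<Sum>S\<in>K. 1 *\<^sub>R set_vector S) + 0 *\<^sub>R set_vector UNIV :: real ^ 'n"
  let ?b = "(\<Sum>S\<in>K. 1 * top_sum S) + 0 * top_sum (UNIV :: 'n set)"
  note le = chain_sum_inner_le[of _ K "\<lambda>_. 1" ?z 0]
  have "permutohedron \<inter> {x. ?z \<bullet> x = ?b} face_of permutohedron"
    using le(1) by (intro face_of_Int_supporting_hyperplane_le) (auto simp: permutohedron_eq)
  moreover have "permutohedron \<inter> {x. ?z \<bullet> x = ?b} = chain_face K"
  proof (intro set_eqI iffI)
    show "x \<in> chain_face K" if "x \<in> permutohedron \<inter> {x. ?z \<bullet> x = ?b}" for x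
      using le(3) that by auto
    show "x \<in> permutohedron \<inter> {x. ?z \<bullet> x = ?b}" if "x \<in> chain_face K" for x
      using le(2)[of x] that by (auto simp: chain_face_def)
  qed
  ultimately show ?thesis by simp
qed

lemma polytope_permutohedron: "polytope (permutohedron :: (real ^ 'n::finite) set)"
proof -
  have "finite (rankings :: ('n \<Rightarrow> nat) set)"
  proof (rule finite_subset)
    show "rankings \<subseteq> (UNIV :: 'n set) \<rightarrow>\<^sub>E {1..CARD('n)}"
      by (auto simp: rankings_def bij_betw_def)
  qed (simp add: finite_PiE)
  then show ?thesis unfolding permutohedron_eq polytope_def by blast
qed

lemma face_of_permutohedron_chain:
  fixes F :: "(real ^ 'n::finite) set"
  assumes F: "F face_of permutohedron" "F \<noteq> {}"
  shows "\<exists>K\<in>proper_chains. F = chain_face K"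
proof -
  have "F exposed_face_of permutohedron"
    using F exposed_face_of_polyhedron polytope_permutohedron polytope_imp_polyhedron by blast
  then obtain a b where ab: "permutohedron \<subseteq> {x. a \<bullet> x \<le> b}" "F = permutohedron \<inter> {x. a \<bullet> x = b}"
    unfolding exposed_face_of_def by blast
  obtain K t r where K: "K \<in> proper_chains"
    "\<And>x. x \<in> permutohedron \<Longrightarrow> a \<bullet> x \<le> (\<Sum>S\<in>K. t S * top_sum S) + r * top_sum (UNIV :: 'n set)"
    "\<And>x. x \<in> permutohedron \<Longrightarrow> a \<bullet> x = (\<Sum>S\<in>K. t S * top_sum S) + r * top_sum (UNIV :: 'n set) \<longleftrightarrow> x \<in> chain_face K"
    by (rule exposed_by_chain[of a]) blast
  obtain x where x: "x \<in> chain_face K" using chain_face_nonempty[OF K(1)] by blast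
  obtain y where y: "y \<in> F" using F by blast
  have sub: "chain_face K \<subseteq> permutohedron" by (auto simp: chain_face_def)
  have "a \<bullet> x = (\<Sum>S\<in>K. t S * top_sum S) + r * top_sum (UNIV :: 'n set)" using K(3)[of x] x sub by blast
  moreover have "a \<bullet> x \<le> b" using ab(1) x sub by blast
  moreover have "a \<bullet> y = b" "a \<bullet> y \<le> (\<Sum>S\<in>K. t S * top_sum S) + r * top_sum (UNIV :: 'n set)"
    using ab(2) K(2)[of y] y by blast+
  ultimately have "b = (\<Sum>S\<in>K. t S * top_sum S) + r * top_sum (UNIV :: 'n set)" by simp
  then have "F = chain_face K" using ab(2) K(3) sub by auto
  then show ?thesis using K(1) by blast
qed

abbreviation diagonal :: "(real ^ 'n::finite) set" where
  "diagonal \<equiv> span {set_vector UNIV}"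

text \<open>Decompose a normal along some chain \<open>J\<close>. Its maximum is attained on all of
  \<open>chain_face K\<close>, so every ranking that serves \<open>K\<close> serves
  \<open>J\<close>, and \<open>mem_chain_if_always_ranked_highest\<close> gives
  \<open>J \<subseteq> K\<close>.\<close>

lemma normal_cone_chain_face:
  fixes K :: "'n::finite set set"
  assumes K: "K \<in> proper_chains"
  shows "normal_cone permutohedron (chain_face K) = cone_mod set_vector diagonal K"
proof
  show "cone_mod set_vector diagonal K \<subseteq> normal_cone permutohedron (chain_face K)"
  proof
    fix z assume "z \<in> cone_mod set_vector diagonal K"
    then obtain t r where tr: "\<forall>S\<in>K. 0 \<le> t S" "z = (\<Sum>S\<in>K. t S *\<^sub>R set_vector S) + r *\<^sub>R set_vector UNIV"
      by (auto simp: cone_mod_def span_singleton)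
    have "z \<bullet> y \<le> z \<bullet> x" if "x \<in> chain_face K" "y \<in> permutohedron" for x y
    proof -
      have "x \<in> permutohedron" using that by (simp add: chain_face_def)
      from chain_sum_inner_le(2)[OF this tr that(1)] chain_sum_inner_le(1)[OF that(2) tr]
      show ?thesis by simp
    qed
    then show "z \<in> normal_cone permutohedron (chain_face K)" by (simp add: normal_cone_def)
  qed
  show "normal_cone permutohedron (chain_face K) \<subseteq> cone_mod set_vector diagonal K"
  proof
    fix z assume z: "z \<in> normal_cone permutohedron (chain_face K)"
    obtain J t r where J: "J \<in> proper_chains" "\<forall>S\<in>J. 0 < t S"
      "z = (\<Sum>S\<in>J. t S *\<^sub>R set_vector S) + r *\<^sub>R set_vector UNIV"
      "\<And>x. x \<in> permutohedron \<Longrightarrow> z \<bullet> x \<le> (\<Sum>S\<in>J. t S * top_sum S) + r * top_sum (UNIV :: 'n set)"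
      "\<And>x. x \<in> permutohedron \<Longrightarrow> z \<bullet> x = (\<Sum>S\<in>J. t S * top_sum S) + r * top_sum (UNIV :: 'n set) \<longleftrightarrow> x \<in> chain_face J"
      by (rule exposed_by_chain[of z]) blast
    obtain y where y: "y \<in> chain_face J" using chain_face_nonempty[OF J(1)] by blast
    have sub: "chain_face I \<subseteq> permutohedron" for I :: "'n set set" by (auto simp: chain_face_def)
    have "x \<in> chain_face J" if x: "x \<in> chain_face K" for x
    proof -
      have "z \<bullet> y \<le> z \<bullet> x" using z x y sub by (auto simp: normal_cone_def)
      then show ?thesis using J(4)[of x] J(5)[of y] J(5)[of x] x y sub by (metis antisym subsetD)
    qed
    then have "ranks_highest \<sigma> S" if "S \<in> J" "\<sigma> \<in> rankings" "\<forall>T\<in>K. ranks_highest \<sigma> T" for S \<sigma>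
      using that ranking_vector_in_chain_face by blast
    then have JK: "J \<subseteq> K"
    proof (intro subsetI)
      fix S assume "S \<in> J"
      moreover have "S \<noteq> {}" "S \<noteq> UNIV" using J(1) \<open>S \<in> J\<close> by (auto simp: proper_chains_def)
      ultimately show "S \<in> K"
        using \<open>\<And>S \<sigma>. S \<in> J \<Longrightarrow> \<sigma> \<in> rankings \<Longrightarrow> \<forall>T\<in>K. ranks_highest \<sigma> T \<Longrightarrow> ranks_highest \<sigma> S\<close>
        by (intro mem_chain_if_always_ranked_highest[OF K])
    qed
    have "(\<Sum>S\<in>J. t S *\<^sub>R set_vector S) = (\<Sum>S\<in>K. (if S \<in> J then t S else 0) *\<^sub>R set_vector S)"
      using JK by (intro sum.mono_neutral_cong_left) auto
    then show "z \<in> cone_mod set_vector diagonal K"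
      unfolding cone_mod_def J(3) using J(2)
      by (intro CollectI exI[of _ "\<lambda>S. if S \<in> J then t S else 0"] exI[of _ "r *\<^sub>R set_vector UNIV"])
        (auto simp: less_imp_le span_scale span_base)
  qed
qed

text \<open>A point outside the largest member gives \<open>r = 0\<close>; a point of that member
  lying in no other one isolates its coefficient, and the member can be removed.\<close>

lemma chain_vectors_independent:
  fixes K :: "'n::finite set set"
  assumes "K \<in> proper_chains" "(\<Sum>S\<in>K. u S *\<^sub>R set_vector S) = r *\<^sub>R set_vector UNIV"
  shows "\<forall>S\<in>K. u S = 0"
  using assms
proof (induction "card K" arbitrary: K)
  case 0
  then show ?case by auto
next
  case (Suc n)
  have ne: "K \<noteq> {}" using Suc.hyps(2) by auto
  have chain: "\<forall>S\<in>J. \<forall>T\<in>J. S \<subseteq> T \<or> T \<subseteq> S" if "J \<subseteq> K" for J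
    using Suc.prems(1) that unfolding proper_chains_def by blast
  define S where "S = \<Union>K"
  have S: "S \<in> K" unfolding S_def using Union_Inter_mem_chain(1)[OF _ ne chain] by simp
  have at: "(\<Sum>T\<in>K. u T * of_bool (i \<in> T)) = r" for i
  proof -
    have "(\<Sum>T\<in>K. u T *\<^sub>R set_vector T) $ i = (r *\<^sub>R set_vector UNIV) $ i" using Suc.prems(2) by simp
    then show ?thesis by (simp add: set_vector_def)
  qed
  have S_proper: "S \<noteq> {}" "S \<noteq> UNIV" using Suc.prems(1) S unfolding proper_chains_def by blast+
  then obtain j where "j \<notin> S" by blast
  then have j: "j \<notin> T" if "T \<in> K" for T using that unfolding S_def by blast
  have "(\<Sum>T\<in>K. u T * of_bool (j \<in> T)) = 0" by (intro sum.neutral) (simp add: j)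
  then have r: "r = 0" using at[of j] by simp
  have "\<exists>i. i \<in> S \<and> i \<notin> \<Union>(K - {S})"
  proof (cases "K - {S} = {}")
    case True
    then show ?thesis using S_proper(1) by auto
  next
    case False
    then have "\<Union>(K - {S}) \<in> K - {S}" using Union_Inter_mem_chain(1)[OF _ False chain] by simp
    moreover have "\<Union>(K - {S}) \<subseteq> S" by (auto simp: S_def)
    ultimately show ?thesis by blast
  qed
  then obtain i where i: "i \<in> S" "\<And>T. T \<in> K \<Longrightarrow> T \<noteq> S \<Longrightarrow> i \<notin> T" by blast
  have "(\<Sum>T\<in>K. u T * of_bool (i \<in> T)) = u S"
    using S i by (subst sum.remove[of K S]) (auto intro!: sum.neutral)
  then have uS: "u S = 0" using at r by simp
  have "\<forall>T\<in>K - {S}. u T = 0"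
  proof (rule Suc.hyps(1))
    show "n = card (K - {S})" using S Suc.hyps(2) by simp
    show "K - {S} \<in> proper_chains" using Suc.prems(1) proper_chains_subset by blast
    show "(\<Sum>T\<in>K - {S}. u T *\<^sub>R set_vector T) = r *\<^sub>R set_vector UNIV"
      using Suc.prems(2) S uS by (simp add: sum.remove[of K S])
  qed
  then show ?case using uS by auto
qed

text \<open>Since \<open>s\<close> is positive, \<open>p\<close> takes its larger value where
  \<open>q\<close> holds, and the values 0 and 1 force \<open>r = 0\<close> and
  \<open>s = 1\<close>. In both fans this separates rays modulo the all-ones vector.\<close>

lemma zero_one_vectors_not_parallel:
  fixes s r :: real
  assumes "\<And>i. i \<in> I \<Longrightarrow> of_bool (p i) - s * of_bool (q i) = r" "s > 0"
    "\<exists>i\<in>I. q i" "\<exists>i\<in>I. \<not> q i" "\<exists>i\<in>I. p i" "\<exists>i\<in>I. \<not> p i" "i \<in> I"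
  shows "p i \<longleftrightarrow> q i"
proof -
  obtain a b where ab: "a \<in> I" "q a" "b \<in> I" "\<not> q b" using assms by blast
  have b: "of_bool (p b) = r" using assms(1)[OF ab(3)] ab by simp
  have a: "of_bool (p a) = r + s" using assms(1)[OF ab(1)] ab by simp
  have "\<not> p b" "p a" using a b \<open>s > 0\<close> by (cases "p a"; cases "p b"; simp)+
  then have "r = 0" "s = 1" using a b by auto
  then show ?thesis using assms(1)[OF \<open>i \<in> I\<close>] by (cases "p i"; cases "q i"; simp)
qed

lemma permutohedron_fan:
  "simplicial_normal_fan (permutohedron :: (real ^ 'n::finite) set) set_vector diagonal proper_chains"
proof
  show "polytope (permutohedron :: (real ^ 'n) set)" by (rule polytope_permutohedron)
  show "subspace (diagonal :: (real ^ 'n) set)" by simp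
  show "normal_fan permutohedron = cone_mod set_vector diagonal ` (proper_chains :: 'n set set set)"
  proof
    show "normal_fan permutohedron \<subseteq> cone_mod set_vector diagonal ` (proper_chains :: 'n set set set)"
      using face_of_permutohedron_chain normal_cone_chain_face by (fastforce simp: normal_fan_def)
    show "cone_mod set_vector diagonal ` (proper_chains :: 'n set set set) \<subseteq> normal_fan permutohedron"
      using normal_cone_chain_face chain_face_face_of chain_face_nonempty by (fastforce simp: normal_fan_def)
  qed
  show "finite K" for K :: "'n set set" by simp
  show "{} \<in> (proper_chains :: 'n set set set)" by (simp add: proper_chains_def)
  show "J \<in> proper_chains" if "K \<in> proper_chains" "J \<subseteq> K" for J K :: "'n set set"
    using proper_chains_subset that by blast
  show "u S = 0" if K: "K \<in> proper_chains" "(\<Sum>S\<in>K. u S *\<^sub>R set_vector S) \<in> diagonal" "S \<in> K"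
    for K and u :: "'n set \<Rightarrow> real" and S
  proof -
    obtain r where "(\<Sum>S\<in>K. u S *\<^sub>R set_vector S) = r *\<^sub>R set_vector UNIV"
      using K(2) by (auto simp: span_singleton)
    then show ?thesis using chain_vectors_independent K by blast
  qed
  show "S = T" if ST: "{S} \<in> proper_chains" "{T} \<in> proper_chains" "s > 0"
      "set_vector S - s *\<^sub>R set_vector T \<in> diagonal" for S T :: "'n set" and s
  proof -
    obtain r where "set_vector S - s *\<^sub>R set_vector T = r *\<^sub>R set_vector UNIV"
      using ST(4) by (auto simp: span_singleton)
    then have "of_bool (i \<in> S) - s * of_bool (i \<in> T) = r" for i
      by (simp add: vec_eq_iff set_vector_def)
    then have "i \<in> S \<longleftrightarrow> i \<in> T" for i
      using ST by (intro zero_one_vectors_not_parallel[of UNIV _ s _ r]) (auto simp: proper_chains_def)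
    then show ?thesis by blast
  qed
qed

section \<open>Chains as a head extension complex\<close>

definition inclusion :: "bool list \<Rightarrow> bool list \<Rightarrow> bool" where
  "inclusion g h \<longleftrightarrow> list_all2 (\<le>) g h"

interpretation chains: head_extension_complex
  "\<lambda>g h. inclusion g h \<or> inclusion h g" "\<lambda>g h. inclusion g h \<and> g \<noteq> h"
proof
  have anti: "inclusion g h \<Longrightarrow> inclusion h g \<Longrightarrow> g = h" for g h
    unfolding inclusion_def by (auto simp: list_all2_conv_all_nth intro!: nth_equalityI)
  have refl: "inclusion h h" for h by (simp add: inclusion_def list_all2_refl)
  have trans: "inclusion f g \<Longrightarrow> inclusion g h \<Longrightarrow> inclusion f h" for f g h
    unfolding inclusion_def by (rule list_all2_trans[of "(\<le>)" "(\<le>)"]) auto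
  have Cons: "inclusion (x # g) (y # h) \<longleftrightarrow> x \<le> y \<and> inclusion g h" for x y g h
    by (simp add: inclusion_def)
  show "inclusion [] [] \<or> inclusion [] []" by (simp add: inclusion_def)
  show "(inclusion (x # g) (y # h) \<or> inclusion (y # h) (x # g)) \<longleftrightarrow> (inclusion g h \<or> inclusion h g) \<and>
      (inclusion g h \<and> g \<noteq> h \<longrightarrow> x \<le> y) \<and> (inclusion h g \<and> h \<noteq> g \<longrightarrow> y \<le> x)" for x y g h
    unfolding Cons using anti refl by (cases x; cases y) auto
  show "\<not> (inclusion h h \<and> h \<noteq> h)" for h by simp
  show "inclusion f h \<and> f \<noteq> h" if "inclusion f g \<and> f \<noteq> g" "inclusion g h \<and> g \<noteq> h" for f g h
    using that trans anti by blast
  show "inclusion (replicate (length h) False) h \<and> replicate (length h) False \<noteq> h"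
    if "h \<noteq> replicate (length h) False" for h
    using that by (auto simp: inclusion_def list_all2_conv_all_nth)
  show "inclusion h (replicate (length h) True) \<and> h \<noteq> replicate (length h) True"
    if "h \<noteq> replicate (length h) True" for h
    using that by (auto simp: inclusion_def list_all2_conv_all_nth)
qed auto

text \<open>An enumeration of the index type turns sets into characteristic lists; the two improper
  sets become the two constants.\<close>

lemma card_proper_chains:
  "card {K \<in> (proper_chains :: 'n::finite set set set). card K = k} =
    card {K \<in> chains.reduced_cliques (CARD('n)). card K = k}"
proof -
  let ?n = "CARD('n)"
  obtain e :: "nat \<Rightarrow> 'n" where e: "bij_betw e {..<?n} UNIV"
    using ex_bij_betw_nat_finite[of "UNIV :: 'n set"] by (auto simp: atLeast0LessThan)
  define f where "f S = map (\<lambda>i. e i \<in> S) [0..<?n]" for S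
  have surj_e: "\<exists>i<?n. e i = a" for a
  proof -
    have "a \<in> e ` {..<?n}" using e by (simp add: bij_betw_def)
    then show ?thesis by auto
  qed
  have len: "length (f S) = ?n" for S by (simp add: f_def)
  have incl: "inclusion (f S) (f T) \<longleftrightarrow> S \<subseteq> T" for S T
  proof -
    have "inclusion (f S) (f T) \<longleftrightarrow> (\<forall>i<?n. e i \<in> S \<longrightarrow> e i \<in> T)"
      by (simp add: inclusion_def f_def list_all2_conv_all_nth)
    also have "\<dots> \<longleftrightarrow> S \<subseteq> T" using surj_e by (metis subset_iff)
    finally show ?thesis .
  qed
  have inj: "inj f" by (rule injI) (metis incl subset_antisym order_refl)
  have surj: "\<exists>S. f S = h" if "length h = ?n" for h
  proof
    have "e i = e j \<longleftrightarrow> i = j" if "i < ?n" "j < ?n" for i j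
      using e that by (auto simp: bij_betw_def inj_on_def)
    then show "f {e i | i. i < ?n \<and> h ! i} = h"
      using that by (intro nth_equalityI) (auto simp: f_def)
  qed
  have const: "f S = replicate ?n False \<longleftrightarrow> S = {}" "f S = replicate ?n True \<longleftrightarrow> S = UNIV" for S
  proof -
    have "f {} = replicate ?n False" "f UNIV = replicate ?n True"
      by (auto simp: f_def map_replicate_const)
    then show "f S = replicate ?n False \<longleftrightarrow> S = {}" "f S = replicate ?n True \<longleftrightarrow> S = UNIV"
      using inj by (metis injD)+
  qed
  have "bij_betw ((`) f) {K \<in> proper_chains. card K = k} {K \<in> chains.reduced_cliques ?n. card K = k}"
  proof (rule bij_betw_imageI)
    show "inj_on ((`) f) {K \<in> proper_chains. card K = k}"
      using inj by (simp add: inj_on_def inj_image_eq_iff)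
    have iff: "f ` K \<in> chains.reduced_cliques ?n \<longleftrightarrow> K \<in> proper_chains" for K
    proof -
      have "f ` K \<in> chains.cliques ?n \<longleftrightarrow> (\<forall>S\<in>K. \<forall>T\<in>K. S \<subseteq> T \<or> T \<subseteq> S)"
        by (simp add: chains.cliques_def image_subset_iff len incl)
      moreover have "f ` K \<inter> chains.constants ?n = {} \<longleftrightarrow>
          (\<forall>S\<in>K. f S \<noteq> replicate ?n False \<and> f S \<noteq> replicate ?n True)"
        unfolding chains.constants_def by blast
      ultimately show ?thesis
        by (simp add: chains.reduced_cliques_def proper_chains_def const conj_commute)
    qed
    show "(`) f ` {K \<in> proper_chains. card K = k} = {K \<in> chains.reduced_cliques ?n. card K = k}"
    proof
      show "(`) f ` {K \<in> proper_chains. card K = k} \<subseteq> {K \<in> chains.reduced_cliques ?n. card K = k}"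
        using iff inj by (auto simp: card_image inj_on_subset)
      show "{K \<in> chains.reduced_cliques ?n. card K = k} \<subseteq> (`) f ` {K \<in> proper_chains. card K = k}"
      proof
        fix K assume K: "K \<in> {K \<in> chains.reduced_cliques ?n. card K = k}"
        have "K \<subseteq> range f"
        proof
          fix h assume "h \<in> K"
          then have "length h = ?n" using K unfolding chains.reduced_cliques_def chains.cliques_def by blast
          then show "h \<in> range f" using surj by blast
        qed
        then obtain J where "K = f ` J" by (metis subset_imageE)
        then show "K \<in> (`) f ` {K \<in> proper_chains. card K = k}"
          using K iff inj by (auto simp: card_image inj_on_subset)
      qed
    qed
  qed
  then show ?thesis by (rule bij_betw_same_card)
qed

section \<open>Good routes as 0/1 vectors\<close>

text \<open>The bit \<open>b\<close> is the current row: at the first difference the first list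
  leaves that row and the second stays. This mirrors the end of a shared walk, where one route takes
  a red edge and the other a blue one.\<close>

fun switches_first :: "bool \<Rightarrow> bool list \<Rightarrow> bool list \<Rightarrow> bool" where
  "switches_first b (x # g) (y # h) = (if x = y then switches_first x g h else x \<noteq> b)"
| "switches_first b _ _ = False"

text \<open>An order of Gray code type: first the lists that start in row_number \<open>False\<close>, by increasing
  eagerness to switch rows, then those that start in row_number \<open>True\<close>, by decreasing eagerness.\<close>

fun switch_less :: "bool list \<Rightarrow> bool list \<Rightarrow> bool" where
  "switch_less (x # g) (y # h) =
     (if x \<noteq> y then y else if x then switches_first x g h else switches_first x h g)"
| "switch_less _ _ = False"

text \<open>The recursion is the one demanded by \<open>R_Cons\<close>;
  \<open>compatible_row_walk\<close> shows that it describes the compatibility of routes.\<close>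

fun row_compatible :: "bool list \<Rightarrow> bool list \<Rightarrow> bool" where
  "row_compatible (x # g) (y # h) \<longleftrightarrow>
     row_compatible g h \<and> (switch_less g h \<longrightarrow> x \<le> y) \<and> (switch_less h g \<longrightarrow> y \<le> x)"
| "row_compatible [] [] \<longleftrightarrow> True"
| "row_compatible _ _ \<longleftrightarrow> False"

lemma switches_first_irrefl: "\<not> switches_first b h h"
  by (induction h arbitrary: b) auto

lemma switches_first_trans:
  "length f = length g \<Longrightarrow> length g = length h \<Longrightarrow> switches_first b f g \<Longrightarrow> switches_first b g h \<Longrightarrow>
   switches_first b f h"
  by (induction f g h arbitrary: b rule: list_induct3) (auto split: if_splits)

lemma switches_first_total:
  "length g = length h \<Longrightarrow> g \<noteq> h \<Longrightarrow> switches_first b g h \<or> switches_first b h g"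
  by (induction g h arbitrary: b rule: list_induct2) auto

lemma switches_first_replicate:
  "h \<noteq> replicate (length h) b \<Longrightarrow> switches_first b h (replicate (length h) b)"
  by (induction h) auto

interpretation rows: head_extension_complex row_compatible switch_less
proof
  show "\<not> switch_less h h" for h
    by (cases h) (auto simp: switches_first_irrefl)
  show "switch_less f h" if "switch_less f g" "switch_less g h" "length f = length g" "length g = length h" for f g h
    using that
    by (cases f; cases g; cases h) (auto split: if_splits intro: switches_first_trans[rotated 2])
  show "switch_less g h \<or> switch_less h g" if "length g = length h" "g \<noteq> h" for g h
    using that by (cases g; cases h) (auto dest: switches_first_total)
  show "switch_less (replicate (length h) False) h" if "h \<noteq> replicate (length h) False" for h
    using that by (cases h) (auto intro: switches_first_replicate)
  show "switch_less h (replicate (length h) True)" if "h \<noteq> replicate (length h) True" for h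
    using that by (cases h) (auto intro: switches_first_replicate)
qed auto

section \<open>Walks built from lists of rows\<close>

definition row_number :: "bool \<Rightarrow> nat" where
  "row_number b = (if b then 2 else 1)"

lemma row_number_eq_iff [simp]: "row_number b = row_number b' \<longleftrightarrow> b = b'"
  by (simp add: row_number_def)

lemma row_number_in [simp]: "row_number b \<in> {1, 2}"
  by (simp add: row_number_def)

text \<open>A walk from the sources to the sinks without backtracking is given by the list of the rows
  (\<open>False\<close> for 1, \<open>True\<close> for 2) in which its blue edges run.\<close>

fun arrival_walk :: "nat \<Rightarrow> bool \<Rightarrow> bool list \<Rightarrow> vertex list" where
  "arrival_walk a b [] = [(a, row_number b)]"
| "arrival_walk a b (x # h) =
     (a, row_number b) # (if x = b then arrival_walk (Suc a) x h else (a, row_number x) # arrival_walk (Suc a) x h)"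

text \<open>Suffixes of a route come in two kinds: after a blue edge a red one may follow, while
  after a red edge the next must be blue. In a conflict the shared walk starts an
  \<open>arrival_walk\<close> of one route and a \<open>departure_walk\<close> of the other.\<close>

definition departure_walk :: "nat \<Rightarrow> bool \<Rightarrow> bool list \<Rightarrow> vertex list" where
  "departure_walk a b h = (a, row_number b) # arrival_walk (Suc a) b h"

definition row_walk :: "bool list \<Rightarrow> vertex list" where
  "row_walk h = departure_walk 0 (hd h) (tl h)"

lemma arrival_walk_nonempty [simp]: "arrival_walk a b h \<noteq> []"
  by (cases h) auto

lemma hd_arrival_walk [simp]: "hd (arrival_walk a b h) = (a, row_number b)"
  by (cases h) auto

lemma departure_walk_nonempty [simp]: "departure_walk a b h \<noteq> []"
  by (simp add: departure_walk_def)

lemma hd_departure_walk [simp]: "hd (departure_walk a b h) = (a, row_number b)"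
  by (simp add: departure_walk_def)

lemma blue_edge [simp]: "((a, row_number b), (a', row_number b')) \<in> blue_edges c \<longleftrightarrow> a' = Suc a \<and> b = b' \<and> a \<le> c"
  by (auto simp: blue_edges_def row_number_def)

lemma red_edge [simp]: "((a, row_number b), (a', row_number b')) \<in> red_edges c \<longleftrightarrow> a = a' \<and> b \<noteq> b' \<and> 1 \<le> a \<and> a \<le> c"
  by (auto simp: red_edges_def row_number_def)

lemma blue_edge_cases:
  assumes "(u, v) \<in> blue_edges c"
  obtains a b where "u = (a, row_number b)" "v = (Suc a, row_number b)" "a \<le> c"
proof -
  obtain a b where "u = (a, b)" "v = (Suc a, b)" "a \<le> c" "b = 1 \<or> b = 2"
    using assms by (auto simp: blue_edges_def)
  then show ?thesis using that[of a "b = 2"] by (auto simp: row_number_def)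
qed

lemma red_edge_cases:
  assumes "(u, v) \<in> red_edges c"
  obtains a b where "u = (a, row_number b)" "v = (a, row_number (\<not> b))" "1 \<le> a" "a \<le> c"
proof -
  obtain a b where "u = (a, b)" "v = (a, 3 - b)" "1 \<le> a" "a \<le> c" "b = 1 \<or> b = 2"
    using assms by (auto simp: red_edges_def)
  then show ?thesis using that[of a "b = 2"] by (auto simp: row_number_def)
qed

lemma walk_edges_Nil [simp]: "walk_edges [] = []"
  by (simp add: walk_edges_def)

lemma walk_edges_Cons: "walk_edges (v # w) = (if w = [] then [] else (v, hd w) # walk_edges w)"
  by (cases w) (auto simp: walk_edges_def)

lemma walk_edges_single [simp]: "walk_edges [v] = []"
  by (simp add: walk_edges_def)

lemma walk_edges_Cons2 [simp]: "walk_edges (u # v # w) = (u, v) # walk_edges (v # w)"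
  by (simp add: walk_edges_def)

lemma set_walk_edges_append:
  "set (walk_edges (u @ v)) =
     set (walk_edges u) \<union> (if u = [] \<or> v = [] then {} else {(last u, hd v)}) \<union> set (walk_edges v)"
  by (induction u) (auto simp: walk_edges_Cons)

section \<open>Conflicts between row walks\<close>

definition suffix_after :: "edge set \<Rightarrow> vertex list \<Rightarrow> vertex list \<Rightarrow> bool" where
  "suffix_after X w u \<longleftrightarrow> (\<exists>P. w = P @ u \<and> P \<noteq> [] \<and> u \<noteq> [] \<and> (last P, hd u) \<in> X)"

text \<open>The condition of a conflict at the end of the shared walk; \<open>suffix_after\<close>
  is the condition at its start. Splitting the two makes both recursive in the walk.\<close>

definition diverges :: "nat \<Rightarrow> vertex list \<Rightarrow> vertex list \<Rightarrow> bool" where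
  "diverges c u u' \<longleftrightarrow> (\<exists>S Q Q'. u = S @ Q \<and> u' = S @ Q' \<and> S \<noteq> [] \<and> Q \<noteq> [] \<and> Q' \<noteq> [] \<and>
     (last S, hd Q) \<in> red_edges c \<and> (last S, hd Q') \<in> blue_edges c)"

lemma conflict_iff:
  "conflict c (Walk w) (Walk w') \<longleftrightarrow>
     (\<exists>u u'. suffix_after (blue_edges c) w u \<and> suffix_after (red_edges c) w' u' \<and> diverges c u u')"
proof
  assume "conflict c (Walk w) (Walk w')"
  then obtain P S Q P' Q' where *: "w = P @ S @ Q" "w' = P' @ S @ Q'"
      "S \<noteq> []" "P \<noteq> []" "Q \<noteq> []" "P' \<noteq> []" "Q' \<noteq> []"
      "(last P, hd S) \<in> blue_edges c" "(last S, hd Q) \<in> red_edges c"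
      "(last P', hd S) \<in> red_edges c" "(last S, hd Q') \<in> blue_edges c"
    unfolding conflict_def by auto
  then have "suffix_after (blue_edges c) w (S @ Q)" "suffix_after (red_edges c) w' (S @ Q')"
    by (auto simp: suffix_after_def)
  moreover have "diverges c (S @ Q) (S @ Q')" unfolding diverges_def using * by blast
  ultimately show "\<exists>u u'. suffix_after (blue_edges c) w u \<and> suffix_after (red_edges c) w' u' \<and> diverges c u u'"
    by blast
next
  assume "\<exists>u u'. suffix_after (blue_edges c) w u \<and> suffix_after (red_edges c) w' u' \<and> diverges c u u'"
  then obtain u u' where u: "suffix_after (blue_edges c) w u" "suffix_after (red_edges c) w' u'" "diverges c u u'"
    by blast
  from u(1) obtain P where P: "w = P @ u" "P \<noteq> []" "(last P, hd u) \<in> blue_edges c"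
    unfolding suffix_after_def by blast
  from u(2) obtain P' where P': "w' = P' @ u'" "P' \<noteq> []" "(last P', hd u') \<in> red_edges c"
    unfolding suffix_after_def by blast
  from u(3) obtain S Q Q' where Q: "u = S @ Q" "u' = S @ Q'" "S \<noteq> []" "Q \<noteq> []" "Q' \<noteq> []"
      "(last S, hd Q) \<in> red_edges c" "(last S, hd Q') \<in> blue_edges c"
    unfolding diverges_def by blast
  note * = P P' Q
  then have "Walk w = Walk (P @ S @ Q)" "Walk w' = Walk (P' @ S @ Q')"
    "(last P, hd S) \<in> blue_edges c" "(last P', hd S) \<in> red_edges c"
    by simp_all
  with * show "conflict c (Walk w) (Walk w')" unfolding conflict_def by blast
qed

lemma suffix_after_Cons:
  "suffix_after X (v # w) u \<longleftrightarrow> (w = u \<and> u \<noteq> [] \<and> (v, hd u) \<in> X) \<or> suffix_after X w u"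
proof
  assume "suffix_after X (v # w) u"
  then obtain P where P: "v # w = P @ u" "P \<noteq> []" "u \<noteq> []" "(last P, hd u) \<in> X"
    by (auto simp: suffix_after_def)
  then obtain P' where P': "P = v # P'" "w = P' @ u" by (cases P) auto
  then show "(w = u \<and> u \<noteq> [] \<and> (v, hd u) \<in> X) \<or> suffix_after X w u"
    using P by (cases "P' = []") (auto simp: suffix_after_def)
next
  assume "(w = u \<and> u \<noteq> [] \<and> (v, hd u) \<in> X) \<or> suffix_after X w u"
  then show "suffix_after X (v # w) u"
  proof
    assume "w = u \<and> u \<noteq> [] \<and> (v, hd u) \<in> X"
    then show ?thesis unfolding suffix_after_def by (intro exI[of _ "[v]"]) auto
  next
    assume "suffix_after X w u"
    then obtain P where "w = P @ u" "P \<noteq> []" "u \<noteq> []" "(last P, hd u) \<in> X"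
      by (auto simp: suffix_after_def)
    then show ?thesis unfolding suffix_after_def by (intro exI[of _ "v # P"]) auto
  qed
qed

lemma suffix_after_Nil [simp]: "\<not> suffix_after X [] u"
  by (simp add: suffix_after_def)

lemma diverges_Cons:
  "diverges c (v # w) (v' # w') \<longleftrightarrow> v = v' \<and>
     (w \<noteq> [] \<and> w' \<noteq> [] \<and> (v, hd w) \<in> red_edges c \<and> (v, hd w') \<in> blue_edges c \<or> diverges c w w')"
proof
  assume "diverges c (v # w) (v' # w')"
  then obtain S Q Q' where *: "v # w = S @ Q" "v' # w' = S @ Q'" "S \<noteq> []" "Q \<noteq> []" "Q' \<noteq> []"
      "(last S, hd Q) \<in> red_edges c" "(last S, hd Q') \<in> blue_edges c"
    unfolding diverges_def by blast
  then obtain S' where S': "S = v # S'" "v = v'" "w = S' @ Q" "w' = S' @ Q'" by (cases S) auto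
  show "v = v' \<and> (w \<noteq> [] \<and> w' \<noteq> [] \<and> (v, hd w) \<in> red_edges c \<and> (v, hd w') \<in> blue_edges c \<or> diverges c w w')"
  proof (cases "S' = []")
    case False
    then have "diverges c w w'" unfolding diverges_def using * S' by (intro exI[of _ S'] exI[of _ Q] exI[of _ Q']) auto
    then show ?thesis using S' by simp
  qed (use * S' in auto)
next
  assume *: "v = v' \<and> (w \<noteq> [] \<and> w' \<noteq> [] \<and> (v, hd w) \<in> red_edges c \<and> (v, hd w') \<in> blue_edges c \<or> diverges c w w')"
  then consider "w \<noteq> []" "w' \<noteq> []" "(v, hd w) \<in> red_edges c" "(v, hd w') \<in> blue_edges c" | "diverges c w w'"
    by blast
  then show "diverges c (v # w) (v' # w')"
  proof cases
    case 1
    then show ?thesis unfolding diverges_def using *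
      by (intro exI[of _ "[v]"] exI[of _ w] exI[of _ w']) auto
  next
    case 2
    then obtain S Q Q' where "w = S @ Q" "w' = S @ Q'" "S \<noteq> []" "Q \<noteq> []" "Q' \<noteq> []"
      "(last S, hd Q) \<in> red_edges c" "(last S, hd Q') \<in> blue_edges c"
      unfolding diverges_def by blast
    then show ?thesis unfolding diverges_def using *
      by (intro exI[of _ "v # S"] exI[of _ Q] exI[of _ Q']) auto
  qed
qed

lemma diverges_hd: "diverges c u u' \<Longrightarrow> hd u = hd u'"
  unfolding diverges_def by (metis hd_append2)

lemma diverges_single [simp]: "\<not> diverges c [v] w"
  by (auto simp: diverges_def append_eq_Cons_conv Cons_eq_append_conv)

text \<open>Having arrived in the same row, both walks choose in each column between staying and
  taking a red edge. They part at the first difference of the lists, where the one that switches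
  takes the red edge.\<close>

lemma diverges_arrival_walk:
  "length g = length h \<Longrightarrow> 1 \<le> a \<Longrightarrow> a + length g \<le> Suc c \<Longrightarrow>
   diverges c (arrival_walk a b g) (arrival_walk a b h) \<longleftrightarrow> switches_first b g h"
proof (induction g h arbitrary: a b rule: list_induct2)
  case (Cons x g y h)
  have IH: "diverges c (arrival_walk (Suc a) b g) (arrival_walk (Suc a) b h) \<longleftrightarrow> switches_first b g h" for b
    using Cons.IH[of "Suc a" b] Cons.prems by simp
  have ne: "\<not> diverges c (arrival_walk (Suc a) b g) ((a, z) # w)" "\<not> diverges c ((a, z) # w) (arrival_walk (Suc a) b h)"
    for b z w
    using diverges_hd by fastforce+
  show ?case
    using Cons.prems IH[of b] IH[of x] ne by (auto simp: diverges_Cons)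
qed simp

lemma suffix_after_blue_departure:
  "a \<le> c \<Longrightarrow> suffix_after (blue_edges c) (departure_walk a b (x # h)) u \<longleftrightarrow>
     u = arrival_walk (Suc a) b (x # h) \<or> suffix_after (blue_edges c) (departure_walk (Suc a) x h) u"
  by (cases "x = b") (auto simp: departure_walk_def suffix_after_Cons)

lemma suffix_after_red_departure_Nil:
  "\<not> suffix_after (red_edges c) (departure_walk a b []) u"
  by (auto simp: departure_walk_def suffix_after_Cons)

lemma suffix_after_red_departure:
  "a < c \<Longrightarrow> suffix_after (red_edges c) (departure_walk a b (x # h)) u \<longleftrightarrow>
     x \<noteq> b \<and> u = departure_walk (Suc a) x h \<or> suffix_after (red_edges c) (departure_walk (Suc a) x h) u"
  by (cases "x = b") (auto simp: departure_walk_def suffix_after_Cons)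

lemma level_arrival_walk: "v \<in> set (arrival_walk a b h) \<Longrightarrow> a \<le> fst v"
  by (induction h arbitrary: a b) (auto split: if_splits dest: Suc_leD)

lemma suffix_after_level:
  assumes "suffix_after X (departure_walk a b h) u"
  shows "Suc a \<le> fst (hd u)"
proof -
  obtain P where "departure_walk a b h = P @ u" "P \<noteq> []" "u \<noteq> []"
    using assms by (auto simp: suffix_after_def)
  then have "hd u \<in> set (arrival_walk (Suc a) b h)"
    by (cases P) (auto simp: departure_walk_def)
  then show ?thesis by (rule level_arrival_walk)
qed

text \<open>For a shared walk that starts in column \<open>Suc a\<close>, the second route must
  enter its row by a red edge, \<open>x' \<noteq> b'\<close>, and the first must arrive there by a
  blue one, \<open>b = x'\<close>. They part at once if \<open>x \<noteq> b\<close>, and otherwise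
  at the first difference of \<open>g\<close> and \<open>h\<close>. Shared walks that start in a
  later column belong to the remaining routes; suffixes starting in different columns share nothing
  at their start.\<close>

lemma conflict_departure:
  assumes len: "length g = length h" and a: "Suc a + length g \<le> c"
  shows "conflict c (Walk (departure_walk a b (x # g))) (Walk (departure_walk a b' (x' # h))) \<longleftrightarrow>
    x' \<noteq> b' \<and> b = x' \<and> (x \<noteq> b \<or> switches_first b g h) \<or>
    conflict c (Walk (departure_walk (Suc a) x g)) (Walk (departure_walk (Suc a) x' h))"
proof -
  have no1: "\<not> diverges c (arrival_walk (Suc a) b (x # g)) u'"
    if "suffix_after (red_edges c) (departure_walk (Suc a) x' h) u'" for u'
  proof
    assume "diverges c (arrival_walk (Suc a) b (x # g)) u'"
    from diverges_hd[OF this] have "hd u' = (Suc a, row_number b)" by simp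
    then show False using suffix_after_level[OF that] by simp
  qed
  have no2: "\<not> diverges c u (departure_walk (Suc a) x' h)"
    if "suffix_after (blue_edges c) (departure_walk (Suc a) x g) u" for u
  proof
    assume "diverges c u (departure_walk (Suc a) x' h)"
    from diverges_hd[OF this] have "hd u = (Suc a, row_number x')" by simp
    then show False using suffix_after_level[OF that] by simp
  qed
  have "diverges c (arrival_walk (Suc a) b (x # g)) (departure_walk (Suc a) x' h) \<longleftrightarrow>
      b = x' \<and> (x \<noteq> b \<or> switches_first b g h)"
  proof (cases "x = b")
    case True
    then have "diverges c (arrival_walk (Suc a) b (x # g)) (departure_walk (Suc a) x' h) \<longleftrightarrow>
        b = x' \<and> diverges c (arrival_walk (Suc (Suc a)) b g) (arrival_walk (Suc (Suc a)) b h)"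
      by (auto simp: departure_walk_def diverges_Cons)
    also have "\<dots> \<longleftrightarrow> b = x' \<and> switches_first b g h"
      using a by (subst diverges_arrival_walk[OF len]) auto
    finally show ?thesis using True by simp
  next
    case False
    then show ?thesis using a by (auto simp: departure_walk_def diverges_Cons)
  qed
  then show ?thesis
    using a no1 no2 unfolding conflict_iff
    by (auto simp: suffix_after_blue_departure suffix_after_red_departure simp del: arrival_walk.simps)
qed

lemma compatible_departure:
  "length g = length h \<Longrightarrow> a + length g \<le> c \<Longrightarrow>
   compatible c (Walk (departure_walk a b g)) (Walk (departure_walk a b' h)) \<longleftrightarrow>
   row_compatible (b # g) (b' # h)"
proof (induction g h arbitrary: a b b' rule: list_induct2)
  case Nil
  have "\<not> conflict c (Walk (departure_walk a b [])) (Walk (departure_walk a b' []))" for b b'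
    unfolding conflict_iff by (simp add: suffix_after_red_departure_Nil)
  then show ?case by (simp add: compatible_def)
next
  case (Cons x g x' h)
  have IH: "compatible c (Walk (departure_walk (Suc a) x g)) (Walk (departure_walk (Suc a) x' h)) \<longleftrightarrow>
      row_compatible (x # g) (x' # h)"
    using Cons.IH[of "Suc a"] Cons.prems by simp
  \<comment> \<open>Both sides hold if \<open>b = b'\<close>. Otherwise different heads
    \<open>x\<close>, \<open>x'\<close> decide the matter, and for equal heads the first switch
    does. With common head \<open>True\<close> it is the route with previous row \<open>True\<close>
    that arrives by a blue edge, with common head \<open>False\<close> the other one; hence the
    reversal in \<open>switch_less\<close>.\<close>
  have *: "\<not> (x' \<noteq> b' \<and> b = x' \<and> (x \<noteq> b \<or> switches_first b g h)) \<and>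
      \<not> (x \<noteq> b \<and> b' = x \<and> (x' \<noteq> b' \<or> switches_first b' h g)) \<longleftrightarrow>
      (switch_less (x # g) (x' # h) \<longrightarrow> b \<le> b') \<and> (switch_less (x' # h) (x # g) \<longrightarrow> b' \<le> b)"
    by (cases b; cases b'; cases x; cases x') auto
  have "compatible c (Walk (departure_walk a b (x # g))) (Walk (departure_walk a b' (x' # h))) \<longleftrightarrow>
      compatible c (Walk (departure_walk (Suc a) x g)) (Walk (departure_walk (Suc a) x' h)) \<and>
      \<not> (x' \<noteq> b' \<and> b = x' \<and> (x \<noteq> b \<or> switches_first b g h)) \<and>
      \<not> (x \<noteq> b \<and> b' = x \<and> (x' \<noteq> b' \<or> switches_first b' h g))"
    unfolding compatible_def using Cons.hyps Cons.prems by (subst (1 2) conflict_departure) auto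
  also have "\<dots> \<longleftrightarrow> row_compatible (b # x # g) (b' # x' # h)"
    unfolding * IH by (simp only: row_compatible.simps)
  finally show ?case .
qed

lemma compatible_row_walk:
  assumes "length g = Suc c" "length h = Suc c"
  shows "compatible c (Walk (row_walk g)) (Walk (row_walk h)) \<longleftrightarrow> row_compatible g h"
  using assms compatible_departure[of "tl g" "tl h" 0 c "hd g" "hd h"]
  by (cases g; cases h) (auto simp: row_walk_def)

section \<open>Good routes are exactly the row walks\<close>

lemma last_arrival_walk: "last (arrival_walk a b h) = (a + length h, row_number (last (b # h)))"
  by (induction h arbitrary: a b) auto

lemma walk_edges_arrival_walk:
  "1 \<le> a \<Longrightarrow> a + length h \<le> Suc c \<Longrightarrow> set (walk_edges (arrival_walk a b h)) \<subseteq> edges c"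
  by (induction h arbitrary: a b) (auto simp: walk_edges_Cons edges_def)

lemma source_sink_row_walk:
  assumes "length h = Suc c"
  shows "source_sink_walk c (row_walk h)"
proof -
  have "set (walk_edges (row_walk h)) \<subseteq> edges c"
    using walk_edges_arrival_walk[of 1 "tl h" c "hd h"] assms
    by (auto simp: row_walk_def departure_walk_def walk_edges_Cons edges_def)
  moreover have "last (row_walk h) \<in> {c + 1} \<times> {1, 2}"
    using assms row_number_in by (simp add: row_walk_def departure_walk_def last_arrival_walk)
  ultimately show ?thesis
    using row_number_in by (simp add: source_sink_walk_def row_walk_def)
qed

lemma two_cycle_subset_red: "C \<in> two_cycles c \<Longrightarrow> C \<subseteq> red_edges c"
  by (auto simp: two_cycles_def red_edges_def)

lemma blue_not_red: "e \<in> blue_edges c \<Longrightarrow> e \<notin> red_edges c'"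
  by (auto simp: blue_edges_def red_edges_def)

lemma good_walk_short [simp]: "good_walk c [u, v]"
  by (auto simp: good_walk_def Cons_eq_append_conv)

lemma good_walk_Cons3:
  "good_walk c (x # y # z # w) \<longleftrightarrow> {(x, y), (y, z)} \<notin> two_cycles c \<and> good_walk c (y # z # w)"
proof -
  have "(\<exists>es e e' es'. walk_edges (x # y # z # w) = es @ [e, e'] @ es' \<and> {e, e'} \<in> two_cycles c) \<longleftrightarrow>
    {(x, y), (y, z)} \<in> two_cycles c \<or>
    (\<exists>es e e' es'. walk_edges (y # z # w) = es @ [e, e'] @ es' \<and> {e, e'} \<in> two_cycles c)" (is "?L \<longleftrightarrow> ?M \<or> ?R")
  proof
    assume ?L
    then obtain es e e' es' where *: "walk_edges (x # y # z # w) = es @ [e, e'] @ es'" "{e, e'} \<in> two_cycles c"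
      by blast
    show "?M \<or> ?R"
    proof (cases es)
      case Nil
      then show ?thesis using * by auto
    next
      case (Cons d ds)
      then have "walk_edges (y # z # w) = ds @ [e, e'] @ es'" using *(1) by simp
      then show ?thesis using *(2) by blast
    qed
  next
    assume "?M \<or> ?R"
    then show ?L
    proof
      assume ?M
      then show ?L
        by (intro exI[of _ "[]"] exI[of _ "(x, y)"] exI[of _ "(y, z)"] exI[of _ "walk_edges (z # w)"]) simp
    next
      assume ?R
      then obtain es e e' es' where "walk_edges (y # z # w) = es @ [e, e'] @ es'" "{e, e'} \<in> two_cycles c"
        by blast
      then show ?L
        by (intro exI[of _ "(x, y) # es"] exI[of _ e] exI[of _ e'] exI[of _ es']) simp
    qed
  qed
  then show ?thesis unfolding good_walk_def by blast
qed

lemma good_walk_tail: "good_walk c (x # w) \<Longrightarrow> good_walk c w"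
  by (cases w rule: remdups_adj.cases) (auto simp: good_walk_Cons3, auto simp: good_walk_def)

lemma good_departure_walk: "a + length h \<le> c \<Longrightarrow> good_walk c (departure_walk a b h)"
proof (induction h arbitrary: a b)
  case Nil
  then show ?case by (simp add: departure_walk_def)
next
  case (Cons x h)
  have IH: "good_walk c (departure_walk (Suc a) x h)" using Cons by simp
  obtain w where w: "arrival_walk (Suc (Suc a)) x h = (Suc (Suc a), row_number x) # w"
    by (cases h) auto
  have blue: "{e, e'} \<notin> two_cycles c" if "e \<in> blue_edges c \<or> e' \<in> blue_edges c" for e e'
    using that two_cycle_subset_red blue_not_red by blast
  show ?case
  proof (cases "x = b")
    case True
    show ?thesis using IH Cons.prems w unfolding True by (simp add: departure_walk_def good_walk_Cons3 blue)
  next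
    case False
    then show ?thesis using IH Cons.prems w by (simp add: departure_walk_def good_walk_Cons3 blue)
  qed
qed

text \<open>Induction on the number \<open>k\<close> of columns left. After a red edge a second red
  edge would complete a 2-cycle, so a blue edge leads on to the next column; no edge leaves the last
  column.\<close>

lemma good_walk_arrivalD:
  "u \<noteq> [] \<Longrightarrow> hd u = (a, row_number b) \<Longrightarrow> 1 \<le> a \<Longrightarrow> a + k = Suc c \<Longrightarrow> set (walk_edges u) \<subseteq> edges c \<Longrightarrow>
   fst (last u) = Suc c \<Longrightarrow> good_walk c u \<Longrightarrow> \<exists>h. length h = k \<and> u = arrival_walk a b h"
proof (induction k arbitrary: u a b)
  case 0
  obtain u' where u: "u = (a, row_number b) # u'" using "0.prems"(1,2) by (cases u) auto
  have "u' = []"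
  proof (rule ccontr)
    assume "u' \<noteq> []"
    then have "((a, row_number b), hd u') \<in> edges c" using "0.prems" u by (auto simp: walk_edges_Cons)
    then show False using "0.prems" by (auto simp: edges_def elim: blue_edge_cases red_edge_cases)
  qed
  then show ?case using u by auto
next
  case (Suc k)
  obtain u' where u: "u = (a, row_number b) # u'" using Suc.prems(1,2) by (cases u) auto
  have "u' \<noteq> []" using Suc.prems u by auto
  then obtain v u'' where u': "u' = v # u''" by (cases u') auto
  have "((a, row_number b), v) \<in> edges c" using Suc.prems(5) u u' by auto
  then consider "((a, row_number b), v) \<in> blue_edges c" | "((a, row_number b), v) \<in> red_edges c"
    by (auto simp: edges_def)
  then show ?case
  proof cases
    case 1
    then have v: "v = (Suc a, row_number b)" by (auto elim!: blue_edge_cases)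
    have "good_walk c u'"
      using Suc.prems(7) u good_walk_tail by blast
    then obtain h where "length h = k" "u' = arrival_walk (Suc a) b h"
      using Suc.IH[of u' "Suc a" b] Suc.prems u u' v by auto
    then show ?thesis using u by (intro exI[of _ "b # h"]) simp
  next
    case 2
    then have v: "v = (a, row_number (\<not> b))" by (auto elim!: red_edge_cases)
    have "u'' \<noteq> []" using Suc.prems u u' v by auto
    then obtain z u3 where u'': "u'' = z # u3" by (cases u'') auto
    have "(v, z) \<in> edges c" using Suc.prems(5) u u' u'' by auto
    moreover have "(v, z) \<notin> red_edges c"
    proof
      assume "(v, z) \<in> red_edges c"
      then have "z = (a, row_number b)" using v by (auto elim!: red_edge_cases)
      then have "{((a, row_number b), v), (v, z)} \<in> two_cycles c"
        using v Suc.prems(3,4) by (cases b) (auto simp: two_cycles_def row_number_def intro!: image_eqI[of _ _ a])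
      then show False using Suc.prems(7) u u' u'' by (simp add: good_walk_Cons3)
    qed
    ultimately have z: "z = (Suc a, row_number (\<not> b))" using v by (auto simp: edges_def elim!: blue_edge_cases)
    have "good_walk c u''"
      using Suc.prems(7) u u' good_walk_tail by blast
    then obtain h where "length h = k" "u'' = arrival_walk (Suc a) (\<not> b) h"
      using Suc.IH[of u'' "Suc a" "\<not> b"] Suc.prems u u' u'' z by auto
    then show ?thesis using u u' v by (intro exI[of _ "(\<not> b) # h"]) simp
  qed
qed

lemma good_routes_eq: "good_routes c = (\<lambda>h. Walk (row_walk h)) ` {h. length h = Suc c}"
proof
  show "good_routes c \<subseteq> (\<lambda>h. Walk (row_walk h)) ` {h. length h = Suc c}"
  proof
    fix \<rho> assume "\<rho> \<in> good_routes c"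
    then obtain w where w: "\<rho> = Walk w" "source_sink_walk c w" "good_walk c w"
      by (auto simp: good_routes_def)
    then obtain v u where vu: "w = v # u" by (cases w) (auto simp: source_sink_walk_def)
    have "fst v = 0" "fst (last w) = Suc c" using w vu by (auto simp: source_sink_walk_def)
    then have u: "u \<noteq> []" "fst (last u) = Suc c" using vu by (cases "u = []"; simp)+
    then have "(v, hd u) \<in> edges c" "set (walk_edges u) \<subseteq> edges c"
      using w vu by (auto simp: source_sink_walk_def walk_edges_Cons)
    then obtain b where b: "v = (0, row_number b)" "hd u = (1, row_number b)"
      using \<open>fst v = 0\<close> by (auto simp: edges_def elim!: blue_edge_cases red_edge_cases)
    have "good_walk c u" using w(3) vu good_walk_tail by blast
    then obtain h where "length h = c" "u = arrival_walk 1 b h"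
      using good_walk_arrivalD[of u 1 b c c] u b \<open>set (walk_edges u) \<subseteq> edges c\<close> by auto
    then have "\<rho> = Walk (row_walk (b # h))" "length (b # h) = Suc c"
      using w(1) vu b(1) by (simp_all add: row_walk_def departure_walk_def)
    then show "\<rho> \<in> (\<lambda>h. Walk (row_walk h)) ` {h. length h = Suc c}" by blast
  qed
  show "(\<lambda>h. Walk (row_walk h)) ` {h. length h = Suc c} \<subseteq> good_routes c"
    using source_sink_row_walk good_departure_walk
    by (auto simp: good_routes_def row_walk_def)
qed

section \<open>Bits as coordinates of the indicator vector\<close>

lemma top_edge_arrival_walk:
  "((k, 2), (Suc k, 2)) \<in> set (walk_edges (arrival_walk a b h)) \<longleftrightarrow> a \<le> k \<and> k < a + length h \<and> h ! (k - a)"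
proof (induction h arbitrary: a b)
  case (Cons x h)
  have "((k, 2), (Suc k, 2)) \<in> set (walk_edges (arrival_walk a b (x # h))) \<longleftrightarrow>
      k = a \<and> x \<or> ((k, 2), (Suc k, 2)) \<in> set (walk_edges (arrival_walk (Suc a) x h))"
    by (cases x; cases b) (auto simp: walk_edges_Cons row_number_def)
  also have "\<dots> \<longleftrightarrow> k = a \<and> x \<or> Suc a \<le> k \<and> k < Suc a + length h \<and> h ! (k - Suc a)"
    unfolding Cons.IH ..
  also have "\<dots> \<longleftrightarrow> a \<le> k \<and> k < a + length (x # h) \<and> (x # h) ! (k - a)"
    by (auto simp: nth_Cons' Suc_le_eq le_less)
  finally show ?case .
qed simp

text \<open>The blue edges in row 2 read off the bits of a route; these coordinates alone carry all
  later arguments about linear relations.\<close>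

lemma top_edge_row_walk:
  assumes "length h = Suc c" "k \<le> c"
  shows "((k, 2), (Suc k, 2)) \<in> set (walk_edges (row_walk h)) \<longleftrightarrow> h ! k"
proof -
  obtain b g where h: "h = b # g" using assms by (cases h) auto
  show ?thesis
    using assms top_edge_arrival_walk[of k 1 b g]
    by (cases k) (auto simp: h row_walk_def departure_walk_def walk_edges_Cons row_number_def)
qed

lemma inj_row_walk: "inj_on row_walk {h. length h = Suc c}"
proof (rule inj_onI)
  fix g h assume "g \<in> {h. length h = Suc c}" "h \<in> {h. length h = Suc c}" "row_walk g = row_walk h"
  then show "g = h"
    using top_edge_row_walk[of g c] top_edge_row_walk[of h c]
    by (intro nth_equalityI) (simp_all add: less_Suc_eq_le)
qed

section \<open>Exceptional routes\<close>

lemma conflict_red_edges: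
  assumes "conflict c (Walk w) (Walk w')"
  shows "set (walk_edges w) \<inter> red_edges c \<noteq> {}" "set (walk_edges w') \<inter> red_edges c \<noteq> {}"
proof -
  obtain P S Q P' Q' where *: "w = P @ S @ Q" "w' = P' @ S @ Q'"
      "S \<noteq> []" "P \<noteq> []" "Q \<noteq> []" "P' \<noteq> []" "Q' \<noteq> []"
      "(last S, hd Q) \<in> red_edges c" "(last P', hd S) \<in> red_edges c"
    using assms unfolding conflict_def by auto
  then have "(last S, hd Q) \<in> set (walk_edges w)" "(last P', hd S) \<in> set (walk_edges w')"
    by (auto simp: set_walk_edges_append)
  then show "set (walk_edges w) \<inter> red_edges c \<noteq> {}" "set (walk_edges w') \<inter> red_edges c \<noteq> {}"
    using * by blast+
qed

lemma walk_edges_constant_arrival: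
  "a + k \<le> Suc c \<Longrightarrow> set (walk_edges (arrival_walk a b (replicate k b))) \<subseteq> blue_edges c"
  by (induction k arbitrary: a) (auto simp: walk_edges_Cons)

lemma constant_row_walk_exceptional: "Walk (row_walk (replicate (Suc c) b)) \<in> exceptional_routes c"
proof -
  have "set (walk_edges (row_walk (replicate (Suc c) b))) \<subseteq> blue_edges c"
    using walk_edges_constant_arrival[of 1 c c b]
    by (auto simp: row_walk_def departure_walk_def walk_edges_Cons)
  then have no_red: "set (walk_edges (row_walk (replicate (Suc c) b))) \<inter> red_edges c = {}"
    using blue_not_red by blast
  have "compatible c (Walk (row_walk (replicate (Suc c) b))) \<rho>" for \<rho>
  proof (cases \<rho>)
    case (TwoCycle C)
    then show ?thesis by (simp add: compatible_def conflict_def)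
  next
    case (Walk w)
    then show ?thesis using conflict_red_edges no_red unfolding compatible_def by blast
  qed
  moreover have "source_sink_walk c (row_walk (replicate (Suc c) b))"
    by (rule source_sink_row_walk) simp
  ultimately show ?thesis by (auto simp: exceptional_routes_def routes_def)
qed

lemma two_cycle_exceptional: "C \<in> two_cycles c \<Longrightarrow> TwoCycle C \<in> exceptional_routes c"
  by (auto simp: exceptional_routes_def routes_def compatible_def conflict_def)

text \<open>The first red edge of a walk that starts with a blue edge has a blue predecessor. The
  vertex between the two will be the whole shared walk of a conflict.\<close>

lemma first_red_edge:
  assumes "set (walk_edges (v # u)) \<subseteq> edges c" "u \<noteq> []" "(v, hd u) \<notin> red_edges c"
    "set (walk_edges (v # u)) \<inter> red_edges c \<noteq> {}"
  shows "\<exists>P p x y Q. v # u = P @ [p, x, y] @ Q \<and> (p, x) \<in> blue_edges c \<and> (x, y) \<in> red_edges c"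
  using assms
proof (induction u arbitrary: v)
  case (Cons x u)
  have blue: "(v, x) \<in> blue_edges c" using Cons.prems by (auto simp: edges_def)
  have "u \<noteq> []" using Cons.prems by auto
  then obtain y u' where u: "u = y # u'" by (cases u) auto
  show ?case
  proof (cases "(x, y) \<in> red_edges c")
    case True
    then show ?thesis using blue u by (intro exI[of _ "[]"]) auto
  next
    case False
    then have "\<exists>P p z y Q. x # u = P @ [p, z, y] @ Q \<and> (p, z) \<in> blue_edges c \<and> (z, y) \<in> red_edges c"
      using Cons.prems u by (intro Cons.IH) auto
    then obtain P p z y Q where "x # u = P @ [p, z, y] @ Q" "(p, z) \<in> blue_edges c" "(z, y) \<in> red_edges c"
      by blast
    then show ?thesis by (intro exI[of _ "v # P"] exI[of _ p] exI[of _ z] exI[of _ y] exI[of _ Q]) auto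
  qed
qed simp

lemma walk_edges_line:
  assumes "n \<le> c + 2"
  shows "set (walk_edges (map (\<lambda>i. (i, row_number b)) [m..<n])) \<subseteq> blue_edges c"
  using assms by (auto simp: walk_edges_def set_zip nth_tl)

text \<open>A walk whose first red edge switches rows at some level is in conflict with the walk whose
  only switch is the opposite one at that level.\<close>

lemma exceptional_walk_no_red:
  assumes "Walk w \<in> exceptional_routes c"
  shows "set (walk_edges w) \<inter> red_edges c = {}"
proof (rule ccontr)
  assume red: "set (walk_edges w) \<inter> red_edges c \<noteq> {}"
  have w: "source_sink_walk c w" "\<And>\<rho>. \<rho> \<in> routes c \<Longrightarrow> compatible c (Walk w) \<rho>"
    using assms by (auto simp: exceptional_routes_def routes_def)
  obtain v u where vu: "w = v # u" using w by (cases w) (auto simp: source_sink_walk_def)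
  have "u \<noteq> []" using red vu by auto
  moreover have "(v, hd u) \<notin> red_edges c"
    using w(1) vu by (auto simp: source_sink_walk_def elim!: red_edge_cases)
  moreover have "set (walk_edges (v # u)) \<subseteq> edges c" using w(1) vu by (simp add: source_sink_walk_def)
  ultimately obtain P p x y Q where *: "w = P @ [p, x, y] @ Q" "(p, x) \<in> blue_edges c" "(x, y) \<in> red_edges c"
    using first_red_edge[of v u c] red unfolding vu by blast
  obtain a b where ab: "x = (a, row_number b)" "y = (a, row_number (\<not> b))" "1 \<le> a" "a \<le> c"
    using *(3) by (rule red_edge_cases)
  let ?P = "map (\<lambda>i. (i, row_number (\<not> b))) [0..<Suc a]" and ?Q = "map (\<lambda>i. (i, row_number b)) [Suc a..<c + 2]"
  let ?w = "?P @ [x] @ ?Q"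
  have hdQ: "hd ?Q = (Suc a, row_number b)" "?Q \<noteq> []" using ab by (simp_all add: hd_map del: upt_Suc)
  have lastP: "last ?P = (a, row_number (\<not> b))" by simp
  have lastQ: "last ?Q = (Suc c, row_number b)" using ab by (simp add: last_map del: upt_Suc)
  have "source_sink_walk c ?w"
  proof -
    have "set (walk_edges ?w) \<subseteq> edges c"
      using walk_edges_line[of "Suc a" c "\<not> b" 0] walk_edges_line[of "c + 2" c b "Suc a"] ab hdQ lastP
      by (auto simp: set_walk_edges_append walk_edges_Cons edges_def simp del: upt_Suc)
    moreover have "hd ?w \<in> {0} \<times> {1, 2}" using row_number_in by (simp add: hd_append hd_map del: upt_Suc)
    moreover have "last ?w \<in> {c + 1} \<times> {1, 2}" using lastQ hdQ(2) row_number_in by (simp del: upt_Suc)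
    ultimately show ?thesis by (simp add: source_sink_walk_def)
  qed
  then have "Walk ?w \<in> routes c" by (simp add: routes_def)
  moreover have "conflict c (Walk w) (Walk ?w)"
    unfolding conflict_def
    by (rule exI[of _ "P @ [p]"], rule exI[of _ "[x]"], rule exI[of _ "y # Q"], rule exI[of _ ?P], rule exI[of _ ?Q])
      (use * ab hdQ lastP in \<open>simp del: upt_Suc\<close>)
  ultimately show False using w(2) unfolding compatible_def by blast
qed

lemma top_edge_blue_walk:
  "w \<noteq> [] \<Longrightarrow> set (walk_edges w) \<subseteq> blue_edges c \<Longrightarrow> fst (last w) = Suc c \<Longrightarrow> hd w = (a, row_number b) \<Longrightarrow>
   ((k, 2), (Suc k, 2)) \<in> set (walk_edges w) \<longleftrightarrow> a \<le> k \<and> k \<le> c \<and> b"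
proof (induction w arbitrary: a)
  case (Cons v w)
  show ?case
  proof (cases "w = []")
    case True
    then show ?thesis using Cons.prems by auto
  next
    case False
    then have "(v, hd w) \<in> blue_edges c" using Cons.prems by (auto simp: walk_edges_Cons)
    then have hd: "hd w = (Suc a, row_number b)" "a \<le> c" using Cons.prems by (auto elim!: blue_edge_cases)
    have "((k, 2), (Suc k, 2)) \<in> set (walk_edges w) \<longleftrightarrow> Suc a \<le> k \<and> k \<le> c \<and> b"
      using False Cons.prems hd by (intro Cons.IH) (auto simp: walk_edges_Cons)
    then show ?thesis
      using False Cons.prems hd by (auto simp: walk_edges_Cons row_number_def)
  qed
qed simp

text \<open>A 2-cycle has no blue edge, and an exceptional walk has no red one and so stays in its
  row. Thus in the coordinates that read off bits, exceptional routes span at most the multiples of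
  the all-ones vector.\<close>

lemma exceptional_top_edges:
  assumes "\<rho> \<in> exceptional_routes c" "i \<le> c" "j \<le> c"
  shows "((i, 2), (Suc i, 2)) \<in> route_edges \<rho> \<longleftrightarrow> ((j, 2), (Suc j, 2)) \<in> route_edges \<rho>"
proof (cases \<rho>)
  case (TwoCycle C)
  then have "C \<in> two_cycles c" using assms(1) by (auto simp: exceptional_routes_def routes_def)
  then show ?thesis using TwoCycle by (auto simp: two_cycles_def)
next
  case (Walk w)
  then have w: "source_sink_walk c w" using assms(1) by (auto simp: exceptional_routes_def routes_def)
  then have "set (walk_edges w) \<subseteq> blue_edges c"
    using exceptional_walk_no_red[of w c] assms(1) Walk by (auto simp: source_sink_walk_def edges_def)
  moreover obtain b where "hd w = (0, row_number b)"
  proof -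
    obtain r where "hd w = (0, r)" "r = 1 \<or> r = 2" using w by (auto simp: source_sink_walk_def)
    then show ?thesis using that[of "r = 2"] by (auto simp: row_number_def)
  qed
  ultimately have "((k, 2), (Suc k, 2)) \<in> set (walk_edges w) \<longleftrightarrow> 0 \<le> k \<and> k \<le> c \<and> b" for k
    using w by (intro top_edge_blue_walk) (auto simp: source_sink_walk_def)
  then show ?thesis using Walk assms by simp
qed

section \<open>Row walks are balanced flows\<close>

lemma distinct_arrival_walk: "distinct (arrival_walk a b h)"
proof (induction h arbitrary: a b)
  case (Cons x h)
  have "(a, r) \<notin> set (arrival_walk (Suc a) x h)" for r
    using level_arrival_walk by fastforce
  then show ?case using Cons by auto
qed simp

lemma distinct_row_walk: "distinct (row_walk h)"
  using distinct_arrival_walk level_arrival_walk[of "(0, row_number (hd h))"]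
  by (fastforce simp: row_walk_def departure_walk_def)

lemma card_edges_into:
  "distinct w \<Longrightarrow> card {e \<in> set (walk_edges w). snd e = v} = of_bool (v \<in> set (tl w))"
proof (induction w)
  case (Cons u w)
  show ?case
  proof (cases "w = []")
    case False
    then have ne: "w = hd w # tl w" by simp
    have fin: "finite {e \<in> set (walk_edges w). snd e = v}" by simp
    have "u \<notin> set w" using Cons.prems by simp
    then have "(u, hd w) \<notin> set (walk_edges w)" by (auto simp: walk_edges_def dest: set_zip_leftD)
    moreover have "{e \<in> set (walk_edges (u # w)). snd e = v} =
        (if hd w = v then insert (u, hd w) {e \<in> set (walk_edges w). snd e = v}
         else {e \<in> set (walk_edges w). snd e = v})"
      using False by (auto simp: walk_edges_Cons)
    moreover have "hd w \<notin> set (tl w)" using Cons.prems ne by (metis distinct.simps(2))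
    moreover have "v \<in> set w \<longleftrightarrow> v = hd w \<or> v \<in> set (tl w)" using ne by (metis set_ConsD list.set_intros)
    ultimately show ?thesis using Cons fin by auto
  qed simp
qed simp

lemma card_edges_out_of:
  "distinct w \<Longrightarrow> card {e \<in> set (walk_edges w). fst e = v} = of_bool (v \<in> set (butlast w))"
proof (induction w)
  case (Cons u w)
  show ?case
  proof (cases "w = []")
    case False
    have fin: "finite {e \<in> set (walk_edges w). fst e = v}" by simp
    have u: "u \<notin> set w" using Cons.prems by simp
    then have "(u, hd w) \<notin> set (walk_edges w)" by (auto simp: walk_edges_def dest: set_zip_leftD)
    moreover have "{e \<in> set (walk_edges (u # w)). fst e = v} =
        (if u = v then insert (u, hd w) {e \<in> set (walk_edges w). fst e = v}
         else {e \<in> set (walk_edges w). fst e = v})"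
      using False by (auto simp: walk_edges_Cons)
    moreover have "u \<notin> set (butlast w)" using u by (meson in_set_butlastD)
    ultimately show ?thesis using Cons fin False by auto
  qed simp
qed simp

text \<open>Needed because \<open>quotient_projection\<close> describes the kernel of
  \<open>q\<close> on balanced flows only. A row walk has no repeated vertices and neither starts
  nor ends at an internal vertex, so it enters each as often as it leaves it.\<close>

lemma good_route_balanced:
  fixes lab :: "'e::finite \<Rightarrow> edge"
  assumes lab: "bij_betw lab UNIV (edges c)" and h: "length h = Suc c"
  shows "indicator_vector lab (Walk (row_walk h)) \<in> balanced_flows c lab"
proof -
  let ?w = "row_walk h"
  have w: "source_sink_walk c ?w" using source_sink_row_walk h by blast
  then have sub: "set (walk_edges ?w) \<subseteq> edges c" by (simp add: source_sink_walk_def)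
  have count: "(\<Sum>e | p (lab e). indicator_vector lab (Walk ?w) $ e) = real (card {e \<in> set (walk_edges ?w). p e})" for p
  proof -
    have "(\<Sum>e | p (lab e). indicator_vector lab (Walk ?w) $ e) =
        (\<Sum>e | p (lab e) \<and> lab e \<in> set (walk_edges ?w). 1)"
      unfolding indicator_vector_def by (intro sum.mono_neutral_cong_right) (auto simp: indicator_def)
    also have "\<dots> = real (card {e. p (lab e) \<and> lab e \<in> set (walk_edges ?w)})" by simp
    also have "card {e. p (lab e) \<and> lab e \<in> set (walk_edges ?w)} = card {e \<in> set (walk_edges ?w). p e}"
    proof (rule bij_betw_same_card[of lab], rule bij_betw_subset[OF lab])
      show "lab ` {e. p (lab e) \<and> lab e \<in> set (walk_edges ?w)} = {e \<in> set (walk_edges ?w). p e}"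
      proof
        show "{e \<in> set (walk_edges ?w). p e} \<subseteq> lab ` {e. p (lab e) \<and> lab e \<in> set (walk_edges ?w)}"
        proof
          fix e assume e: "e \<in> {e \<in> set (walk_edges ?w). p e}"
          then have "e \<in> range lab" using sub lab by (auto simp: bij_betw_def)
          then show "e \<in> lab ` {e. p (lab e) \<and> lab e \<in> set (walk_edges ?w)}" using e by auto
        qed
      qed auto
    qed simp
    finally show ?thesis .
  qed
  have "v \<in> set (tl ?w) \<longleftrightarrow> v \<in> set (butlast ?w)" if v: "v \<in> internal_vertices c" for v
  proof -
    have ne: "?w \<noteq> []" using w by (simp add: source_sink_walk_def)
    have "hd ?w \<noteq> v" "last ?w \<noteq> v" using w v by (auto simp: source_sink_walk_def internal_vertices_def)
    moreover have "v \<in> set ?w \<longleftrightarrow> v = hd ?w \<or> v \<in> set (tl ?w)" using ne by (cases ?w) auto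
    moreover have "v \<in> set ?w \<longleftrightarrow> v \<in> set (butlast ?w) \<or> v = last ?w"
    proof -
      have "set ?w = set (butlast ?w @ [last ?w])" using ne by simp
      then show ?thesis by auto
    qed
    ultimately show ?thesis by auto
  qed
  then show ?thesis
    unfolding balanced_flows_def
    by (simp add: count[of "\<lambda>e. snd e = _"] count[of "\<lambda>e. fst e = _"] card_edges_into card_edges_out_of distinct_row_walk)
qed

section \<open>The mutoperhedron\<close>

locale mutoperhedron =
  fixes c :: nat and lab :: "'e::finite \<Rightarrow> edge"
    and q :: "real ^ 'e \<Rightarrow> 'q::euclidean_space" and M :: "'q set"
  assumes lab: "bij_betw lab UNIV (edges c)"
    and q: "quotient_projection (balanced_flows c lab) (exceptional_span c lab) q"
    and polytope_M: "polytope M"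
    and fan_M: "normal_fan M = DKK_red c lab q"
begin

definition ray :: "bool list \<Rightarrow> 'q" where
  "ray h = q (indicator_vector lab (Walk (row_walk h)))"

lemma linear_q: "linear q"
  using q by (simp add: quotient_projection_def)

lemma q_exceptional:
  assumes "\<rho> \<in> exceptional_routes c"
  shows "q (indicator_vector lab \<rho>) = 0"
proof -
  have "indicator_vector lab \<rho> \<in> exceptional_span c lab"
    using assms by (auto simp: exceptional_span_def intro: span_base)
  then show ?thesis using q by (auto simp: quotient_projection_def)
qed

definition top_edge :: "nat \<Rightarrow> 'e" where
  "top_edge k = inv lab ((k, 2), (Suc k, 2))"

lemma lab_top_edge:
  assumes "k \<le> c"
  shows "lab (top_edge k) = ((k, 2), (Suc k, 2))"
proof -
  have "((k, 2), (Suc k, 2)) \<in> edges c" using assms by (auto simp: edges_def blue_edges_def)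
  then have "((k, 2), (Suc k, 2)) \<in> range lab" using lab by (simp add: bij_betw_def)
  then show ?thesis unfolding top_edge_def by (rule f_inv_into_f)
qed

lemma indicator_top_edge:
  assumes "length h = Suc c" "k < Suc c"
  shows "indicator_vector lab (Walk (row_walk h)) $ top_edge k = of_bool (h ! k)"
  using assms top_edge_row_walk[of h c k] by (simp add: indicator_vector_def lab_top_edge indicator_def)

lemma exceptional_span_top_edges:
  assumes "x \<in> exceptional_span c lab" "i < Suc c"
  shows "x $ top_edge i = x $ top_edge 0"
proof -
  have "exceptional_span c lab \<subseteq> {x. x $ top_edge i = x $ top_edge 0}"
    unfolding exceptional_span_def
  proof (rule span_minimal)
    show "indicator_vector lab ` exceptional_routes c \<subseteq> {x. x $ top_edge i = x $ top_edge 0}"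
      using exceptional_top_edges[of _ c i 0] assms
      by (auto simp: indicator_vector_def lab_top_edge indicator_def less_Suc_eq_le)
    show "subspace {x :: real ^ 'e. x $ top_edge i = x $ top_edge 0}"
      by (auto simp: subspace_def)
  qed
  then show ?thesis using assms by auto
qed

lemma subspace_balanced_flows: "subspace (balanced_flows c lab)"
  unfolding balanced_flows_def subspace_def
  by (auto simp: sum.distrib sum_distrib_left[symmetric])

text \<open>The relation lifts to a balanced flow in the kernel of \<open>q\<close>, that is, in the
  span of the exceptional routes, whose row 2 coordinates are all equal.\<close>

lemma ray_combination_zero:
  assumes K: "\<And>h. h \<in> K \<Longrightarrow> length h = Suc c" and zero: "(\<Sum>h\<in>K. u h *\<^sub>R ray h) = 0"
  shows "\<exists>r. \<forall>i<Suc c. (\<Sum>h\<in>K. u h * of_bool (h ! i)) = r"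
proof -
  let ?x = "\<Sum>h\<in>K. u h *\<^sub>R indicator_vector lab (Walk (row_walk h))"
  have "?x \<in> balanced_flows c lab"
    using K good_route_balanced[OF lab] by (intro subspace_sum subspace_scale subspace_balanced_flows) auto
  moreover have "q ?x = 0"
    using zero linear_q by (simp add: linear_sum linear_scale ray_def)
  ultimately have "?x \<in> exceptional_span c lab" using q by (auto simp: quotient_projection_def)
  from exceptional_span_top_edges[OF this]
  obtain r where "\<forall>i<Suc c. ?x $ top_edge i = r" by blast
  moreover have "?x $ top_edge i = (\<Sum>h\<in>K. u h * of_bool (h ! i))" if "i < Suc c" for i
    using K that by (auto simp: indicator_top_edge intro!: sum.cong)
  ultimately show ?thesis by auto
qed

lemma ray_constant: "h \<in> rows.constants (Suc c) \<Longrightarrow> ray h = 0"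
  using q_exceptional constant_row_walk_exceptional by (auto simp: rows.constants_def ray_def)

lemma q_cone:
  "q ` (convex_cone hull (indicator_vector lab ` K)) = convex_cone hull ((\<lambda>\<rho>. q (indicator_vector lab \<rho>)) ` K)"
  using convex_cone_hull_linear_image[OF linear_q, of "indicator_vector lab ` K"] by (simp add: image_image)

text \<open>The map \<open>q\<close> sends 2-cycles and the two constant routes to 0, so discarding
  them from a compatible set does not change the projected cone; what is left is a reduced
  clique.\<close>

lemma DKK_red_eq: "DKK_red c lab q = cone_mod ray {0} ` rows.reduced_cliques (Suc c)"
proof
  show "DKK_red c lab q \<subseteq> cone_mod ray {0} ` rows.reduced_cliques (Suc c)"
  proof
    fix C assume "C \<in> DKK_red c lab q"
    then obtain K where K: "K \<subseteq> TwoCycle ` two_cycles c \<union> good_routes c" "pairwise (compatible c) K"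
        "C = convex_cone hull ((\<lambda>\<rho>. q (indicator_vector lab \<rho>)) ` K)"
      unfolding DKK_red_def DKK_def using q_cone by auto
    define J where "J = {h. length h = Suc c \<and> h \<notin> rows.constants (Suc c) \<and> Walk (row_walk h) \<in> K}"
    have "row_compatible g h" if gh: "g \<in> J" "h \<in> J" for g h
    proof (cases "g = h")
      case False
      then have "Walk (row_walk g) \<noteq> Walk (row_walk h)"
        using gh inj_row_walk[of c] by (auto simp: J_def inj_on_def)
      then have "compatible c (Walk (row_walk g)) (Walk (row_walk h))"
        using K(2) gh by (auto simp: J_def pairwise_def)
      then show ?thesis using gh compatible_row_walk by (auto simp: J_def)
    qed (simp add: rows.R_refl)
    then have J: "J \<in> rows.reduced_cliques (Suc c)"
      by (auto simp: rows.reduced_cliques_def rows.cliques_def J_def)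
    have "C = cone_mod ray {0} J"
      unfolding K(3)
    proof (rule convex_cone_hull_eq_cone_mod)
      show "finite J" using J rows.finite_clique by (auto simp: rows.reduced_cliques_def)
      show "ray ` J \<subseteq> (\<lambda>\<rho>. q (indicator_vector lab \<rho>)) ` K" by (auto simp: J_def ray_def)
      show "(\<lambda>\<rho>. q (indicator_vector lab \<rho>)) ` K \<subseteq> ray ` J \<union> {0}"
      proof
        fix x assume "x \<in> (\<lambda>\<rho>. q (indicator_vector lab \<rho>)) ` K"
        then obtain \<rho> where \<rho>: "\<rho> \<in> K" "x = q (indicator_vector lab \<rho>)" by blast
        then consider C where "C \<in> two_cycles c" "\<rho> = TwoCycle C"
          | h where "length h = Suc c" "\<rho> = Walk (row_walk h)"
          using K(1) good_routes_eq by blast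
        then show "x \<in> ray ` J \<union> {0}"
        proof cases
          case 1
          then show ?thesis using q_exceptional two_cycle_exceptional \<rho>(2) by blast
        next
          case 2
          then show ?thesis using \<rho> ray_constant[of h] by (auto simp: ray_def J_def)
        qed
      qed
    qed
    then show "C \<in> cone_mod ray {0} ` rows.reduced_cliques (Suc c)" using J by blast
  qed
  show "cone_mod ray {0} ` rows.reduced_cliques (Suc c) \<subseteq> DKK_red c lab q"
  proof
    fix C assume "C \<in> cone_mod ray {0} ` rows.reduced_cliques (Suc c)"
    then obtain J where J: "J \<in> rows.cliques (Suc c)" "C = cone_mod ray {0} J"
      by (auto simp: rows.reduced_cliques_def)
    define K where "K = (\<lambda>h. Walk (row_walk h)) ` J"
    have len: "length h = Suc c" if "h \<in> J" for h using J that by (auto simp: rows.cliques_def)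
    have "K \<subseteq> good_routes c" using len by (auto simp: K_def good_routes_eq)
    moreover have "pairwise (compatible c) K"
      using J compatible_row_walk len by (auto simp: K_def pairwise_def rows.cliques_def)
    moreover have "q ` (convex_cone hull (indicator_vector lab ` K)) = C"
    proof -
      have "(\<lambda>\<rho>. q (indicator_vector lab \<rho>)) ` K = ray ` J"
        by (simp add: K_def ray_def image_image)
      moreover have "convex_cone hull (ray ` J) = C"
        unfolding J(2) by (rule convex_cone_hull_eq_cone_mod) (use J rows.finite_clique in auto)
      ultimately show ?thesis by (simp add: q_cone)
    qed
    ultimately show "C \<in> DKK_red c lab q" unfolding DKK_red_def DKK_def by blast
  qed
qed

text \<open>Here the lineality space is \<open>{0}\<close>: \<open>q\<close> has already divided out
  the exceptional routes, which play the role of the all-ones vector.\<close>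

lemma mutoperhedron_fan: "simplicial_normal_fan M ray {0} (rows.reduced_cliques (Suc c))"
proof
  show "polytope M" by (rule polytope_M)
  show "subspace ({0} :: 'q set)" by simp
  show "normal_fan M = cone_mod ray {0} ` rows.reduced_cliques (Suc c)" using fan_M DKK_red_eq by simp
  show "finite K" if "K \<in> rows.reduced_cliques (Suc c)" for K
    using that rows.finite_clique by (auto simp: rows.reduced_cliques_def)
  show "{} \<in> rows.reduced_cliques (Suc c)"
    by (simp add: rows.reduced_cliques_def rows.cliques_def)
  show "J \<in> rows.reduced_cliques (Suc c)" if "K \<in> rows.reduced_cliques (Suc c)" "J \<subseteq> K" for J K
    using that by (auto simp: rows.reduced_cliques_def rows.cliques_def subset_iff)
  show "u h = 0" if K: "K \<in> rows.reduced_cliques (Suc c)" "(\<Sum>h\<in>K. u h *\<^sub>R ray h) \<in> {0}" "h \<in> K" for K u h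
  proof -
    have "length g = Suc c" if "g \<in> K" for g
      using K(1) that by (auto simp: rows.reduced_cliques_def rows.cliques_def)
    then obtain r where "\<forall>i<Suc c. (\<Sum>h\<in>K. u h * of_bool (h ! i)) = r"
      using ray_combination_zero[of K u] K(2) by auto
    then show ?thesis using rows.reduced_clique_independent[OF K(1), of u r] K(3) by blast
  qed
  show "g = h" if gh: "{g} \<in> rows.reduced_cliques (Suc c)" "{h} \<in> rows.reduced_cliques (Suc c)"
      "s > 0" "ray g - s *\<^sub>R ray h \<in> {0}" for g h s
  proof (rule ccontr)
    assume ne: "g \<noteq> h"
    have len: "length g = Suc c" "length h = Suc c"
      using gh by (auto simp: rows.reduced_cliques_def rows.cliques_def)
    have mixed: "(\<exists>i\<in>{..<Suc c}. f ! i) \<and> (\<exists>i\<in>{..<Suc c}. \<not> f ! i)"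
      if "length f = Suc c" "f \<notin> rows.constants (Suc c)" for f
    proof (rule ccontr)
      assume "\<not> ((\<exists>i\<in>{..<Suc c}. f ! i) \<and> (\<exists>i\<in>{..<Suc c}. \<not> f ! i))"
      then obtain b where "\<forall>i<Suc c. f ! i = b" by auto
      then have "f = replicate (Suc c) b" using that(1) by (intro nth_equalityI) (auto simp del: replicate_Suc)
      then show False using that(2) by (cases b) (auto simp: rows.constants_def)
    qed
    let ?u = "\<lambda>f. if f = g then 1 else - s"
    have "(\<Sum>f\<in>{g, h}. ?u f *\<^sub>R ray f) = 0" using ne gh(4) by simp
    then obtain r where "\<forall>i<Suc c. (\<Sum>f\<in>{g, h}. ?u f * of_bool (f ! i)) = r"
      using ray_combination_zero[of "{g, h}" ?u] len by auto
    moreover have "(\<Sum>f\<in>{g, h}. F f) = F g + F h" for F :: "bool list \<Rightarrow> real" using ne by simp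
    ultimately have "of_bool (g ! i) - s * of_bool (h ! i) = r" if "i \<in> {..<Suc c}" for i
      using that ne by simp
    then have "g ! i \<longleftrightarrow> h ! i" if "i \<in> {..<Suc c}" for i
      using mixed[of g] mixed[of h] len gh that
      by (intro zero_one_vectors_not_parallel[of "{..<Suc c}" "(!) g" s "(!) h" r])
        (auto simp: rows.reduced_cliques_def)
    then have "g = h" using len by (intro nth_equalityI) auto
    then show False using ne by simp
  qed
qed

end

section \<open>A clique with exactly five extensions\<close>

definition clique_link :: "nat \<Rightarrow> bool list set \<Rightarrow> bool list set" where
  "clique_link n K = {h. length h = n \<and> h \<notin> rows.constants n \<and> h \<notin> K \<and> (\<forall>k\<in>K. row_compatible h k)}"

text \<open>One more column without changing the number of extensions
  (\<open>clique_link_cone\<close>), so that a single example of length 4 serves all larger lengths.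
  All heads are equal and every tail is compatible with the all-\<open>False\<close> tail, so the
  result is a clique.\<close>

lemma cone_clique_reduced:
  assumes K: "K \<in> rows.reduced_cliques n" and n: "n \<noteq> 0"
  shows "insert (True # replicate n False) (Cons True ` K) \<in> rows.reduced_cliques (Suc n)"
proof -
  let ?F = "replicate n False" and ?K = "insert (True # replicate n False) (Cons True ` K)"
  have len: "length h = n" if "h \<in> K" for h
    using K that by (auto simp: rows.reduced_cliques_def rows.cliques_def)
  have RK: "row_compatible g h" if "g \<in> K" "h \<in> K" for g h
    using K that by (auto simp: rows.reduced_cliques_def rows.cliques_def)
  have const: "?F \<notin> K" "replicate n True \<notin> K"
    using K by (auto simp: rows.reduced_cliques_def rows.constants_def)
  have FR: "row_compatible h ?F" "row_compatible ?F h" if "length h = n" for h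
    using rows.R_constant[of h False] rows.R_sym[of h ?F] that by simp_all
  have "?F \<noteq> replicate n True" using n by (cases n) auto
  then have "h \<notin> rows.constants (Suc n)" if "h \<in> ?K" for h
    using that const by (auto simp: rows.constants_def)
  moreover have "length h = Suc n" if "h \<in> ?K" for h using that len by auto
  moreover have "row_compatible g h" if "g \<in> ?K" "h \<in> ?K" for g h
    using that RK FR len by auto
  ultimately show ?thesis
    unfolding rows.reduced_cliques_def rows.cliques_def
    by (intro CollectI conjI subsetI ballI equals0I; (elim IntE)?) (simp_all only: mem_Collect_eq)
qed

text \<open>Since \<open>replicate n False\<close> is the least list, compatibility with \<open>True # replicate n False\<close>
  forces every other head bit to be \<open>True\<close>.\<close>

lemma clique_link_cone:
  "clique_link (Suc n) (insert (True # replicate n False) (Cons True ` K)) = Cons True ` clique_link n K"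
proof -
  let ?F = "replicate n False" and ?K = "insert (True # replicate n False) (Cons True ` K)"
  have "h \<in> clique_link (Suc n) ?K \<longleftrightarrow> h \<in> Cons True ` clique_link n K" for h
  proof (cases "length h = Suc n")
    case True
    then obtain x g where h: "h = x # g" "length g = n" by (cases h) auto
    have gF: "row_compatible g ?F" using rows.R_constant[of g False] h by simp
    have Cons_iff: "True # g \<in> Cons True ` A \<longleftrightarrow> g \<in> A" for A by auto
    show ?thesis
    proof (cases x)
      case True
      then have "h \<in> clique_link (Suc n) ?K \<longleftrightarrow> g \<in> clique_link n K"
        using h gF by (auto simp: clique_link_def rows.constants_def)
      then show ?thesis using h True Cons_iff by simp
    next
      case False
      have "\<not> row_compatible (False # g) (True # ?F)" if "g \<noteq> ?F"
        using rows.lt_least[of g] h that by simp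
      then have "h \<notin> clique_link (Suc n) ?K"
        using h False by (auto simp: clique_link_def rows.constants_def)
      then show ?thesis using h False by auto
    qed
  qed (auto simp: clique_link_def)
  then show ?thesis by blast
qed

text \<open>A clique whose corresponding face, of dimension 2, is a pentagon.\<close>

fun pentagon_clique :: "nat \<Rightarrow> bool list set" where
  "pentagon_clique 0 = {[False, True, False, True]}"
| "pentagon_clique (Suc m) = insert (True # replicate (m + 4) False) (Cons True ` pentagon_clique m)"

lemma pentagon_clique_reduced: "pentagon_clique m \<in> rows.reduced_cliques (m + 4)"
proof (induction m)
  case 0
  then show ?case
    by (simp add: rows.reduced_cliques_def rows.cliques_def rows.constants_def eval_nat_numeral)
next
  case (Suc m)
  then show ?case using cone_clique_reduced[of "pentagon_clique m" "m + 4"] unfolding add_Suc by simp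
qed

text \<open>Length 4 means \<open>c = 3\<close>, where a single list gives a face of dimension 2;
  its five neighbours are found by testing all sixteen lists. Longer lengths inherit the number
  through the injective map \<open>Cons True\<close>.\<close>

lemma card_clique_link_pentagon: "card (clique_link (m + 4) (pentagon_clique m)) = 5"
proof (induction m)
  case 0
  have "h \<in> clique_link 4 (pentagon_clique 0) \<longleftrightarrow> h \<in> {[False, True, True, True], [True, True, False, False],
     [False, False, False, True], [False, True, False, False], [True, True, False, True]}" for h
  proof (cases "length h = 4")
    case True
    then obtain x y z w where "h = [x, y, z, w]" by (auto simp: eval_nat_numeral length_Suc_conv)
    then show ?thesis
      by (cases x; cases y; cases z; cases w)
        (simp_all add: clique_link_def rows.constants_def eval_nat_numeral)
  qed (auto simp: clique_link_def)
  then have "clique_link 4 (pentagon_clique 0) = {[False, True, True, True], [True, True, False, False],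
     [False, False, False, True], [False, True, False, False], [True, True, False, True]}"
    by blast
  then show ?case by simp
next
  case (Suc m)
  then show ?case unfolding add_Suc pentagon_clique.simps clique_link_cone by (simp add: card_image)
qed

lemma card_simplex_covers_pentagon:
  "card (simplex_covers (rows.reduced_cliques (m + 4)) (pentagon_clique m)) = 5"
proof -
  let ?K = "pentagon_clique m" and ?n = "m + 4"
  have K: "?K \<in> rows.reduced_cliques ?n" by (rule pentagon_clique_reduced)
  have "{h. h \<notin> ?K \<and> insert h ?K \<in> rows.reduced_cliques ?n} = clique_link ?n ?K"
  proof (intro set_eqI iffI)
    fix h assume h: "h \<in> clique_link ?n ?K"
    have "row_compatible k h" if "k \<in> ?K" for k
      using h K that rows.R_sym[of h k]
      by (auto simp: clique_link_def rows.reduced_cliques_def rows.cliques_def)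
    then show "h \<in> {h. h \<notin> ?K \<and> insert h ?K \<in> rows.reduced_cliques ?n}"
      using h K rows.R_refl[of h]
      by (auto simp: clique_link_def rows.reduced_cliques_def rows.cliques_def)
  qed (auto simp: clique_link_def rows.reduced_cliques_def rows.cliques_def)
  moreover have "finite J" if "J \<in> rows.reduced_cliques ?n" for J
    using that rows.finite_clique by (auto simp: rows.reduced_cliques_def)
  ultimately show ?thesis
    using card_simplex_covers[of "rows.reduced_cliques ?n" ?K] K card_clique_link_pentagon by simp
qed

theorem theorem9p2:
  fixes c :: nat
    and lab :: "'e::finite \<Rightarrow> edge"
    and q :: "real ^ 'e \<Rightarrow> 'q::euclidean_space"
    and M :: "'q set"
  assumes "c \<ge> 1"
    and "bij_betw lab UNIV (edges c)"
    and "quotient_projection (balanced_flows c lab) (exceptional_span c lab) q"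
    and "polytope M"
    and "normal_fan M = DKK_red c lab q"
    and "CARD('n::finite) = c + 1"
  shows "(\<forall>i\<le>c. num_faces i M = num_faces i (permutohedron :: (real ^ 'n) set)) \<and>
         (c \<ge> 3 \<longrightarrow> \<not> combinatorially_isomorphic M (permutohedron :: (real ^ 'n) set))"
proof -
  interpret mutoperhedron c lab q M using assms by unfold_locales
  let ?\<K> = "rows.reduced_cliques (Suc c)" and ?\<C> = "proper_chains :: 'n set set set"
  let ?P = "permutohedron :: (real ^ 'n) set"
  interpret M: simplicial_normal_fan M ray "{0}" ?\<K> by (rule mutoperhedron_fan)
  interpret P: simplicial_normal_fan ?P set_vector diagonal ?\<C> by (rule permutohedron_fan)
  \<comment> \<open>Both complexes consist of lists of length \<open>c + 1\<close>: a good route has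
    that many blue edges, and the index type has that many elements.\<close>
  have count: "card {K \<in> ?\<K>. card K = k} = card {K \<in> ?\<C>. card K = k}" for k
    using card_reduced_cliques_universal[OF rows.head_extension_complex_axioms
        chains.head_extension_complex_axioms, of "Suc c" k] card_proper_chains[where 'n='n, of k] assms(6)
    by simp
  \<comment> \<open>Equal counts in each size make the same sizes occur, so the maximum in
    \<open>num_faces_eq\<close> is the same for both polytopes.\<close>
  have "card ` ?\<K> = card ` ?\<C>"
  proof -
    have "k \<in> card ` ?\<K> \<longleftrightarrow> k \<in> card ` ?\<C>" for k
    proof -
      have "k \<in> card ` ?\<K> \<longleftrightarrow> card {K \<in> ?\<K>. card K = k} \<noteq> 0"
        using M.finite_complex by (subst card_eq_0_iff) auto
      also have "\<dots> \<longleftrightarrow> k \<in> card ` ?\<C>"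
        unfolding count using P.finite_complex by (subst card_eq_0_iff) auto
      finally show ?thesis .
    qed
    then show ?thesis by blast
  qed
  moreover define d where "d = Max (card ` ?\<K>)"
  ultimately have d: "Max (card ` ?\<C>) = d" by simp
  have faces: "num_faces i M = num_faces i ?P" for i
  proof (cases "i \<le> d")
    case True
    have *: "card K + i = d \<longleftrightarrow> card K = d - i" for K :: "bool list set" using True by auto
    have **: "card K + i = d \<longleftrightarrow> card K = d - i" for K :: "'n set set" using True by auto
    show ?thesis
      unfolding M.num_faces_eq P.num_faces_eq d d_def[symmetric] * ** by (rule count)
  next
    case False
    then show ?thesis unfolding M.num_faces_eq P.num_faces_eq d d_def[symmetric] by simp
  qed
  moreover have "\<not> combinatorially_isomorphic M ?P" if "c \<ge> 3"
  proof
    assume iso: "combinatorially_isomorphic M ?P"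
    \<comment> \<open>The cliques of the example start at length 4, which is where the bound
      \<open>c \<ge> 3\<close> comes from.\<close>
    have "Suc c = (c - 3) + 4" using \<open>c \<ge> 3\<close> by simp
    then obtain m where m: "Suc c = m + 4" by blast
    have "pentagon_clique m \<in> ?\<K>" unfolding m by (rule pentagon_clique_reduced)
    then obtain B where "B \<in> ?\<C>" "card (simplex_covers ?\<C> B) = 5"
      using combinatorially_isomorphic_simplex_covers[OF mutoperhedron_fan permutohedron_fan iso]
        card_simplex_covers_pentagon[of m] unfolding m by metis
    then show False using even_card_chain_covers[of B] by simp
  qed
  ultimately show ?thesis by blast
qed

end
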